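(* Let $\Gamma$ be a Conrad orderable group having infinitely many left-invariant total orders. Then every neighborhood in $\mathcal{O}(\Gamma)$ of every Conradian order on $\Gamma$ contains a homeomorphic copy of the Cantor set.
   Context: An ordering on a group $\Gamma$ is a left-invariant total order on $\Gamma$. $\mathcal{O}(\Gamma)$ denotes the set of all orderings on $\Gamma$, endowed with the topology having as sub-basis the sets $U_{f,g} = \{\preceq \,:\, f \prec g\}$, $f,g \in \Gamma$, $f\neq g$. An ordering $\preceq$ is Conradian if for all $f \succ id$, $g\succ id$ there exists $n\in\mathbb{N}$ with $fg^n\succ g$; a group is Conrad orderable if it admits a Conradian ordering. No countability of $\Gamma$ is assumed. *)

theory Defs
  imports "HOL-Algebra.Group" "HOL-Analysis.Analysis"
begin

definition strictly :: "'a rel \<Rightarrow> 'a \<Rightarrow> 'a \<Rightarrow> bool"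
  where "strictly r f g \<longleftrightarrow> (f, g) \<in> r \<and> f \<noteq> g"

text \<open>\<^const>\<open>linear_order_on\<close> includes \<open>r \<subseteq> carrier G \<times> carrier G\<close>, so each ordering of the group
  is represented by exactly one relation.\<close>

definition orderings :: "('a, 'b) monoid_scheme \<Rightarrow> 'a rel set"
  where "orderings G =
    {r. linear_order_on (carrier G) r \<and>
        (\<forall>f\<in>carrier G. \<forall>g\<in>carrier G. \<forall>h\<in>carrier G.
           (f, g) \<in> r \<longrightarrow> (h \<otimes>\<^bsub>G\<^esub> f, h \<otimes>\<^bsub>G\<^esub> g) \<in> r)}"

text \<open>The whole space is added to the sub-basis as the empty intersection, because
  \<^const>\<open>topology_generated_by\<close> takes the union of the sub-basis as its carrier. This only
  matters for the trivial group, which has one ordering and no pair \<open>f \<noteq> g\<close>.\<close>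

definition orderings_topology :: "('a, 'b) monoid_scheme \<Rightarrow> 'a rel topology"
  where "orderings_topology G = topology_generated_by
    (insert (orderings G)
      {{r \<in> orderings G. strictly r f g} | f g. f \<in> carrier G \<and> g \<in> carrier G \<and> f \<noteq> g})"

definition conradian :: "('a, 'b) monoid_scheme \<Rightarrow> 'a rel \<Rightarrow> bool"
  where "conradian G r \<longleftrightarrow> r \<in> orderings G \<and>
    (\<forall>f\<in>carrier G. \<forall>g\<in>carrier G. strictly r \<one>\<^bsub>G\<^esub> f \<longrightarrow> strictly r \<one>\<^bsub>G\<^esub> g \<longrightarrow>
       (\<exists>n::nat. strictly r g (f \<otimes>\<^bsub>G\<^esub> g [^]\<^bsub>G\<^esub> n)))"

definition conrad_orderable :: "('a, 'b) monoid_scheme \<Rightarrow> bool"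
  where "conrad_orderable G \<longleftrightarrow> (\<exists>r. conradian G r)"

definition neighborhood_of :: "'a topology \<Rightarrow> 'a \<Rightarrow> 'a set \<Rightarrow> bool"
  where "neighborhood_of X x N \<longleftrightarrow>
    N \<subseteq> topspace X \<and> (\<exists>U. openin X U \<and> x \<in> U \<and> U \<subseteq> N)"

text \<open>Removing the open middle third of every interval of a stage of the middle-thirds
  construction yields the two copies of that stage scaled by \<open>1/3\<close>.\<close>

primrec cantor_stage :: "nat \<Rightarrow> real set"
  where
    "cantor_stage 0 = {0..1}"
  | "cantor_stage (Suc n) =
       (\<lambda>x. x / 3) ` cantor_stage n \<union> (\<lambda>x. (x + 2) / 3) ` cantor_stage n"

definition cantor_set :: "real set"
  where "cantor_set = (\<Inter>n. cantor_stage n)"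

end

theory Submission
  imports Defs "HOL-Algebra.Coset"
begin

text \<open>
  Left orders correspond to positive cones, so a neighborhood of an order \<open>r\<close> is given by a finite
  set \<open>F\<close> of \<open>r\<close>-positive elements, and a continuous injection of the Cantor set into the cones
  containing \<open>F\<close> is wanted. Modifying an order on a jump between convex subgroups gives another
  order, which reduces the problem to the jumps.

  If there are infinitely many convex jumps, those not met by \<open>F\<close> can be reversed independently.
  By Conrad's theorem the jumps \<open>D \<subset> C\<close> of a Conradian order have \<open>D\<close> normal in \<open>C\<close> and \<open>C/D\<close>
  archimedean, hence abelian. If such a \<open>C/D\<close> has rank at least two, none of its orders is isolated,
  and a binary tree of choices in a countable subgroup gives the Cantor set.

  Otherwise the order has finitely many convex subgroups and all jumps have rank one. If every
  convex subgroup stays convex for all orders, an order is determined by finitely many signs, so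
  there are finitely many orders. If not, let \<open>H\<close> be the smallest convex subgroup on which this
  fails and \<open>L \<subset> K \<subset> H\<close> the last two jumps. Then \<open>L\<close> is normal in \<open>H\<close>, and \<open>H\<close> acts on the rank
  one group \<open>K/L\<close> by rational multiplication factors. A negative factor would force \<open>K\<close> to be
  convex for all orders. If all factors are \<open>1\<close>, then \<open>H/L\<close> is abelian of rank two. In the
  remaining case \<open>H/L\<close> acts on the line by affine maps, and the orders obtained by following
  irrational points near infinity form a family without isolated points near the given one.
\<close>

text \<open>The group may be uncountable, so the space of orders need not be metrizable and
  perfect-set theorems for Polish spaces do not apply directly. The binary tree therefore runs over
  a countable set of test elements that decide membership for the whole family: in the abelian case
  a countable isolated subgroup, outside which the order is kept fixed; in the affine case one
  representative for each pair of rational factor and translation. The Conradian condition concerns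
  the given order alone, while the orders of the space are arbitrary. Convexity must therefore be
  controlled in all left orders of a subgroup: this serves to count the orders at the end, and also
  to see that \<open>L\<close> is normal in \<open>H\<close>, by conjugating an order of
  \<open>K\<close>. The argument fixes a finite \<open>F\<close> and assumes that no Cantor family
  of cones contains \<open>F\<close>. Each structural property of the given order (finitely many
  spans, rank one jumps, convexity in all orders) is extracted from this absence, until only
  finitely many orders remain.\<close>

subsection \<open>Relative cones\<close>

text \<open>\<open>P\<close> is the set of positive elements outside \<open>D\<close> for a left order on \<open>C\<close> in which \<open>D\<close> is a
  convex subgroup; the order on \<open>D\<close> itself is left open.\<close>

definition rel_cone :: "('a, 'b) monoid_scheme \<Rightarrow> 'a set \<Rightarrow> 'a set \<Rightarrow> 'a set \<Rightarrow> bool"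
  where "rel_cone G D C P \<longleftrightarrow>
    subgroup D G \<and> subgroup C G \<and> D \<subseteq> C \<and> P \<subseteq> C - D \<and>
    (\<forall>x\<in>P. \<forall>y\<in>P. x \<otimes>\<^bsub>G\<^esub> y \<in> P) \<and>
    (\<forall>x\<in>P. \<forall>d\<in>D. d \<otimes>\<^bsub>G\<^esub> x \<in> P \<and> x \<otimes>\<^bsub>G\<^esub> d \<in> P) \<and>
    (\<forall>x\<in>C - D. x \<in> P \<or> inv\<^bsub>G\<^esub> x \<in> P)"

abbreviation cone :: "('a, 'b) monoid_scheme \<Rightarrow> 'a set \<Rightarrow> bool"
  where "cone G P \<equiv> rel_cone G {\<one>\<^bsub>G\<^esub>} (carrier G) P"

text \<open>A continuous injection of \<open>2\<^sup>\<nat>\<close> into the subsets of the group.\<close>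

definition cantor_family :: "((nat \<Rightarrow> bool) \<Rightarrow> 'a set) \<Rightarrow> bool"
  where "cantor_family \<Phi> \<longleftrightarrow>
    inj \<Phi> \<and> (\<forall>x. \<exists>n. \<forall>b b'. (\<forall>i<n. b i = b' i) \<longrightarrow> (x \<in> \<Phi> b \<longleftrightarrow> x \<in> \<Phi> b'))"

text \<open>For \<open>D\<close> trivial and \<open>C\<close> the whole group this puts a Cantor set
  of orders in the neighborhood given by \<open>F\<close>. Other \<open>D\<close> and
  \<open>C\<close> allow the family to be built on a single jump or on a tower of jumps.\<close>

definition cantor_many :: "('a, 'b) monoid_scheme \<Rightarrow> 'a set \<Rightarrow> 'a set \<Rightarrow> 'a set \<Rightarrow> bool"
  where "cantor_many G D C F \<longleftrightarrow>
    (\<exists>\<Phi>. cantor_family \<Phi> \<and> (\<forall>b. rel_cone G D C (\<Phi> b) \<and> F \<subseteq> \<Phi> b))"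

lemma rel_coneD:
  assumes "rel_cone G D C P"
  shows "subgroup D G" "subgroup C G" "D \<subseteq> C" "P \<subseteq> C" "P \<subseteq> carrier G" "C \<subseteq> carrier G"
    and "\<And>x. x \<in> P \<Longrightarrow> x \<notin> D"
    and "\<And>x y. x \<in> P \<Longrightarrow> y \<in> P \<Longrightarrow> x \<otimes>\<^bsub>G\<^esub> y \<in> P"
    and "\<And>x d. x \<in> P \<Longrightarrow> d \<in> D \<Longrightarrow> d \<otimes>\<^bsub>G\<^esub> x \<in> P"
    and "\<And>x d. x \<in> P \<Longrightarrow> d \<in> D \<Longrightarrow> x \<otimes>\<^bsub>G\<^esub> d \<in> P"
    and "\<And>x. x \<in> C \<Longrightarrow> x \<notin> D \<Longrightarrow> x \<in> P \<or> inv\<^bsub>G\<^esub> x \<in> P"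
proof -
  show *: "subgroup D G" "subgroup C G" "D \<subseteq> C" "P \<subseteq> C"
    using assms unfolding rel_cone_def by auto
  show "C \<subseteq> carrier G"
    using *(2) by (rule subgroup.subset)
  with *(4) show "P \<subseteq> carrier G"
    by (rule subset_trans)
qed (use assms in \<open>auto simp: rel_cone_def\<close>)

subsection \<open>Orderings and positive cones\<close>

definition order_of :: "('a, 'b) monoid_scheme \<Rightarrow> 'a set \<Rightarrow> 'a rel"
  where "order_of G P =
    {(x, y). x \<in> carrier G \<and> y \<in> carrier G \<and> (x = y \<or> inv\<^bsub>G\<^esub> x \<otimes>\<^bsub>G\<^esub> y \<in> P)}"

definition pos_cone :: "('a, 'b) monoid_scheme \<Rightarrow> 'a rel \<Rightarrow> 'a set"
  where "pos_cone G r = {x \<in> carrier G. strictly r \<one>\<^bsub>G\<^esub> x}"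

context group
begin

lemma inv_cancel_left [simp]:
  assumes "x \<in> carrier G" "y \<in> carrier G"
  shows "inv x \<otimes> (x \<otimes> y) = y" "x \<otimes> (inv x \<otimes> y) = y"
  using assms by (simp_all flip: m_assoc)

lemma inv_mult_eq_one_iff:
  assumes "x \<in> carrier G" "y \<in> carrier G"
  shows "inv x \<otimes> y = \<one> \<longleftrightarrow> x = y"
  using assms by (metis inv_cancel_left(2) l_inv r_one)

lemma cone_inv:
  assumes "rel_cone G D C P" "x \<in> P"
  shows "inv x \<notin> P"
proof
  assume "inv x \<in> P"
  then have "x \<otimes> inv x \<in> P"
    using assms rel_coneD(8) by metis
  moreover have "x \<in> carrier G"
    using rel_coneD(5)[OF assms(1)] assms(2) by blast
  ultimately show False
    using rel_coneD(7)[OF assms(1), of \<one>] subgroup.one_closed[OF rel_coneD(1)[OF assms(1)]]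
    by simp
qed

lemma strictly_order_of:
  assumes P: "cone G P" and "x \<in> carrier G" "y \<in> carrier G"
  shows "strictly (order_of G P) x y \<longleftrightarrow> inv x \<otimes> y \<in> P"
proof -
  have "\<one> \<notin> P"
    using rel_coneD(7)[OF P, of \<one>] by blast
  then show ?thesis
    using assms(2,3) unfolding strictly_def order_of_def by auto
qed

lemma order_of_in_orderings:
  assumes P: "cone G P"
  shows "order_of G P \<in> orderings G"
proof -
  note PD = rel_coneD[OF P]
  have sub: "order_of G P \<subseteq> carrier G \<times> carrier G"
    unfolding order_of_def by auto
  have refl: "refl_on (carrier G) (order_of G P)"
    unfolding refl_on_def order_of_def by auto
  have trans: "trans (order_of G P)"
  proof (rule transI)
    fix x y z
    assume xy: "(x, y) \<in> order_of G P" and yz: "(y, z) \<in> order_of G P"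
    show "(x, z) \<in> order_of G P"
    proof (cases "x = y \<or> y = z")
      case False
      then have c: "x \<in> carrier G" "y \<in> carrier G" "z \<in> carrier G"
        and "inv x \<otimes> y \<in> P" "inv y \<otimes> z \<in> P"
        using xy yz unfolding order_of_def by auto
      then have "(inv x \<otimes> y) \<otimes> (inv y \<otimes> z) \<in> P"
        using PD(8) by blast
      then show ?thesis
        using c unfolding order_of_def by (simp add: m_assoc)
    qed (use xy yz in auto)
  qed
  have antisym: "antisym (order_of G P)"
  proof (rule antisymI, rule ccontr)
    fix x y
    assume "(x, y) \<in> order_of G P" "(y, x) \<in> order_of G P" "x \<noteq> y"
    then have c: "x \<in> carrier G" "y \<in> carrier G"
      and "inv x \<otimes> y \<in> P" "inv y \<otimes> x \<in> P"
      unfolding order_of_def by auto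
    then have "(inv x \<otimes> y) \<otimes> (inv y \<otimes> x) \<in> P"
      using PD(8) by simp
    then show False
      using c PD(7)[of \<one>] by (simp add: m_assoc)
  qed
  have total: "total_on (carrier G) (order_of G P)"
  proof (rule total_onI)
    fix x y
    assume c: "x \<in> carrier G" "y \<in> carrier G" "x \<noteq> y"
    then have "inv x \<otimes> y \<in> P \<or> inv (inv x \<otimes> y) \<in> P"
      using PD(11) by (simp add: inv_mult_eq_one_iff)
    then show "(x, y) \<in> order_of G P \<or> (y, x) \<in> order_of G P"
      using c unfolding order_of_def by (auto simp: inv_mult_group)
  qed
  have left: "(h \<otimes> f, h \<otimes> g) \<in> order_of G P"
    if "(f, g) \<in> order_of G P" "h \<in> carrier G" for f g h
    using that unfolding order_of_def by (auto simp: inv_mult_group m_assoc)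
  show ?thesis
    unfolding orderings_def linear_order_on_def partial_order_on_def preorder_on_def
    using sub refl trans antisym total left by auto
qed

lemma orderingsD:
  assumes "r \<in> orderings G"
  shows "r \<subseteq> carrier G \<times> carrier G" "trans r" "antisym r" "refl_on (carrier G) r"
    and "total_on (carrier G) r"
    and "\<And>f g h. (f, g) \<in> r \<Longrightarrow> h \<in> carrier G \<Longrightarrow> (h \<otimes> f, h \<otimes> g) \<in> r"
proof -
  show sub: "r \<subseteq> carrier G \<times> carrier G"
    using assms
    unfolding orderings_def linear_order_on_def partial_order_on_def preorder_on_def by auto
  show "(h \<otimes> f, h \<otimes> g) \<in> r" if "(f, g) \<in> r" "h \<in> carrier G" for f g h
    using assms that sub unfolding orderings_def by auto
qed (use assms in
    \<open>auto simp: orderings_def linear_order_on_def partial_order_on_def preorder_on_def\<close>)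

lemma strictly_iff_pos_cone:
  assumes r: "r \<in> orderings G" and c: "f \<in> carrier G" "g \<in> carrier G"
  shows "strictly r f g \<longleftrightarrow> inv f \<otimes> g \<in> pos_cone G r"
proof -
  have "(f, g) \<in> r \<longleftrightarrow> (\<one>, inv f \<otimes> g) \<in> r"
  proof
    show "(f, g) \<in> r \<Longrightarrow> (\<one>, inv f \<otimes> g) \<in> r"
      using orderingsD(6)[OF r, of f g "inv f"] c by simp
    show "(\<one>, inv f \<otimes> g) \<in> r \<Longrightarrow> (f, g) \<in> r"
      using orderingsD(6)[OF r, of \<one> "inv f \<otimes> g" f] c by simp
  qed
  then show ?thesis
    using c inv_mult_eq_one_iff[OF c] unfolding pos_cone_def strictly_def by auto
qed

lemma cone_pos_cone:
  assumes r: "r \<in> orderings G"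
  shows "cone G (pos_cone G r)"
proof -
  note rD = orderingsD[OF r]
  have mult: "x \<otimes> y \<in> pos_cone G r" if "x \<in> pos_cone G r" "y \<in> pos_cone G r" for x y
  proof -
    have c: "x \<in> carrier G" "y \<in> carrier G" and x: "(\<one>, x) \<in> r" "x \<noteq> \<one>"
      and y: "(\<one>, y) \<in> r" "y \<noteq> \<one>"
      using that unfolding pos_cone_def strictly_def by auto
    have xy: "(x, x \<otimes> y) \<in> r"
      using rD(6)[OF y(1) c(1)] c by simp
    then have "(\<one>, x \<otimes> y) \<in> r"
      using rD(2) x transD by metis
    moreover have "x \<otimes> y \<noteq> \<one>"
      using xy x rD(3) by (metis antisymD)
    ultimately show ?thesis
      using c unfolding pos_cone_def strictly_def by auto
  qed
  have tot: "x \<in> pos_cone G r \<or> inv x \<in> pos_cone G r" if "x \<in> carrier G" "x \<noteq> \<one>" for x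
  proof (cases "(\<one>, x) \<in> r")
    case False
    then have "(x, \<one>) \<in> r"
      using rD(5) that unfolding total_on_def by auto
    then have "(\<one>, inv x) \<in> r"
      using rD(6)[of x \<one> "inv x"] that by simp
    moreover have "\<one> \<noteq> inv x"
      using that by (metis inv_inv inv_one)
    ultimately show ?thesis
      using that unfolding pos_cone_def strictly_def by blast
  qed (use that in \<open>auto simp: pos_cone_def strictly_def\<close>)
  have sub: "pos_cone G r \<subseteq> carrier G - {\<one>}"
    unfolding pos_cone_def strictly_def by auto
  then have "\<one> \<otimes> x \<in> pos_cone G r \<and> x \<otimes> \<one> \<in> pos_cone G r" if "x \<in> pos_cone G r" for x
    using that by auto
  then show ?thesis
    unfolding rel_cone_def using triv_subgroup subgroup_self mult tot sub by auto
qed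

lemma pos_cone_order_of:
  assumes "cone G P"
  shows "pos_cone G (order_of G P) = P"
proof -
  have "strictly (order_of G P) \<one> x \<longleftrightarrow> x \<in> P" if "x \<in> carrier G" for x
    using strictly_order_of[OF assms, of \<one> x] that by simp
  then show ?thesis
    using rel_coneD(5)[OF assms] unfolding pos_cone_def by blast
qed

lemma order_of_pos_cone:
  assumes r: "r \<in> orderings G"
  shows "order_of G (pos_cone G r) = r"
proof -
  have 1: "(x, x) \<in> r" if "x \<in> carrier G" for x
    using refl_onD[OF orderingsD(4)[OF r] that] .
  have "(x, y) \<in> order_of G (pos_cone G r) \<longleftrightarrow> (x, y) \<in> r"
    if c: "x \<in> carrier G" "y \<in> carrier G" for x y
  proof (cases "x = y")
    case True
    then show ?thesis
      using c 1 by (simp add: order_of_def)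
  next
    case False
    then show ?thesis
      using strictly_iff_pos_cone[OF r c] c by (simp add: order_of_def strictly_def)
  qed
  moreover have "order_of G (pos_cone G r) \<subseteq> carrier G \<times> carrier G"
    unfolding order_of_def by blast
  ultimately show ?thesis
    using orderingsD(1)[OF r] by blast
qed

subsection \<open>The space of orderings\<close>

lemma topspace_orderings [simp]: "topspace (orderings_topology G) = orderings G"
  unfolding orderings_topology_def topology_generated_by_topspace by auto

lemma orderings_basic_open:
  assumes "f \<in> carrier G" "g \<in> carrier G" "f \<noteq> g"
  shows "openin (orderings_topology G) {r \<in> orderings G. strictly r f g}"
  unfolding orderings_topology_def using assms by (intro topology_generated_by_Basis) blast

text \<open>Needed to turn a continuous injection of the compact Cantor set into an embedding. Two
  distinct orders disagree on some pair x, y, and the two sub-basic sets of this pair separate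
  them.\<close>

lemma Hausdorff_orderings: "Hausdorff_space (orderings_topology G)"
  unfolding Hausdorff_space_def topspace_orderings
proof (intro allI impI, elim conjE)
  fix r s
  assume r: "r \<in> orderings G" and s: "s \<in> orderings G" and "r \<noteq> s"
  have less: "strictly r x y \<or> strictly r y x"
    if "r \<in> orderings G" "x \<in> carrier G" "y \<in> carrier G" "x \<noteq> y" for r x y
    using orderingsD(5)[OF that(1)] that unfolding total_on_def strictly_def by blast
  have anti: "\<not> (strictly r x y \<and> strictly r y x)" if "r \<in> orderings G" for r x y
    using orderingsD(3)[OF that] unfolding antisym_def strictly_def by blast
  have "\<exists>x\<in>carrier G. \<exists>y\<in>carrier G. x \<noteq> y \<and> strictly r x y \<and> strictly s y x"
  proof (rule ccontr)
    assume "\<not> ?thesis"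
    then have eq: "strictly r x y \<longleftrightarrow> strictly s x y" if "x \<in> carrier G" "y \<in> carrier G" for x y
      using less[OF r] less[OF s] anti[OF r] anti[OF s] that unfolding strictly_def by meson
    then have "pos_cone G r = pos_cone G s"
      unfolding pos_cone_def by auto
    then show False
      using order_of_pos_cone r s \<open>r \<noteq> s\<close> by metis
  qed
  then obtain x y where xy: "x \<in> carrier G" "y \<in> carrier G" "x \<noteq> y" "strictly r x y" "strictly s y x"
    by blast
  have "disjnt {r \<in> orderings G. strictly r x y} {r \<in> orderings G. strictly r y x}"
    using anti unfolding disjnt_def by auto
  then show "\<exists>U V. openin (orderings_topology G) U \<and> openin (orderings_topology G) V \<and>
      r \<in> U \<and> s \<in> V \<and> disjnt U V"
    using orderings_basic_open[of x y] orderings_basic_open[of y x] xy r s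
    by (intro exI[of _ "{r \<in> orderings G. strictly r x y}"]
        exI[of _ "{r \<in> orderings G. strictly r y x}"]) auto
qed

text \<open>By left invariance, f below g says that \<open>inv f \<otimes> g\<close> is positive, so
  a sub-basic set is one positivity condition and a basic set is finitely many.\<close>

lemma open_contains_cone_nbhd:
  assumes "openin (orderings_topology G) U" "r \<in> U"
  shows "\<exists>F. finite F \<and> F \<subseteq> pos_cone G r \<and>
    (\<forall>P. cone G P \<longrightarrow> F \<subseteq> P \<longrightarrow> order_of G P \<in> U)"
proof -
  define \<S> where "\<S> = insert (orderings G)
      {{r \<in> orderings G. strictly r f g} | f g. f \<in> carrier G \<and> g \<in> carrier G \<and> f \<noteq> g}"
  have "generate_topology_on \<S> U"
    using assms(1) unfolding orderings_topology_def \<S>_def openin_topology_generated_by_iff .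
  then show ?thesis
    using assms(2)
  proof (induction arbitrary: r rule: generate_topology_on.induct)
    case (Int A B)
    obtain FA where "finite FA" "FA \<subseteq> pos_cone G r"
        "\<forall>P. cone G P \<longrightarrow> FA \<subseteq> P \<longrightarrow> order_of G P \<in> A"
      using Int.IH(1)[of r] Int.prems by auto
    moreover obtain FB where "finite FB" "FB \<subseteq> pos_cone G r"
        "\<forall>P. cone G P \<longrightarrow> FB \<subseteq> P \<longrightarrow> order_of G P \<in> B"
      using Int.IH(2)[of r] Int.prems by auto
    ultimately show ?case
      by (intro exI[of _ "FA \<union> FB"]) simp
  next
    case (UN K)
    then obtain k where k: "k \<in> K" "r \<in> k"
      by blast
    obtain F where "finite F" "F \<subseteq> pos_cone G r"
        "\<forall>P. cone G P \<longrightarrow> F \<subseteq> P \<longrightarrow> order_of G P \<in> k"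
      using UN.IH[OF k] by auto
    then show ?case
      using k(1) by (intro exI[of _ F]) auto
  next
    case (Basis A)
    show ?case
    proof (cases "A = orderings G")
      case True
      then show ?thesis
        using order_of_in_orderings by (intro exI[of _ "{}"]) auto
    next
      case False
      then obtain f g where A: "A = {r \<in> orderings G. strictly r f g}"
        and fg: "f \<in> carrier G" "g \<in> carrier G"
        using Basis unfolding \<S>_def by blast
      have "inv f \<otimes> g \<in> pos_cone G r"
        using Basis A fg strictly_iff_pos_cone by auto
      then show ?thesis
        using strictly_order_of[OF _ fg] order_of_in_orderings A
        by (intro exI[of _ "{inv f \<otimes> g}"]) auto
    qed
  qed auto
qed

end

subsection \<open>Ternary digits\<close>

text \<open>The inverse of the two contractions that build \<open>cantor_stage\<close>. The cut at
  1/2 lies in the first removed interval.\<close>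

definition cantor_shift :: "real \<Rightarrow> real"
  where "cantor_shift x = (if x < 1/2 then 3 * x else 3 * x - 2)"

text \<open>With ternary expansions in the digits 0 and 2, True stands for the digit 2.\<close>

definition cantor_digit :: "real \<Rightarrow> nat \<Rightarrow> bool"
  where "cantor_digit x n \<longleftrightarrow> (cantor_shift ^^ n) x > 1/2"

lemma cantor_stage_unit: "cantor_stage n \<subseteq> {0..1}"
  by (induction n) auto

lemma compact_cantor_set: "compact cantor_set"
proof -
  have "compact (cantor_stage n)" for n
    by (induction n) (auto intro!: compact_Un compact_continuous_image continuous_intros)
  then have "closed cantor_set"
    unfolding cantor_set_def by (auto intro: compact_imp_closed)
  moreover have "cantor_set \<subseteq> {0..1}"
    unfolding cantor_set_def using cantor_stage_unit by blast
  ultimately show ?thesis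
    using bounded_subset compact_eq_bounded_closed bounded_closed_interval by blast
qed

text \<open>A point of stage \<open>Suc n\<close> is y/3 or (y + 2)/3 with y in the unit interval.
  The two images lie on different sides of 1/2, so \<open>cantor_shift\<close> recovers y.\<close>

lemma cantor_set_shift:
  assumes "x \<in> cantor_set"
  shows "cantor_shift x \<in> cantor_set" "x \<in> {0..1}" "x \<noteq> 1/2"
proof -
  have st: "cantor_shift x \<in> cantor_stage n \<and> x \<noteq> 1/2" for n
  proof -
    have "x \<in> cantor_stage (Suc n)"
      using assms unfolding cantor_set_def by blast
    then obtain y where "y \<in> cantor_stage n" and "x = y / 3 \<or> x = (y + 2) / 3"
      by auto
    then show ?thesis
      using cantor_stage_unit[of n] unfolding cantor_shift_def by (auto simp: field_simps)
  qed
  then show "cantor_shift x \<in> cantor_set" "x \<noteq> 1/2"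
    unfolding cantor_set_def by blast+
  show "x \<in> {0..1}"
    using assms cantor_stage_unit[of 0] unfolding cantor_set_def by blast
qed

lemma cantor_set_shift_pow: "x \<in> cantor_set \<Longrightarrow> (cantor_shift ^^ n) x \<in> cantor_set"
  by (induction n) (auto simp: cantor_set_shift)

text \<open>The discontinuity at 1/2 is invisible: the two closed halves of the Cantor set are
  disjoint.\<close>

lemma continuous_on_cantor_shift: "continuous_on cantor_set cantor_shift"
proof -
  have eq: "cantor_set = (cantor_set \<inter> {..1/2}) \<union> (cantor_set \<inter> {1/2..})"
    by auto
  have cl: "closed (cantor_set \<inter> {..1/2})" "closed (cantor_set \<inter> {1/2..})"
    using compact_cantor_set by (auto intro: compact_imp_closed)
  have "continuous_on (cantor_set \<inter> {..1/2}) cantor_shift"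
  proof (rule continuous_on_eq[of _ "\<lambda>x. 3 * x"])
    fix x
    assume "x \<in> cantor_set \<inter> {..1/2}"
    then have "x < 1/2"
      using cantor_set_shift(3)[of x] by auto
    then show "3 * x = cantor_shift x"
      by (simp add: cantor_shift_def)
  qed (intro continuous_intros)
  moreover have "continuous_on (cantor_set \<inter> {1/2..}) cantor_shift"
  proof (rule continuous_on_eq[of _ "\<lambda>x. 3 * x - 2"])
    fix x
    assume "x \<in> cantor_set \<inter> {1/2..}"
    then show "3 * x - 2 = cantor_shift x"
      by (simp add: cantor_shift_def)
  qed (intro continuous_intros)
  ultimately show ?thesis
    by (subst eq) (rule continuous_on_closed_Un[OF cl])
qed

lemma openin_cantor_digit:
  "openin (top_of_set cantor_set) {x \<in> cantor_set. cantor_digit x n = v}"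
proof -
  have cont: "continuous_on cantor_set (cantor_shift ^^ n)"
  proof (induction n)
    case (Suc n)
    have "continuous_on cantor_set (cantor_shift \<circ> (cantor_shift ^^ n))"
      using Suc cantor_set_shift_pow
      by (intro continuous_on_compose continuous_on_subset[OF continuous_on_cantor_shift]) auto
    then show ?case
      by (simp add: o_def)
  qed (simp add: id_def)
  have 1: "openin (top_of_set cantor_set) (cantor_set \<inter> (cantor_shift ^^ n) -` {1/2<..})"
    and 2: "openin (top_of_set cantor_set) (cantor_set \<inter> (cantor_shift ^^ n) -` {..<1/2})"
    using cont continuous_openin_preimage_gen open_greaterThan open_lessThan by blast+
  show ?thesis
  proof (cases v)
    case True
    then have "{x \<in> cantor_set. cantor_digit x n = v} = cantor_set \<inter> (cantor_shift ^^ n) -` {1/2<..}"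
      unfolding cantor_digit_def by auto
    then show ?thesis
      using 1 by simp
  next
    case False
    then have "{x \<in> cantor_set. cantor_digit x n = v} = cantor_set \<inter> (cantor_shift ^^ n) -` {..<1/2}"
      using cantor_set_shift(3)[OF cantor_set_shift_pow, of _ n]
      unfolding cantor_digit_def by force
    then show ?thesis
      using 2 by simp
  qed
qed

text \<open>With equal digits both orbits use the same branch at each step, so their distance
  triples each time, while it can never exceed 1.\<close>

lemma cantor_digit_inj:
  assumes "x \<in> cantor_set" "y \<in> cantor_set" and eq: "cantor_digit x = cantor_digit y"
  shows "x = y"
proof (rule ccontr)
  assume "x \<noteq> y"
  have dist: "\<bar>(cantor_shift ^^ n) x - (cantor_shift ^^ n) y\<bar> = 3 ^ n * \<bar>x - y\<bar>" for n
  proof (induction n)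
    case (Suc n)
    let ?x = "(cantor_shift ^^ n) x" and ?y = "(cantor_shift ^^ n) y"
    have "?x > 1/2 \<longleftrightarrow> ?y > 1/2"
      using fun_cong[OF eq, of n] unfolding cantor_digit_def .
    moreover have "?x \<noteq> 1/2" "?y \<noteq> 1/2"
      using assms cantor_set_shift(3) cantor_set_shift_pow by blast+
    ultimately have "cantor_shift ?x - cantor_shift ?y = 3 * (?x - ?y)"
      unfolding cantor_shift_def by auto
    then have "\<bar>cantor_shift ?x - cantor_shift ?y\<bar> = 3 * \<bar>?x - ?y\<bar>"
      by (simp only: abs_mult abs_numeral)
    then show ?case
      using Suc by simp
  qed simp
  obtain n where "1 / \<bar>x - y\<bar> < 3 ^ n"
    using real_arch_pow[of 3 "1 / \<bar>x - y\<bar>"] by auto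
  then have "1 < 3 ^ n * \<bar>x - y\<bar>"
    using \<open>x \<noteq> y\<close> by (simp add: field_simps)
  then have "\<bar>(cantor_shift ^^ n) x - (cantor_shift ^^ n) y\<bar> > 1"
    using dist by simp
  moreover have "(cantor_shift ^^ n) x \<in> {0..1}" "(cantor_shift ^^ n) y \<in> {0..1}"
    using assms cantor_set_shift(2) cantor_set_shift_pow by blast+
  ultimately show False
    by auto
qed

text \<open>The digits of a point of the Cantor set form a bit sequence, so \<Phi> composed with the
  digit map is a continuous injection of a compact space into a Hausdorff space.\<close>

lemma (in group) cantor_many_imp_cantor_set:
  assumes "cantor_many G {\<one>} (carrier G) F"
  shows "\<exists>K. (\<forall>s\<in>K. \<exists>P. cone G P \<and> F \<subseteq> P \<and> s = order_of G P) \<and>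
    subtopology (orderings_topology G) K homeomorphic_space top_of_set cantor_set"
proof -
  obtain \<Phi> where \<Phi>: "cantor_family \<Phi>" and cone: "\<And>b. cone G (\<Phi> b)" "\<And>b. F \<subseteq> \<Phi> b"
    using assms unfolding cantor_many_def by auto
  define \<Theta> where "\<Theta> x = order_of G (\<Phi> (cantor_digit x))" for x
  have ord: "\<Theta> x \<in> orderings G" for x
    unfolding \<Theta>_def using order_of_in_orderings[OF cone(1)] .
  have inj: "inj_on \<Theta> cantor_set"
  proof (rule inj_onI)
    fix x y
    assume "x \<in> cantor_set" "y \<in> cantor_set" "\<Theta> x = \<Theta> y"
    moreover from this have "\<Phi> (cantor_digit x) = \<Phi> (cantor_digit y)"
      unfolding \<Theta>_def by (metis cone(1) pos_cone_order_of)
    ultimately show "x = y"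
      using \<Phi> cantor_digit_inj unfolding cantor_family_def by (metis injD)
  qed
  have cont: "continuous_map (top_of_set cantor_set) (orderings_topology G) \<Theta>"
    unfolding orderings_topology_def
  proof (rule continuous_on_generated_topo)
    fix U
    assume "U \<in> insert (orderings G)
      {{r \<in> orderings G. strictly r f g} | f g. f \<in> carrier G \<and> g \<in> carrier G \<and> f \<noteq> g}"
    then consider "U = orderings G" | f g where "U = {r \<in> orderings G. strictly r f g}"
        "f \<in> carrier G" "g \<in> carrier G"
      by blast
    then show "openin (top_of_set cantor_set) (\<Theta> -` U \<inter> topspace (top_of_set cantor_set))"
    proof cases
      case 1
      then have "\<Theta> -` U = UNIV"
        using ord by auto
      then show ?thesis
        by (metis Int_UNIV_left openin_topspace)
    next
      case 2
      have mem: "\<Theta> x \<in> U \<longleftrightarrow> inv f \<otimes> g \<in> \<Phi> (cantor_digit x)" for x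
        using 2 ord[of x] strictly_order_of[OF cone(1)] unfolding \<Theta>_def by auto
      obtain n where n: "\<And>b b'. (\<forall>i<n. b i = b' i) \<Longrightarrow>
          (inv f \<otimes> g \<in> \<Phi> b \<longleftrightarrow> inv f \<otimes> g \<in> \<Phi> b')"
        using \<Phi> unfolding cantor_family_def by blast
      show ?thesis
      proof (subst openin_subopen, intro ballI)
        fix x
        assume x: "x \<in> \<Theta> -` U \<inter> topspace (top_of_set cantor_set)"
        \<comment> \<open>Membership depends on the first n digits only, so it is constant on the
          cylinder of points that share these digits with x. The intersection with
          \<open>cantor_set\<close> covers n = 0.\<close>
        define T where "T = cantor_set \<inter> \<Inter> ((\<lambda>i. {y \<in> cantor_set. cantor_digit y i = cantor_digit x i}) ` {..<n})"
        have "openin (top_of_set cantor_set) T"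
          unfolding T_def using openin_cantor_digit
          by (cases "n = 0") (auto intro!: openin_Int openin_INT openin_subtopology_self)
        moreover have "x \<in> T"
          using x unfolding T_def by auto
        moreover have "T \<subseteq> \<Theta> -` U \<inter> topspace (top_of_set cantor_set)"
        proof
          fix y
          assume y: "y \<in> T"
          then have "\<forall>i<n. cantor_digit y i = cantor_digit x i"
            unfolding T_def by auto
          then have "\<Theta> y \<in> U"
            using n[of "cantor_digit y" "cantor_digit x"] x mem by auto
          then show "y \<in> \<Theta> -` U \<inter> topspace (top_of_set cantor_set)"
            using y unfolding T_def by auto
        qed
        ultimately show "\<exists>T. openin (top_of_set cantor_set) T \<and> x \<in> T \<and>
            T \<subseteq> \<Theta> -` U \<inter> topspace (top_of_set cantor_set)"
          by blast
      qed
    qed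
  qed (use ord in auto)
  define K where "K = \<Theta> ` cantor_set"
  have K: "K \<subseteq> orderings G"
    unfolding K_def using ord by auto
  have cont': "continuous_map (top_of_set cantor_set) (subtopology (orderings_topology G) K) \<Theta>"
    using cont unfolding K_def continuous_map_in_subtopology by auto
  have "closed_map (top_of_set cantor_set) (subtopology (orderings_topology G) K) \<Theta>"
    using cont' compact_cantor_set
    by (intro continuous_imp_closed_map)
      (auto simp: compact_space_subtopology Hausdorff_orderings intro: Hausdorff_space_subtopology)
  then have "homeomorphic_map (top_of_set cantor_set) (subtopology (orderings_topology G) K) \<Theta>"
    using cont' inj K unfolding K_def
    by (intro bijective_closed_imp_homeomorphic_map) auto
  then have "subtopology (orderings_topology G) K homeomorphic_space top_of_set cantor_set"
    using homeomorphic_map_imp_homeomorphic_space homeomorphic_space_sym by blast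
  moreover have "\<exists>P. cone G P \<and> F \<subseteq> P \<and> s = order_of G P" if "s \<in> K" for s
    using that cone unfolding K_def \<Theta>_def by auto
  ultimately show ?thesis
    by blast
qed

subsection \<open>Families without isolated points\<close>

lemma cantor_scheme:
  fixes \<X> :: "'a set set" and T :: "'a set"
  assumes P0: "P0 \<in> \<X>" and S0: "finite S0"
    and perfect: "\<And>P S. P \<in> \<X> \<Longrightarrow> finite S \<Longrightarrow> \<exists>P'\<in>\<X>. P' \<noteq> P \<and> P' \<inter> S = P \<inter> S"
    and T: "countable T" "\<And>x. \<exists>t\<in>T. \<forall>P\<in>\<X>. x \<in> P \<longleftrightarrow> t \<in> P"
  obtains \<Phi> where "cantor_family \<Phi>"
    and "\<And>b S. finite S \<Longrightarrow> \<exists>P\<in>\<X>. P \<inter> S0 = P0 \<inter> S0 \<and> P \<inter> S = \<Phi> b \<inter> S"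
proof -
  have "T \<noteq> {}"
    using T(2) by blast
  then have e_range: "range (from_nat_into T) = T"
    using T(1) by (rule range_from_nat_into)
  define e where "e = from_nat_into T"
  obtain ch where ch: "\<And>P S. P \<in> \<X> \<Longrightarrow> finite S \<Longrightarrow>
      ch P S \<in> \<X> \<and> ch P S \<noteq> P \<and> ch P S \<inter> S = P \<inter> S"
    using perfect by metis
  have "\<exists>x. x \<in> P \<longleftrightarrow> x \<notin> P'" if "P \<noteq> P'" for P P' :: "'a set"
    using that by auto
  then obtain df where df: "\<And>P P' :: 'a set. P \<noteq> P' \<Longrightarrow> df P P' \<in> P \<longleftrightarrow> df P P' \<notin> P'"
    by metis
  \<comment> \<open>A point on which the two children of a node differ; it is frozen after the
    choice.\<close>
  define split where "split P S = df (ch P S) P" for P S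
  \<comment> \<open>A node is a member of the family with the finite set on which its descendants agree with it.\<close>
  define next_node where "next_node n v = (\<lambda>(P, S).
      (if v then ch P (insert (e n) S) else P, insert (split P (insert (e n) S)) (insert (e n) S)))"
    for n v
  define node where "node b = rec_nat (P0, S0) (\<lambda>n. next_node n (b n))" for b
  define Q where "Q b n = fst (node b n)" for b n
  define R where "R b n = snd (node b n)" for b n
  have node_0: "Q b 0 = P0" "R b 0 = S0" for b
    by (simp_all add: Q_def R_def node_def)
  have node_Suc: "Q b (Suc n) = (if b n then ch (Q b n) (insert (e n) (R b n)) else Q b n)"
    "R b (Suc n) = insert (split (Q b n) (insert (e n) (R b n))) (insert (e n) (R b n))" for b n
    by (simp_all add: Q_def R_def node_def next_node_def case_prod_beta)
  have node: "Q b n \<in> \<X> \<and> finite (R b n)" for b n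
    by (induction n) (use P0 S0 ch in \<open>auto simp: node_0 node_Suc\<close>)
  have cong: "Q b n = Q b' n \<and> R b n = R b' n" if "\<forall>i<n. b i = b' i" for b b' n
    using that by (induction n) (auto simp: node_0 node_Suc)
  have mono: "R b m \<subseteq> R b n" if "m \<le> n" for b m n
    using that by (induction n rule: dec_induct) (auto simp: node_Suc)
  have agree_Suc: "Q b (Suc n) \<inter> insert (e n) (R b n) = Q b n \<inter> insert (e n) (R b n)" for b n
    using ch[of "Q b n" "insert (e n) (R b n)"] node[of b n] by (simp add: node_Suc)
  have agree: "Q b n \<inter> R b m = Q b m \<inter> R b m" if "m \<le> n" for b m n
    using that
  proof (induction n rule: dec_induct)
    case (step n)
    have "R b m \<subseteq> insert (e n) (R b n)"
      using mono[OF step(1)] by blast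
    then have "Q b (Suc n) \<inter> R b m = Q b n \<inter> R b m"
      using agree_Suc[of b n] by blast
    then show ?case
      using step by simp
  qed simp
  have e_R: "e n \<in> R b (Suc n)" for b n
    by (simp add: node_Suc)
  have "\<exists>n. \<forall>P\<in>\<X>. x \<in> P \<longleftrightarrow> e n \<in> P" for x
    using T(2)[of x] e_range unfolding e_def by (metis rangeE)
  then obtain idx where idx: "\<And>x P. P \<in> \<X> \<Longrightarrow> x \<in> P \<longleftrightarrow> e (idx x) \<in> P"
    by metis
  \<comment> \<open>\<open>e n\<close> is frozen from stage \<open>Suc n\<close> on, so x is decided
    at stage \<open>Suc (idx x)\<close>.\<close>
  define \<Phi> where "\<Phi> b = {x. x \<in> Q b (Suc (idx x))}" for b
  have \<Phi>_Q: "x \<in> \<Phi> b \<longleftrightarrow> x \<in> Q b n" if "Suc (idx x) \<le> n" for x b n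
  proof -
    have "x \<in> Q b n \<longleftrightarrow> e (idx x) \<in> Q b n"
      using idx node by blast
    also have "\<dots> \<longleftrightarrow> e (idx x) \<in> Q b (Suc (idx x))"
      using agree[OF that, of b] e_R[of "idx x" b] by blast
    also have "\<dots> \<longleftrightarrow> x \<in> \<Phi> b"
      using idx node unfolding \<Phi>_def by blast
    finally show ?thesis
      by blast
  qed
  have \<Phi>_R: "x \<in> \<Phi> b \<longleftrightarrow> x \<in> Q b n" if "x \<in> R b n" for x b n
  proof -
    have "x \<in> \<Phi> b \<longleftrightarrow> x \<in> Q b (max n (Suc (idx x)))"
      by (rule \<Phi>_Q) simp
    also have "\<dots> \<longleftrightarrow> x \<in> Q b n"
      using agree[of n "max n (Suc (idx x))" b] that by auto
    finally show ?thesis .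
  qed
  have "inj \<Phi>"
  proof (rule injI, rule ccontr)
    fix b b'
    assume eq: "\<Phi> b = \<Phi> b'" and "b \<noteq> b'"
    then have "\<exists>n. b n \<noteq> b' n"
      by auto
    then obtain n where n: "b n \<noteq> b' n" and "\<forall>i<n. b i = b' i"
      using exists_least_iff[of "\<lambda>n. b n \<noteq> b' n"] by auto
    then have same: "Q b n = Q b' n" "R b n = R b' n"
      using cong by blast+
    define s where "s = split (Q b n) (insert (e n) (R b n))"
    have "s \<in> ch (Q b n) (insert (e n) (R b n)) \<longleftrightarrow> s \<notin> Q b n"
      using ch[of "Q b n" "insert (e n) (R b n)"] node[of b n] df unfolding s_def split_def by auto
    then have "s \<in> Q b (Suc n) \<longleftrightarrow> s \<notin> Q b' (Suc n)"
      using n same by (auto simp: node_Suc)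
    moreover have "s \<in> R b (Suc n)" "s \<in> R b' (Suc n)"
      using same by (simp_all add: node_Suc s_def)
    ultimately show False
      using \<Phi>_R eq by blast
  qed
  moreover have "\<exists>n. \<forall>b b'. (\<forall>i<n. b i = b' i) \<longrightarrow> (x \<in> \<Phi> b \<longleftrightarrow> x \<in> \<Phi> b')" for x
  proof (intro exI allI impI)
    fix b b' :: "nat \<Rightarrow> bool"
    assume "\<forall>i<Suc (idx x). b i = b' i"
    then show "x \<in> \<Phi> b \<longleftrightarrow> x \<in> \<Phi> b'"
      unfolding \<Phi>_def using cong by blast
  qed
  ultimately have "cantor_family \<Phi>"
    unfolding cantor_family_def by blast
  moreover have "\<exists>P\<in>\<X>. P \<inter> S0 = P0 \<inter> S0 \<and> P \<inter> S = \<Phi> b \<inter> S" if "finite S" for b S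
  proof (intro bexI conjI)
    \<comment> \<open>A stage at which all of the finite set \<open>S\<close> is already decided;
      its node is the required member.\<close>
    define n where "n = Max (insert 0 ((\<lambda>x. Suc (idx x)) ` S))"
    have "Suc (idx x) \<le> n" if "x \<in> S" for x
      unfolding n_def using that \<open>finite S\<close> by (intro Max_ge) auto
    then show "Q b n \<inter> S = \<Phi> b \<inter> S"
      using \<Phi>_Q by blast
    show "Q b n \<inter> S0 = P0 \<inter> S0"
      using agree[of 0 n b] by (simp add: node_0)
    show "Q b n \<in> \<X>"
      using node by blast
  qed
  ultimately show thesis
    by (rule that)
qed

context group
begin

lemma rel_coneI:
  assumes "subgroup D G" "subgroup C G" "D \<subseteq> C" "P \<subseteq> C" "P \<inter> D = {}"
    and "\<And>x y. x \<in> P \<Longrightarrow> y \<in> P \<Longrightarrow> x \<otimes> y \<in> P"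
    and "\<And>x d. x \<in> P \<Longrightarrow> d \<in> D \<Longrightarrow> d \<otimes> x \<in> P"
    and "\<And>x d. x \<in> P \<Longrightarrow> d \<in> D \<Longrightarrow> x \<otimes> d \<in> P"
    and "\<And>x. x \<in> C \<Longrightarrow> x \<notin> D \<Longrightarrow> x \<notin> P \<Longrightarrow> inv x \<in> P"
  shows "rel_cone G D C P"
  unfolding rel_cone_def using assms(1-5)
  by (intro conjI ballI) (auto intro: assms(6-9))

text \<open>Each cone axiom concerns at most three elements at a time, so it passes to a set that
  agrees with some cone on every finite set.\<close>

lemma rel_cone_limit:
  assumes sub: "subgroup D G" "subgroup C G" "D \<subseteq> C"
    and lim: "\<And>S. finite S \<Longrightarrow> \<exists>P. rel_cone G D C P \<and> P \<inter> S = Q \<inter> S"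
  shows "rel_cone G D C Q"
proof -
  have 3: "\<exists>P. rel_cone G D C P \<and> (x \<in> P \<longleftrightarrow> x \<in> Q) \<and> (y \<in> P \<longleftrightarrow> y \<in> Q) \<and> (z \<in> P \<longleftrightarrow> z \<in> Q)"
    for x y z
    using lim[of "{x, y, z}"] by (auto simp: set_eq_iff)
  show ?thesis
  proof (rule rel_coneI[OF sub])
    show "Q \<subseteq> C"
      using 3 rel_coneD(4) by blast
    show "Q \<inter> D = {}"
      using 3 rel_coneD(7) by (metis disjoint_iff)
    show "x \<otimes> y \<in> Q" if "x \<in> Q" "y \<in> Q" for x y
      using 3[of x y "x \<otimes> y"] rel_coneD(8) that by metis
    show "d \<otimes> x \<in> Q" if "x \<in> Q" "d \<in> D" for x d
      using 3[of x x "d \<otimes> x"] rel_coneD(9) that by metis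
    show "x \<otimes> d \<in> Q" if "x \<in> Q" "d \<in> D" for x d
      using 3[of x x "x \<otimes> d"] rel_coneD(10) that by metis
    show "inv x \<in> Q" if "x \<in> C" "x \<notin> D" "x \<notin> Q" for x
      using 3[of x x "inv x"] rel_coneD(11) that by metis
  qed
qed

text \<open>\<open>F\<close> is frozen at the root of the tree, so every limit agrees with
  \<open>P0\<close> on \<open>F\<close>.\<close>

lemma cantor_manyI:
  assumes P0: "rel_cone G D C P0" "P0 \<in> \<X>" and \<X>: "\<And>P. P \<in> \<X> \<Longrightarrow> rel_cone G D C P"
    and F: "finite F" "F \<subseteq> P0"
    and perfect: "\<And>P S. P \<in> \<X> \<Longrightarrow> finite S \<Longrightarrow> \<exists>P'\<in>\<X>. P' \<noteq> P \<and> P' \<inter> S = P \<inter> S"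
    and T: "countable T" "\<And>x. \<exists>t\<in>T. \<forall>P\<in>\<X>. x \<in> P \<longleftrightarrow> t \<in> P"
  shows "cantor_many G D C F"
proof -
  obtain \<Phi> where \<Phi>: "cantor_family \<Phi>"
    and lim: "\<And>b S. finite S \<Longrightarrow> \<exists>P\<in>\<X>. P \<inter> F = P0 \<inter> F \<and> P \<inter> S = \<Phi> b \<inter> S"
    using cantor_scheme[OF P0(2) F(1) perfect T] by blast
  have "rel_cone G D C (\<Phi> b)" for b
    using lim \<X> by (intro rel_cone_limit rel_coneD(1,2,3)[OF P0(1)]) metis
  moreover have "F \<subseteq> \<Phi> b" for b
    using lim[OF F(1), of b] F(2) by blast
  ultimately show ?thesis
    unfolding cantor_many_def using \<Phi> by blast
qed

section \<open>Powers, composition, restriction and reversal of relative cones\<close>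

lemma cone_pow:
  assumes P: "rel_cone G D C P" and x: "x \<in> P" and n: "0 < (n::nat)"
  shows "x [^] n \<in> P"
proof -
  have "x \<in> carrier G"
    using rel_coneD(5)[OF P] x by blast
  have "x [^] Suc k \<in> P" for k
  proof (induction k)
    case 0
    then show ?case
      using x \<open>x \<in> carrier G\<close> by simp
  next
    case (Suc k)
    then show ?case
      using rel_coneD(8)[OF P Suc x] by simp
  qed
  then show ?thesis
    using n gr0_implies_Suc by blast
qed

lemma cone_inv_pow:
  assumes P: "rel_cone G D C P" and x: "x \<in> carrier G" "inv x \<in> P" and n: "0 < (n::nat)"
  shows "inv (x [^] n) \<in> P"
  using cone_pow[OF P x(2) n] x(1) by (simp add: nat_pow_inv)

lemma cone_pow_iff:
  assumes P: "rel_cone G D C P" and x: "x \<in> C" "x \<notin> D" and n: "0 < (n::nat)"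
  shows "x [^] n \<in> P \<longleftrightarrow> x \<in> P"
proof
  assume "x [^] n \<in> P"
  then have "inv (x [^] n) \<notin> P"
    by (rule cone_inv[OF P])
  moreover have "x \<in> carrier G"
    using rel_coneD(6)[OF P] x by blast
  ultimately have "inv x \<notin> P"
    using cone_inv_pow[OF P _ _ n, of x] by blast
  then show "x \<in> P"
    using rel_coneD(11)[OF P x] by blast
qed (rule cone_pow[OF P _ n])

text \<open>Outside \<open>D\<close> either x or its inverse would be positive, and positive
  elements have positive powers, which avoid \<open>D\<close>. For trivial \<open>D\<close> this is
  torsion-freeness.\<close>

lemma cone_isolated:
  assumes P: "rel_cone G D C P" and x: "x \<in> C" "x [^] n \<in> D" and n: "0 < (n::nat)"
  shows "x \<in> D"
proof (rule ccontr)
  assume "x \<notin> D"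
  have c: "x \<in> carrier G"
    using rel_coneD(6)[OF P] x(1) by blast
  have "inv (x [^] n) \<in> D"
    using x(2) rel_coneD(1)[OF P] by (simp add: subgroup.m_inv_closed)
  then show False
    using rel_coneD(11)[OF P x(1) \<open>x \<notin> D\<close>] cone_pow[OF P _ n, of x]
      cone_inv_pow[OF P c _ n] rel_coneD(7)[OF P] x(2) by blast
qed

text \<open>The lexicographic order: \<open>Q\<close> decides outside \<open>B\<close>, and
  \<open>P\<close> inside. A mixed product has the sign of its factor outside \<open>B\<close>,
  because \<open>Q\<close> absorbs \<open>B\<close> on both sides.\<close>

lemma rel_cone_trans:
  assumes P: "rel_cone G D B P" and Q: "rel_cone G B C Q"
  shows "rel_cone G D C (P \<union> Q)"
proof -
  note PD = rel_coneD[OF P] and QD = rel_coneD[OF Q]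
  show ?thesis
  proof (rule rel_coneI)
    show "subgroup D G" "subgroup C G" "D \<subseteq> C" "P \<union> Q \<subseteq> C" "(P \<union> Q) \<inter> D = {}"
      using PD QD by auto
    show "x \<otimes> y \<in> P \<union> Q" if "x \<in> P \<union> Q" "y \<in> P \<union> Q" for x y
      using that PD(4,8) QD(8,9,10) by blast
    show "d \<otimes> x \<in> P \<union> Q" "x \<otimes> d \<in> P \<union> Q" if "x \<in> P \<union> Q" "d \<in> D" for x d
      using that PD(3,9,10) QD(9,10) by blast+
    show "inv x \<in> P \<union> Q" if "x \<in> C" "x \<notin> D" "x \<notin> P \<union> Q" for x
      using that PD(11)[of x] QD(11)[of x] by blast
  qed
qed

lemma rel_cone_restrict:
  assumes P: "rel_cone G D C P" and B: "subgroup B G" "D \<subseteq> B" "B \<subseteq> C"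
  shows "rel_cone G D B (P \<inter> B)"
proof -
  note PD = rel_coneD[OF P]
  show ?thesis
  proof (rule rel_coneI)
    show "x \<otimes> y \<in> P \<inter> B" if "x \<in> P \<inter> B" "y \<in> P \<inter> B" for x y
      using that PD(8) subgroup.m_closed[OF B(1)] by blast
    show "d \<otimes> x \<in> P \<inter> B" "x \<otimes> d \<in> P \<inter> B" if "x \<in> P \<inter> B" "d \<in> D" for x d
      using that PD(9,10) subgroup.m_closed[OF B(1)] B(2) by blast+
    show "inv x \<in> P \<inter> B" if "x \<in> B" "x \<notin> D" "x \<notin> P \<inter> B" for x
      using that PD(11)[of x] B(3) subgroup.m_inv_closed[OF B(1)] by blast
  qed (use PD B in auto)
qed

lemma rel_cone_inverse:
  assumes P: "rel_cone G D C P"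
  shows "rel_cone G D C {x \<in> C. inv x \<in> P}"
proof -
  note PD = rel_coneD[OF P]
  note cl = subgroup.m_closed[OF PD(2)] subgroup.m_inv_closed[OF PD(2)]
    subgroup.m_inv_closed[OF PD(1)]
  have c: "x \<in> carrier G" if "x \<in> C" for x
    using PD(6) that by blast
  show ?thesis
  proof (rule rel_coneI)
    show "{x \<in> C. inv x \<in> P} \<inter> D = {}"
      using cl(3) PD(7) by blast
    show "x \<otimes> y \<in> {x \<in> C. inv x \<in> P}"
      if "x \<in> {x \<in> C. inv x \<in> P}" "y \<in> {x \<in> C. inv x \<in> P}" for x y
      using that c cl PD(8) by (simp add: inv_mult_group)
    show "d \<otimes> x \<in> {x \<in> C. inv x \<in> P}" "x \<otimes> d \<in> {x \<in> C. inv x \<in> P}"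
      if "x \<in> {x \<in> C. inv x \<in> P}" "d \<in> D" for x d
    proof -
      have "d \<in> C"
        using PD(3) that by blast
      then show "d \<otimes> x \<in> {x \<in> C. inv x \<in> P}" "x \<otimes> d \<in> {x \<in> C. inv x \<in> P}"
        using that c cl PD(9,10) by (simp_all add: inv_mult_group)
    qed
    show "inv x \<in> {x \<in> C. inv x \<in> P}" if "x \<in> C" "x \<notin> D" "x \<notin> {x \<in> C. inv x \<in> P}" for x
      using that c cl PD(11)[of x] by auto
  qed (use PD in auto)
qed

text \<open>Only the layer \<open>C - D\<close> varies. The three layers are disjoint, so adding the
  fixed parts preserves injectivity.\<close>

lemma cantor_many_extend:
  assumes D: "rel_cone G E D P" and C: "rel_cone G C B Q"
    and many: "cantor_many G D C F" and F': "F' \<subseteq> P \<union> F \<union> Q"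
  shows "cantor_many G E B F'"
proof -
  obtain \<Phi> where \<Phi>: "cantor_family \<Phi>" "\<And>b. rel_cone G D C (\<Phi> b)" "\<And>b. F \<subseteq> \<Phi> b"
    using many unfolding cantor_many_def by blast
  define \<Psi> where "\<Psi> b = P \<union> \<Phi> b \<union> Q" for b
  have \<Phi>D: "\<Phi> b \<inter> D = {}" "\<Phi> b \<subseteq> C" for b
    using rel_coneD(4,7)[OF \<Phi>(2)] by blast+
  have PQ: "P \<subseteq> D" "Q \<inter> C = {}"
    using rel_coneD(4)[OF D] rel_coneD(7)[OF C] by blast+
  have inj: "inj \<Psi>"
  proof (rule injI)
    fix b b'
    assume "\<Psi> b = \<Psi> b'"
    then have "\<Phi> b = \<Phi> b'"
      using \<Phi>D PQ unfolding \<Psi>_def by blast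
    then show "b = b'"
      using \<Phi>(1) unfolding cantor_family_def by (metis injD)
  qed
  have "\<exists>n. \<forall>b b'. (\<forall>i<n. b i = b' i) \<longrightarrow> (x \<in> \<Psi> b \<longleftrightarrow> x \<in> \<Psi> b')" for x
  proof -
    obtain n where "\<And>b b'. (\<forall>i<n. b i = b' i) \<Longrightarrow> (x \<in> \<Phi> b \<longleftrightarrow> x \<in> \<Phi> b')"
      using \<Phi>(1) unfolding cantor_family_def by blast
    then show ?thesis
      unfolding \<Psi>_def by (metis Un_iff)
  qed
  then have "cantor_family \<Psi>"
    unfolding cantor_family_def using inj by blast
  moreover have "rel_cone G E B (\<Psi> b)" for b
    unfolding \<Psi>_def by (rule rel_cone_trans[OF rel_cone_trans[OF D \<Phi>(2)] C])
  moreover have "F' \<subseteq> \<Psi> b" for b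
    using F' \<Phi>(3) unfolding \<Psi>_def by blast
  ultimately show ?thesis
    unfolding cantor_many_def by blast
qed

end

subsection \<open>Convex subgroups\<close>

text \<open>Convexity in the form that composes: the positive elements outside \<open>E\<close>
  absorb multiplication by \<open>E\<close>. \<open>rel_cone_convexI\<close> and
  \<open>rel_cone_convexD\<close> relate it to the usual condition that 1 < x < y with y in
  \<open>E\<close> forces x into \<open>E\<close>.\<close>

abbreviation convex_subgroup :: "('a, 'b) monoid_scheme \<Rightarrow> 'a set \<Rightarrow> 'a set \<Rightarrow> bool"
  where "convex_subgroup G P E \<equiv> rel_cone G E (carrier G) (P - E)"

text \<open>Together with \<open>convex_below\<close> this is the jump of convex subgroups at
  g.\<close>

definition convex_span :: "('a, 'b) monoid_scheme \<Rightarrow> 'a set \<Rightarrow> 'a \<Rightarrow> 'a set"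
  where "convex_span G P g = \<Inter> {E. convex_subgroup G P E \<and> g \<in> E}"

definition convex_below :: "('a, 'b) monoid_scheme \<Rightarrow> 'a set \<Rightarrow> 'a \<Rightarrow> 'a set"
  where "convex_below G P g = \<Union> {E. convex_subgroup G P E \<and> g \<notin> E}"

context group
begin

lemma subgroup_mult_left_iff:
  assumes H: "subgroup H G" and x: "x \<in> H" and y: "y \<in> carrier G"
  shows "x \<otimes> y \<in> H \<longleftrightarrow> y \<in> H"
proof
  assume "x \<otimes> y \<in> H"
  then have "inv x \<otimes> (x \<otimes> y) \<in> H"
    using subgroup.m_closed[OF H subgroup.m_inv_closed[OF H x]] by blast
  then show "y \<in> H"
    using subgroup.mem_carrier[OF H x] y by simp
qed (rule subgroup.m_closed[OF H x])

lemma subgroup_mult_right_iff: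
  assumes H: "subgroup H G" and x: "x \<in> H" and y: "y \<in> carrier G"
  shows "y \<otimes> x \<in> H \<longleftrightarrow> y \<in> H"
proof
  assume "y \<otimes> x \<in> H"
  then have "y \<otimes> x \<otimes> inv x \<in> H"
    using subgroup.m_closed[OF H _ subgroup.m_inv_closed[OF H x]] by blast
  then show "y \<in> H"
    using subgroup.mem_carrier[OF H x] y by (simp add: m_assoc)
qed (rule subgroup.m_closed[OF H _ x])

lemma subgroup_inv_iff:
  assumes H: "subgroup H G" and x: "x \<in> carrier G"
  shows "inv x \<in> H \<longleftrightarrow> x \<in> H"
  using subgroup.m_inv_closed[OF H] x by force

text \<open>\<open>conv\<close> is the usual condition on 1 < x < y. It suffices because a positive
  x outside \<open>E\<close> keeps its sign when multiplied by some e of \<open>E\<close>: otherwise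
  x or \<open>inv (x \<otimes> e)\<close> would be a positive element below \<open>inv e\<close>,
  hence in \<open>E\<close>.\<close>

lemma rel_cone_convexI:
  assumes R: "rel_cone G D H R" and E: "subgroup E G" "D \<subseteq> E" "E \<subseteq> H"
    and conv: "\<And>x y. x \<in> R \<Longrightarrow> y \<in> E \<Longrightarrow> inv x \<otimes> y \<in> R \<Longrightarrow> x \<in> E"
  shows "rel_cone G E H (R - E)"
proof -
  note RD = rel_coneD[OF R]
  have c: "x \<in> carrier G" if "x \<in> H" for x
    using that RD(6) by blast
  have prod: "e \<otimes> x \<in> R \<and> x \<otimes> e \<in> R" if x: "x \<in> R" "x \<notin> E" and e: "e \<in> E" for x e
  proof
    have xc: "x \<in> carrier G" and ec: "e \<in> carrier G" "inv e \<in> E"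
      using RD(5) x e c E subgroup.m_inv_closed[OF E(1)] by auto
    have cl: "e \<otimes> x \<in> H" "x \<otimes> e \<in> H"
      using subgroup.m_closed[OF RD(2)] e E(3) x RD(4) by blast+
    have ne: "e \<otimes> x \<notin> E" "x \<otimes> e \<notin> E"
      using x(2) subgroup_mult_left_iff[OF E(1) e xc] subgroup_mult_right_iff[OF E(1) e xc] by auto
    show "e \<otimes> x \<in> R"
    proof (rule ccontr)
      assume "e \<otimes> x \<notin> R"
      then have "inv (e \<otimes> x) \<in> R"
        using RD(11)[OF cl(1)] ne E(2) by blast
      then have "inv x \<otimes> inv e \<in> R"
        using xc ec by (simp add: inv_mult_group)
      then show False
        using conv[OF x(1) ec(2)] x(2) by blast
    qed
    show "x \<otimes> e \<in> R"
    proof (rule ccontr)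
      assume "x \<otimes> e \<notin> R"
      then have R': "inv (x \<otimes> e) \<in> R"
        using RD(11)[OF cl(2)] ne E(2) by blast
      have "inv (inv (x \<otimes> e)) \<otimes> inv e \<in> R"
        using xc ec x by (simp add: m_assoc)
      then have "inv (x \<otimes> e) \<in> E"
        using conv[OF R' ec(2)] by blast
      then show False
        using ne(2) subgroup_inv_iff[OF E(1), of "x \<otimes> e"] xc ec by auto
    qed
  qed
  show ?thesis
  proof (rule rel_coneI)
    show "x \<otimes> y \<in> R - E" if "x \<in> R - E" "y \<in> R - E" for x y
    proof -
      have xy: "x \<otimes> y \<in> R" "x \<in> carrier G" "y \<in> carrier G"
        using that RD(5,8) by blast+
      moreover have "x \<otimes> y \<notin> E"
        using conv[of x "x \<otimes> y"] that xy by auto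
      ultimately show ?thesis
        by blast
    qed
    show "d \<otimes> x \<in> R - E" "x \<otimes> d \<in> R - E" if "x \<in> R - E" "d \<in> E" for x d
      using prod[of x d] that subgroup_mult_left_iff[OF E(1), of d x]
        subgroup_mult_right_iff[OF E(1), of d x] RD(5) by blast+
    show "inv x \<in> R - E" if "x \<in> H" "x \<notin> E" "x \<notin> R - E" for x
      using that RD(11)[of x] E(2) subgroup_inv_iff[OF E(1) c[of x]] by blast
  qed (use RD E in auto)
qed

lemma rel_cone_convexD:
  assumes R: "rel_cone G D H R" and E: "rel_cone G E H (R - E)"
    and x: "x \<in> R" "inv x \<otimes> y \<in> R" and y: "y \<in> E"
  shows "x \<in> E"
proof (rule ccontr)
  assume "x \<notin> E"
  note ED = rel_coneD[OF E]
  have c: "x \<in> carrier G" "y \<in> carrier G" "inv x \<otimes> y \<in> carrier G"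
    using rel_coneD(5)[OF R] x ED(3,6) y by blast+
  have eq: "x \<otimes> (inv x \<otimes> y) = y"
    using c by simp
  then have "inv x \<otimes> y \<notin> E"
    using subgroup_mult_right_iff[OF ED(1), of "inv x \<otimes> y" x] c y \<open>x \<notin> E\<close> by auto
  then have "x \<otimes> (inv x \<otimes> y) \<in> R - E"
    using ED(8)[of x "inv x \<otimes> y"] x \<open>x \<notin> E\<close> by blast
  then show False
    using eq y by simp
qed

text \<open>Take positive x in \<open>E\<close> but not in \<open>E'\<close>, and y in
  \<open>E'\<close> but not in \<open>E\<close>. One is below the other, and convexity puts the
  smaller one into the subgroup of the larger.\<close>

lemma convex_chain:
  assumes R: "rel_cone G D H R" and E: "rel_cone G E H (R - E)" and E': "rel_cone G E' H (R - E')"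
  shows "E \<subseteq> E' \<or> E' \<subseteq> E"
proof (rule ccontr)
  note ED = rel_coneD[OF E] and ED' = rel_coneD[OF E']
  assume "\<not> ?thesis"
  then obtain x0 y0 where 0: "x0 \<in> E" "x0 \<notin> E'" "y0 \<in> E'" "y0 \<notin> E"
    by blast
  have c: "x0 \<in> carrier G" "y0 \<in> carrier G" "x0 \<in> H" "y0 \<in> H"
    using 0 ED(3,6) ED'(3) by blast+
  have "\<exists>x. x \<in> E \<and> x \<notin> E' \<and> x \<in> R"
    using ED'(11)[of x0] 0 c subgroup.m_inv_closed[OF ED(1), of x0] subgroup_inv_iff[OF ED'(1), of x0]
    by blast
  then obtain x where x: "x \<in> E" "x \<notin> E'" "x \<in> R"
    by blast
  have "\<exists>x. x \<in> E' \<and> x \<notin> E \<and> x \<in> R"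
    using ED(11)[of y0] 0 c subgroup.m_inv_closed[OF ED'(1), of y0] subgroup_inv_iff[OF ED(1), of y0]
    by blast
  then obtain y where y: "y \<in> E'" "y \<notin> E" "y \<in> R"
    by blast
  have cc: "x \<in> carrier G" "y \<in> carrier G" "x \<in> H" "y \<in> H"
    using rel_coneD(4,5)[OF R] x y by blast+
  have "inv x \<otimes> y \<in> H"
    using subgroup.m_closed[OF ED(2) subgroup.m_inv_closed[OF ED(2)]] cc by blast
  moreover have "inv x \<otimes> y \<notin> E"
    using subgroup_mult_left_iff[OF ED(1) subgroup.m_inv_closed[OF ED(1)], of x y] x y cc by blast
  ultimately consider "inv x \<otimes> y \<in> R" | "inv (inv x \<otimes> y) \<in> R"
    using ED(11)[of "inv x \<otimes> y"] by blast
  then show False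
  proof cases
    case 1
    then show False
      using rel_cone_convexD[OF R E' x(3) _ y(1)] x by blast
  next
    case 2
    then have "inv y \<otimes> x \<in> R"
      using cc by (simp add: inv_mult_group)
    then show False
      using rel_cone_convexD[OF R E y(3) _ x(1)] y by blast
  qed
qed

lemma convex_carrier:
  assumes "rel_cone G D H R"
  shows "rel_cone G H H (R - H)"
  using rel_coneD(2,3,4)[OF assms] by (intro rel_cone_convexI[OF assms]) auto

lemma convex_Inter:
  assumes P: "cone G P" and \<E>: "\<E> \<noteq> {}" "\<And>E. E \<in> \<E> \<Longrightarrow> convex_subgroup G P E"
  shows "convex_subgroup G P (\<Inter>\<E>)"
proof (rule rel_cone_convexI[OF P])
  show sub: "subgroup (\<Inter>\<E>) G"
    using \<E> rel_coneD(1) by (intro subgroups_Inter) blast+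
  then show "{\<one>} \<subseteq> \<Inter>\<E>" "\<Inter>\<E> \<subseteq> carrier G"
    using subgroup.one_closed subgroup.subset by blast+
  show "x \<in> \<Inter>\<E>" if x: "x \<in> P" "y \<in> \<Inter>\<E>" "inv x \<otimes> y \<in> P" for x y
    using rel_cone_convexD[OF P \<E>(2) x(1,3)] x(2) by blast
qed

text \<open>Closure under products comes from the fact that convex subgroups form a chain.\<close>

lemma convex_Union:
  assumes P: "cone G P" and \<E>: "\<E> \<noteq> {}" "\<And>E. E \<in> \<E> \<Longrightarrow> convex_subgroup G P E"
  shows "convex_subgroup G P (\<Union>\<E>)"
proof (rule rel_cone_convexI[OF P])
  have sub: "subgroup E G" if "E \<in> \<E>" for E
    using rel_coneD(1)[OF \<E>(2)[OF that]] .
  show "\<Union>\<E> \<subseteq> carrier G"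
    using sub subgroup.subset by blast
  have 1: "\<one> \<in> \<Union>\<E>"
    using \<E>(1) sub subgroup.one_closed by blast
  then show "{\<one>} \<subseteq> \<Union>\<E>"
    by blast
  show "subgroup (\<Union>\<E>) G"
  proof (rule subgroupI)
    show "inv x \<in> \<Union>\<E>" if "x \<in> \<Union>\<E>" for x
      using that subgroup.m_inv_closed[OF sub, of _ x] by blast
    show "x \<otimes> y \<in> \<Union>\<E>" if xy: "x \<in> \<Union>\<E>" "y \<in> \<Union>\<E>" for x y
    proof -
      obtain E E' where E: "E \<in> \<E>" "E' \<in> \<E>" "x \<in> E" "y \<in> E'"
        using xy by blast
      consider "E \<subseteq> E'" | "E' \<subseteq> E"
        using convex_chain[OF P \<E>(2)[OF E(1)] \<E>(2)[OF E(2)]] by blast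
      then show ?thesis
        using E subgroup.m_closed[OF sub[OF E(1)], of x y] subgroup.m_closed[OF sub[OF E(2)], of x y]
        by cases blast+
    qed
  qed (use 1 \<open>\<Union>\<E> \<subseteq> carrier G\<close> in auto)
  show "x \<in> \<Union>\<E>" if x: "x \<in> P" "y \<in> \<Union>\<E>" "inv x \<otimes> y \<in> P" for x y
    using rel_cone_convexD[OF P \<E>(2) x(1,3)] x(2) by blast
qed

lemma convex_trivial:
  assumes P: "rel_cone G {\<one>} H P"
  shows "rel_cone G {\<one>} H (P - {\<one>})"
proof -
  have "P - {\<one>} = P"
    using rel_coneD(7)[OF P] by blast
  then show ?thesis
    using P by simp
qed

lemma convex_span:
  assumes P: "cone G P" and g: "g \<in> carrier G"
  shows "convex_subgroup G P (convex_span G P g)" "g \<in> convex_span G P g"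
    and "\<And>E. convex_subgroup G P E \<Longrightarrow> g \<in> E \<Longrightarrow> convex_span G P g \<subseteq> E"
proof -
  have "carrier G \<in> {E. convex_subgroup G P E \<and> g \<in> E}"
    using convex_carrier[OF P] g by blast
  then show "convex_subgroup G P (convex_span G P g)"
    unfolding convex_span_def by (intro convex_Inter[OF P]) blast+
qed (auto simp: convex_span_def)

lemma convex_below:
  assumes P: "cone G P" and g: "g \<noteq> \<one>"
  shows "convex_subgroup G P (convex_below G P g)" "g \<notin> convex_below G P g"
    and "\<And>E. convex_subgroup G P E \<Longrightarrow> g \<notin> E \<Longrightarrow> E \<subseteq> convex_below G P g"
proof -
  have "{\<one>} \<in> {E. convex_subgroup G P E \<and> g \<notin> E}"
    using convex_trivial[OF P] g by blast
  then show "convex_subgroup G P (convex_below G P g)"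
    unfolding convex_below_def by (intro convex_Union[OF P]) blast+
qed (auto simp: convex_below_def)

lemma convex_span_subset_iff:
  assumes P: "cone G P" and "g \<in> carrier G" "h \<in> carrier G"
  shows "convex_span G P g \<subseteq> convex_span G P h \<longleftrightarrow> g \<in> convex_span G P h"
  using convex_span[OF P assms(2)] convex_span[OF P assms(3)] by blast

lemma convex_span_inv:
  assumes P: "cone G P" and g: "g \<in> carrier G"
  shows "convex_span G P (inv g) = convex_span G P g"
proof -
  have "inv g \<in> E \<longleftrightarrow> g \<in> E" if "convex_subgroup G P E" for E
    using subgroup_inv_iff[OF rel_coneD(1)[OF that] g] .
  then show ?thesis
    unfolding convex_span_def by (metis (no_types, lifting))
qed

lemma convex_below_subset_span:
  assumes P: "cone G P" and g: "g \<in> carrier G" "g \<noteq> \<one>"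
  shows "convex_below G P g \<subseteq> convex_span G P g"
  using convex_chain[OF P convex_below(1)[OF P g(2)] convex_span(1)[OF P g(1)]]
    convex_below(2)[OF P g(2)] convex_span(2)[OF P g(1)] by blast

lemma convex_below_eq:
  assumes P: "cone G P" and g: "g \<in> carrier G" "g \<noteq> \<one>" and h: "h \<in> carrier G" "h \<noteq> \<one>"
    and eq: "convex_span G P g = convex_span G P h"
  shows "convex_below G P g = convex_below G P h"
proof -
  have "g \<in> E \<longleftrightarrow> h \<in> E" if "convex_subgroup G P E" for E
    using eq convex_span(2,3)[OF P g(1)] convex_span(2,3)[OF P h(1)] that by blast
  then show ?thesis
    unfolding convex_below_def by (metis (no_types, lifting))
qed

text \<open>h lies outside the convex span of g, and both the positive and the negative elements
  outside that span absorb multiplication by g.\<close>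

lemma convex_span_mult_less:
  assumes P: "cone G P" and g: "g \<in> carrier G" and h: "h \<in> carrier G"
    and less: "convex_span G P g \<subset> convex_span G P h"
  shows "convex_span G P (g \<otimes> h) = convex_span G P h" "convex_span G P (h \<otimes> g) = convex_span G P h"
    and "g \<otimes> h \<in> P \<longleftrightarrow> h \<in> P" "h \<otimes> g \<in> P \<longleftrightarrow> h \<in> P"
proof -
  let ?C = "convex_span G P"
  have hC: "h \<notin> ?C g"
    using less convex_span_subset_iff[OF P h g] by blast
  note C = convex_span(1)[OF P g] and gC = convex_span(2)[OF P g]
  note CD = rel_coneD[OF C]
  have giC: "inv g \<in> ?C g"
    using subgroup.m_inv_closed[OF CD(1) gC] .
  have span: "?C z = ?C h"
    if z: "z \<in> carrier G" "z \<notin> ?C g" "z \<in> ?C h" "\<And>E. subgroup E G \<Longrightarrow> g \<in> E \<Longrightarrow> z \<in> E \<Longrightarrow> h \<in> E" for z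
  proof -
    have "?C g \<subseteq> ?C z"
      using convex_chain[OF P C convex_span(1)[OF P z(1)]] convex_span(2)[OF P z(1)] z(2) by blast
    then have "h \<in> ?C z"
      using z(4)[OF rel_coneD(1)[OF convex_span(1)[OF P z(1)]]] gC convex_span(2)[OF P z(1)] by blast
    then show ?thesis
      using convex_span_subset_iff[OF P] h z(1,3) by blast
  qed
  have gh: "g \<in> ?C h"
    using less gC by blast
  note sub = rel_coneD(1)[OF convex_span(1)[OF P h]] and hh = convex_span(2)[OF P h]
  show "?C (g \<otimes> h) = ?C h"
    using g h gh hh hC gC subgroup_mult_left_iff[OF _ _ h, of _ g] CD(1) sub by (intro span) auto
  show "?C (h \<otimes> g) = ?C h"
    using g h gh hh hC gC subgroup_mult_right_iff[OF _ _ h, of _ g] CD(1) sub by (intro span) auto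
  have pos: "g \<otimes> h \<in> P \<and> h \<otimes> g \<in> P" if "h \<in> P"
    using CD(9)[of h g] CD(10)[of h g] that hC gC by blast
  have neg: "g \<otimes> h \<notin> P \<and> h \<otimes> g \<notin> P" if "h \<notin> P"
  proof -
    have "inv h \<in> P - ?C g"
      using CD(11)[OF h hC] that by blast
    then have "inv g \<otimes> inv h \<in> P" "inv h \<otimes> inv g \<in> P"
      using CD(9)[OF _ giC] CD(10)[OF _ giC] by blast+
    then have "inv (h \<otimes> g) \<in> P" "inv (g \<otimes> h) \<in> P"
      using g h by (simp_all add: inv_mult_group)
    then show ?thesis
      using cone_inv[OF P] by blast
  qed
  show "g \<otimes> h \<in> P \<longleftrightarrow> h \<in> P" "h \<otimes> g \<in> P \<longleftrightarrow> h \<in> P"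
    using pos neg by blast+
qed

text \<open>Positivity of both factors gives g < gh, so the span of the product contains g. Factors
  of opposite sign could cancel down to a smaller span.\<close>

lemma convex_span_mult_eq:
  assumes P: "cone G P" and gh: "g \<in> P" "h \<in> P" "convex_span G P g = convex_span G P h"
  shows "convex_span G P (g \<otimes> h) = convex_span G P h"
proof -
  have c: "g \<in> carrier G" "h \<in> carrier G" "g \<otimes> h \<in> carrier G"
    using rel_coneD(5)[OF P] gh by auto
  have "g \<otimes> h \<in> convex_span G P h"
    using subgroup.m_closed[OF rel_coneD(1)[OF convex_span(1)[OF P c(2)]]] gh(3)
      convex_span(2)[OF P] c by blast
  moreover have "g \<in> convex_span G P (g \<otimes> h)"
    using rel_cone_convexD[OF P convex_span(1)[OF P c(3)] gh(1) _ convex_span(2)[OF P c(3)]] c gh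
    by simp
  ultimately show ?thesis
    using convex_span_subset_iff[OF P] c gh(3) by blast
qed

text \<open>The sign of a product is that of the factor with the larger convex span, so the sign can be
  reversed independently on each jump.\<close>

lemma cone_flip:
  assumes P: "cone G P"
  shows "cone G {x \<in> carrier G - {\<one>}. x \<in> P \<longleftrightarrow> convex_span G P x \<notin> \<J>}"
    (is "cone G ?Q")
proof -
  let ?C = "convex_span G P"
  have inv_iff: "inv x \<in> P \<longleftrightarrow> x \<notin> P" if "x \<in> carrier G" "x \<noteq> \<one>" for x
    using cone_inv[OF P] rel_coneD(11)[OF P that(1)] that by blast
  have one: "\<one> \<notin> P"
    using rel_coneD(7)[OF P, of \<one>] by blast
  show ?thesis
  proof (rule rel_coneI)
    show "x \<otimes> y \<in> ?Q" if "x \<in> ?Q" "y \<in> ?Q" for x y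
    proof -
      have c: "x \<in> carrier G" "y \<in> carrier G" "x \<noteq> \<one>" "y \<noteq> \<one>"
        and Q: "x \<in> P \<longleftrightarrow> ?C x \<notin> \<J>" "y \<in> P \<longleftrightarrow> ?C y \<notin> \<J>"
        using that by auto
      have "?C x \<subseteq> ?C y \<or> ?C y \<subseteq> ?C x"
        using convex_chain[OF P convex_span(1)[OF P c(1)] convex_span(1)[OF P c(2)]] .
      then consider "?C x \<subset> ?C y" | "?C y \<subset> ?C x" | "?C x = ?C y"
        by blast
      then show ?thesis
      proof cases
        case 1
        have "x \<otimes> y \<noteq> \<one>"
        proof
          assume "x \<otimes> y = \<one>"
          then have "y = inv x"
            using c inv_equality[of y x] inv_comm by metis
          then show False
            using 1 convex_span_inv[OF P c(1)] by simp
        qed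
        then show ?thesis
          using convex_span_mult_less[OF P c(1,2) 1] Q c by simp
      next
        case 2
        have "x \<otimes> y \<noteq> \<one>"
        proof
          assume "x \<otimes> y = \<one>"
          then have "y = inv x"
            using c inv_equality[of y x] inv_comm by metis
          then show False
            using 2 convex_span_inv[OF P c(1)] by simp
        qed
        then show ?thesis
          using convex_span_mult_less[OF P c(2,1) 2] Q c by simp
      next
        case 3
        show ?thesis
        proof (cases "?C x \<in> \<J>")
          case False
          then have "x \<in> P" "y \<in> P"
            using Q 3 by auto
          moreover from this have "x \<otimes> y \<in> P"
            by (rule rel_coneD(8)[OF P])
          moreover from this have "x \<otimes> y \<noteq> \<one>"
            using one by auto
          ultimately show ?thesis
            using convex_span_mult_eq[OF P _ _ 3] c False 3 by simp
        next
          case True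
          then have i: "inv x \<in> P" "inv y \<in> P"
            using Q 3 c inv_iff by auto
          then have xy: "inv (x \<otimes> y) \<in> P"
            using rel_coneD(8)[OF P i(2,1)] c by (simp add: inv_mult_group)
          have "x \<otimes> y \<noteq> \<one>"
            using xy one by auto
          moreover have "x \<otimes> y \<notin> P"
            using cone_inv[OF P, of "x \<otimes> y"] xy by blast
          moreover have "?C (x \<otimes> y) = ?C x"
            using convex_span_mult_eq[OF P i(2,1)] 3 c convex_span_inv[OF P]
              convex_span_inv[OF P, of "x \<otimes> y"] by (simp add: inv_mult_group)
          ultimately show ?thesis
            using c True by simp
        qed
      qed
    qed
    show "inv x \<in> ?Q" if x: "x \<in> carrier G" "x \<notin> {\<one>}" "x \<notin> ?Q" for x
    proof -
      have "inv x \<noteq> \<one>"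
        using x by (metis inv_inv inv_one singletonI)
      then show ?thesis
        using x inv_iff[of x] convex_span_inv[OF P x(1)] by auto
    qed
  qed (use triv_subgroup subgroup_self in auto)
qed

text \<open>The spans of the finite set \<open>F\<close> are set aside, so that no flip touches
  \<open>F\<close>. Bit i flips the i-th span of a sequence chosen among the others. An element has
  just one span, so its membership depends on at most one bit.\<close>

lemma cantor_many_infinite_spans:
  assumes P: "cone G P" and F: "finite F" "F \<subseteq> P"
    and inf: "infinite (convex_span G P ` P)"
  shows "cantor_many G {\<one>} (carrier G) F"
proof -
  let ?C = "convex_span G P"
  have "infinite (?C ` P - ?C ` F)"
    using inf F(1) by simp
  then obtain J :: "nat \<Rightarrow> 'a set" where J: "inj J" "range J \<subseteq> ?C ` P - ?C ` F"
    using infinite_countable_subset by blast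
  define \<Phi> where "\<Phi> b = {x \<in> carrier G - {\<one>}. x \<in> P \<longleftrightarrow> ?C x \<notin> J ` {i. b i}}" for b
  have P1: "P \<subseteq> carrier G - {\<one>}"
    using P unfolding rel_cone_def by blast
  have "inj \<Phi>"
  proof (rule injI, rule ext)
    fix b b' i
    assume eq: "\<Phi> b = \<Phi> b'"
    have "J i \<in> ?C ` P"
      using J(2) by (meson Diff_iff rangeI subsetD)
    then obtain a where a: "a \<in> P" "?C a = J i"
      by force
    then have "a \<in> \<Phi> b \<longleftrightarrow> \<not> b i" for b
      using P1 inj_image_mem_iff[OF J(1), of i "{i. b i}"] unfolding \<Phi>_def by auto
    then show "b i = b' i"
      using eq by blast
  qed
  moreover have "\<exists>n. \<forall>b b'. (\<forall>i<n. b i = b' i) \<longrightarrow> (x \<in> \<Phi> b \<longleftrightarrow> x \<in> \<Phi> b')" for x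
  proof (cases "?C x \<in> range J")
    case True
    then obtain i where i: "?C x = J i"
      by blast
    then have "?C x \<in> J ` {i. b i} \<longleftrightarrow> b i" for b
      using inj_image_mem_iff[OF J(1), of i "{i. b i}"] by simp
    then show ?thesis
      unfolding \<Phi>_def by (intro exI[of _ "Suc i"]) auto
  next
    case False
    then have "?C x \<notin> J ` {i. b i}" for b
      by blast
    then show ?thesis
      unfolding \<Phi>_def by simp
  qed
  ultimately have "cantor_family \<Phi>"
    unfolding cantor_family_def by blast
  moreover have "cone G (\<Phi> b)" for b
    unfolding \<Phi>_def by (rule cone_flip[OF P])
  moreover have "F \<subseteq> \<Phi> b" for b
  proof
    fix x
    assume "x \<in> F"
    then have "?C x \<notin> range J" "x \<in> P"
      using J(2) F(2) by blast+
    then show "x \<in> \<Phi> b"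
      using P1 unfolding \<Phi>_def by blast
  qed
  ultimately show ?thesis
    unfolding cantor_many_def by blast
qed

end

section \<open>The order relation of a cone, invariant on the left\<close>

locale left_ordered_group = group +
  fixes P
  assumes cone: "cone G P"
begin

abbreviation lt (infix "\<sqsubset>" 50)
  where "x \<sqsubset> y \<equiv> inv x \<otimes> y \<in> P"

lemma P_carrier: "x \<in> P \<Longrightarrow> x \<in> carrier G"
  using rel_coneD(5)[OF cone] by blast

lemma one_notin: "\<one> \<notin> P"
  using rel_coneD(7)[OF cone, of \<one>] by blast

lemma P_mult: "x \<in> P \<Longrightarrow> y \<in> P \<Longrightarrow> x \<otimes> y \<in> P"
  by (rule rel_coneD(8)[OF cone])

lemma P_pow: "x \<in> P \<Longrightarrow> 0 < n \<Longrightarrow> x [^] (n::nat) \<in> P"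
  by (rule cone_pow[OF cone])

lemma inv_P_iff: "x \<in> carrier G \<Longrightarrow> inv x \<in> P \<longleftrightarrow> x \<notin> P \<and> x \<noteq> \<one>"
  using cone_inv[OF cone, of x] rel_coneD(11)[OF cone, of x] one_notin by auto

lemma lt_irrefl: "x \<in> carrier G \<Longrightarrow> \<not> x \<sqsubset> x"
  using one_notin by simp

lemma lt_trans:
  assumes "x \<sqsubset> y" "y \<sqsubset> z" "x \<in> carrier G" "y \<in> carrier G" "z \<in> carrier G"
  shows "x \<sqsubset> z"
  using P_mult[OF assms(1,2)] assms(3-5) by (simp add: m_assoc)

lemma not_lt_iff:
  assumes "x \<in> carrier G" "y \<in> carrier G"
  shows "\<not> x \<sqsubset> y \<longleftrightarrow> x = y \<or> y \<sqsubset> x"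
  using inv_P_iff[of "inv x \<otimes> y"] assms inv_mult_eq_one_iff[OF assms]
    inv_P_iff[of "inv y \<otimes> x"] by (auto simp: inv_mult_group)

lemma lt_mult_left_iff:
  assumes "x \<in> carrier G" "y \<in> carrier G" "c \<in> carrier G"
  shows "c \<otimes> x \<sqsubset> c \<otimes> y \<longleftrightarrow> x \<sqsubset> y"
  using assms by (simp add: inv_mult_group m_assoc)

lemma lt_mult_P: "x \<in> carrier G \<Longrightarrow> p \<in> P \<Longrightarrow> x \<sqsubset> x \<otimes> p"
  using P_carrier by simp

lemma lt_not_lt_trans:
  assumes "x \<sqsubset> y" "\<not> z \<sqsubset> y" "x \<in> carrier G" "y \<in> carrier G" "z \<in> carrier G"
  shows "x \<sqsubset> z"
  using assms not_lt_iff[of z y] lt_trans[of x y z] by blast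

lemma not_lt_lt_trans:
  assumes "\<not> y \<sqsubset> x" "y \<sqsubset> z" "x \<in> carrier G" "y \<in> carrier G" "z \<in> carrier G"
  shows "x \<sqsubset> z"
  using assms not_lt_iff[of y x] lt_trans[of x y z] by blast

lemma pow_lt_iff:
  assumes "a \<in> P"
  shows "a [^] (m::nat) \<sqsubset> a [^] (n::nat) \<longleftrightarrow> m < n"
proof -
  have c: "a \<in> carrier G"
    using assms P_carrier by blast
  have less: "a [^] m \<sqsubset> a [^] n" if "m < n" for m n :: nat
  proof -
    have "a [^] n = a [^] m \<otimes> a [^] (n - m)"
      using nat_pow_mult[OF c, of m "n - m"] that by simp
    then show ?thesis
      using lt_mult_P[of "a [^] m" "a [^] (n - m)"] P_pow[OF assms] that c by simp
  qed
  show ?thesis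
    using less[of m n] less[of n m] not_lt_iff[of "a [^] m" "a [^] n"] lt_irrefl c
    by (metis linorder_neqE_nat nat_pow_closed)
qed

end

subsection \<open>Hoelder's theorem\<close>

locale archimedean_group = left_ordered_group +
  assumes archimedean: "\<And>x y. x \<in> P \<Longrightarrow> y \<in> P \<Longrightarrow> \<exists>n::nat. y \<sqsubset> x [^] n"
begin

lemma conj_pow:
  assumes "c \<in> carrier G" "x \<in> carrier G"
  shows "(c \<otimes> x \<otimes> inv c) [^] (n::nat) = c \<otimes> x [^] n \<otimes> inv c"
  using assms by (induction n) (simp_all add: m_assoc)

text \<open>Only left invariance is given; the archimedean property forces the other side. Suppose
  that y = c x c^-1 is negative, and use y^n c = c x^n. For c > 1 some power of \<open>inv y\<close>
  exceeds c, although c x^n > 1 says the opposite; for c < 1 a power x^n above \<open>inv c\<close>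
  makes y^n positive.\<close>

lemma conj_P:
  assumes x: "x \<in> P" and c: "c \<in> carrier G"
  shows "c \<otimes> x \<otimes> inv c \<in> P"
proof (rule ccontr)
  have xc: "x \<in> carrier G"
    using P_carrier x .
  define y where "y = c \<otimes> x \<otimes> inv c"
  have yc: "y \<in> carrier G" "inv y \<in> carrier G"
    using xc c unfolding y_def by auto
  assume "c \<otimes> x \<otimes> inv c \<notin> P"
  moreover have "y \<noteq> \<one>"
  proof
    assume "y = \<one>"
    then have "inv c \<otimes> (y \<otimes> c) = \<one>"
      using c by simp
    then have "x = \<one>"
      using xc c unfolding y_def by (simp add: m_assoc)
    then show False
      using x one_notin by simp
  qed
  ultimately have y: "inv y \<in> P"
    using inv_P_iff[OF yc(1)] unfolding y_def by simp
  have eq: "y [^] n \<otimes> c = c \<otimes> x [^] n" for n :: nat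
    using conj_pow[OF c xc, of n] c xc unfolding y_def by (simp add: m_assoc)
  consider "c \<in> P" | "c = \<one>" | "inv c \<in> P"
    using inv_P_iff[OF c] by blast
  then show False
  proof cases
    case 1
    obtain n :: nat where n: "c \<sqsubset> inv y [^] n"
      using archimedean[OF y 1] by blast
    have iy: "inv y [^] n = inv (y [^] n)"
      using nat_pow_inv yc by simp
    have "c \<otimes> x [^] n \<in> P"
      using P_mult[OF 1 P_pow[OF x, of n]] 1 c by (cases "n = 0") auto
    then have "inv y [^] n \<sqsubset> inv y [^] n \<otimes> (c \<otimes> x [^] n)"
      using lt_mult_P yc by simp
    moreover have "inv y [^] n \<otimes> (c \<otimes> x [^] n) = c"
      unfolding eq[symmetric] iy using yc c by simp
    ultimately show False
      using lt_trans[OF n _ c _ c] lt_irrefl[OF c] yc by auto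
  next
    case 2
    then show False
      using y x xc c inv_P_iff[OF xc] unfolding y_def by simp
  next
    case 3
    obtain n :: nat where n: "inv c \<sqsubset> x [^] n"
      using archimedean[OF x 3] by blast
    have "x [^] n \<sqsubset> x [^] n \<otimes> inv c"
      using lt_mult_P[OF _ 3] xc by simp
    then have 4: "inv c \<sqsubset> x [^] n \<otimes> inv c"
      using lt_trans[OF n] xc c by simp
    have "x [^] n \<otimes> inv c = inv c \<otimes> y [^] n"
    proof -
      have "inv c \<otimes> (y [^] n \<otimes> c) \<otimes> inv c = inv c \<otimes> (c \<otimes> x [^] n) \<otimes> inv c"
        unfolding eq ..
      then show ?thesis
        using c xc yc by (simp add: m_assoc)
    qed
    then have yn: "y [^] n \<in> P"
      using 4 c yc xc by simp
    show False
    proof (cases "n = 0")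
      case True
      then show False
        using yn one_notin by simp
    next
      case False
      then have "inv (y [^] n) \<in> P"
        using cone_inv_pow[OF cone yc(1) y] by simp
      then show False
        using yn inv_P_iff[of "y [^] n"] yc by simp
    qed
  qed
qed

lemma lt_mult_right_iff:
  assumes "x \<in> carrier G" "y \<in> carrier G" "c \<in> carrier G"
  shows "x \<otimes> c \<sqsubset> y \<otimes> c \<longleftrightarrow> x \<sqsubset> y"
proof -
  have "inv (x \<otimes> c) \<otimes> (y \<otimes> c) = inv c \<otimes> (inv x \<otimes> y) \<otimes> c"
    using assms by (simp add: inv_mult_group m_assoc)
  moreover have "inv c \<otimes> z \<otimes> c \<in> P \<longleftrightarrow> z \<in> P" if "z \<in> carrier G" for z
  proof
    assume "inv c \<otimes> z \<otimes> c \<in> P"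
    then have "c \<otimes> (inv c \<otimes> z \<otimes> c) \<otimes> inv c \<in> P"
      using conj_P assms by blast
    then show "z \<in> P"
      using that assms by (simp add: m_assoc)
  next
    assume "z \<in> P"
    then have "inv c \<otimes> z \<otimes> inv (inv c) \<in> P"
      using conj_P[of z "inv c"] assms by blast
    then show "inv c \<otimes> z \<otimes> c \<in> P"
      using assms by simp
  qed
  ultimately show ?thesis
    using assms by simp
qed

lemma lt_mult_mono:
  assumes "x \<sqsubset> y" "x' \<sqsubset> y'" "x \<in> carrier G" "y \<in> carrier G" "x' \<in> carrier G" "y' \<in> carrier G"
  shows "x \<otimes> x' \<sqsubset> y \<otimes> y'"
proof -
  have "x \<otimes> x' \<sqsubset> y \<otimes> x'" "y \<otimes> x' \<sqsubset> y \<otimes> y'"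
    using assms lt_mult_right_iff lt_mult_left_iff by simp_all
  then show ?thesis
    using lt_trans assms by (metis m_closed)
qed

lemma sandwich:
  assumes "u \<in> P" "x \<in> P"
  shows "\<exists>m::nat. \<not> x \<sqsubset> u [^] m \<and> x \<sqsubset> u [^] Suc m"
proof -
  define n where "n = (LEAST n::nat. x \<sqsubset> u [^] n)"
  have n: "x \<sqsubset> u [^] n"
    unfolding n_def using archimedean[OF assms] by (rule LeastI_ex)
  have "n \<noteq> 0"
    using n assms inv_P_iff[OF P_carrier[OF assms(2)]] P_carrier[OF assms(2)] by (cases "n = 0") auto
  then obtain m where m: "n = Suc m"
    using not0_implies_Suc by blast
  then have "\<not> x \<sqsubset> u [^] m"
    using not_less_Least[of m "\<lambda>n. x \<sqsubset> u [^] n"] unfolding n_def by simp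
  then show ?thesis
    using n m by blast
qed

text \<open>Hoelder's argument for z > 1 with ab = ba z. If something lies strictly between 1 and z,
  some u > 1 has u^2 at most z; with a and b enclosed between consecutive powers u^m, u^(m+1) and
  u^n, u^(n+1), ab is less than u^(m+n+2), which is at most ba u^2 and so at most ba z = ab. If
  nothing lies between, all positive elements are powers of z and commute.\<close>

lemma no_commutator:
  assumes a: "a \<in> P" and b: "b \<in> P"
  shows "\<not> b \<otimes> a \<sqsubset> a \<otimes> b"
proof
  have c: "a \<in> carrier G" "b \<in> carrier G"
    using a b P_carrier by auto
  define z where "z = inv (b \<otimes> a) \<otimes> (a \<otimes> b)"
  assume "b \<otimes> a \<sqsubset> a \<otimes> b"
  then have z: "z \<in> P"
    unfolding z_def .
  have zc: "z \<in> carrier G"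
    using P_carrier[OF z] .
  show False
  proof (cases "\<exists>w\<in>P. w \<sqsubset> z")
    case True
    then obtain w where w: "w \<in> P" "w \<sqsubset> z"
      by blast
    have wc: "w \<in> carrier G"
      using P_carrier[OF w(1)] .
    \<comment> \<open>If w^2 exceeds z, the complement \<open>inv w \<otimes> z\<close> is smaller
      than w and its square is below z.\<close>
    obtain u where u: "u \<in> P" "\<not> z \<sqsubset> u \<otimes> u"
    proof (cases "z \<sqsubset> w \<otimes> w")
      case False
      then show ?thesis
        using that w(1) by blast
    next
      case True
      define v where "v = inv w \<otimes> z"
      have v: "v \<in> P" "v \<in> carrier G" "w \<otimes> v = z"
        using w(2) wc zc unfolding v_def by auto
      have "w \<otimes> v \<sqsubset> w \<otimes> w"
        using True v by simp
      then have "v \<sqsubset> w"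
        using lt_mult_left_iff v(2) wc by simp
      then have "v \<otimes> v \<sqsubset> w \<otimes> v"
        using lt_mult_right_iff v(2) wc by simp
      then have "\<not> z \<sqsubset> v \<otimes> v"
        using v zc not_lt_iff[of z "v \<otimes> v"] by auto
      then show ?thesis
        using that v(1) by blast
    qed
    have uc: "u \<in> carrier G"
      using P_carrier[OF u(1)] .
    obtain m n :: nat where m: "\<not> a \<sqsubset> u [^] m" "a \<sqsubset> u [^] Suc m"
      and n: "\<not> b \<sqsubset> u [^] n" "b \<sqsubset> u [^] Suc n"
      using sandwich[OF u(1) a] sandwich[OF u(1) b] by blast
    have "a \<otimes> b \<sqsubset> u [^] Suc m \<otimes> u [^] Suc n"
      using lt_mult_mono[OF m(2) n(2)] c uc by blast
    also have "u [^] Suc m \<otimes> u [^] Suc n = u [^] n \<otimes> u [^] m \<otimes> (u \<otimes> u)"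
      using nat_pow_mult[OF uc, of "Suc m" "Suc n"] nat_pow_mult[OF uc, of n m]
        nat_pow_mult[OF uc, of "n + m" 2] uc by (simp add: numeral_2_eq_2 ac_simps)
    finally have 1: "a \<otimes> b \<sqsubset> u [^] n \<otimes> u [^] m \<otimes> (u \<otimes> u)" .
    have 2: "\<not> b \<otimes> a \<sqsubset> u [^] n \<otimes> u [^] m"
    proof
      assume "b \<otimes> a \<sqsubset> u [^] n \<otimes> u [^] m"
      moreover have "\<not> b \<otimes> a \<sqsubset> b \<otimes> u [^] m"
        using m(1) lt_mult_left_iff c uc by simp
      ultimately have "b \<otimes> u [^] m \<sqsubset> u [^] n \<otimes> u [^] m"
        using not_lt_lt_trans[of "b \<otimes> a" "b \<otimes> u [^] m"] c uc by simp
      then show False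
        using n(1) lt_mult_right_iff c uc by simp
    qed
    have 3: "\<not> b \<otimes> a \<otimes> (u \<otimes> u) \<sqsubset> u [^] n \<otimes> u [^] m \<otimes> (u \<otimes> u)"
      using 2 lt_mult_right_iff c uc by simp
    have ab: "a \<otimes> b = b \<otimes> a \<otimes> z"
      unfolding z_def using c by simp
    have "\<not> b \<otimes> a \<otimes> z \<sqsubset> b \<otimes> a \<otimes> (u \<otimes> u)"
      using u(2) lt_mult_left_iff[of z "u \<otimes> u" "b \<otimes> a"] c uc zc by simp
    then show False
      using lt_not_lt_trans[OF 1 3] ab c uc zc by auto
  next
    case False
    have power: "\<exists>k::nat. x = z [^] k" if x: "x \<in> P" for x
    proof -
      have xc: "x \<in> carrier G"
        using P_carrier[OF x] .
      obtain k :: nat where k: "\<not> x \<sqsubset> z [^] k" "x \<sqsubset> z [^] Suc k"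
        using sandwich[OF z x] by blast
      have "\<not> z [^] k \<sqsubset> x"
      proof
        assume "z [^] k \<sqsubset> x"
        moreover have "inv (z [^] k) \<otimes> x \<sqsubset> z"
        proof -
          have "z [^] k \<otimes> (inv (z [^] k) \<otimes> x) \<sqsubset> z [^] k \<otimes> z"
            using k(2) xc zc by simp
          then show ?thesis
            using lt_mult_left_iff[of "inv (z [^] k) \<otimes> x" z "z [^] k"] xc zc by simp
        qed
        ultimately show False
          using False by blast
      qed
      then have "x = z [^] k"
        using k(1) not_lt_iff[of x "z [^] k"] xc zc by auto
      then show ?thesis
        by blast
    qed
    then obtain k l :: nat where "a = z [^] k" "b = z [^] l"
      using a b by blast
    then have "b \<otimes> a = a \<otimes> b"
      using nat_pow_comm[OF zc] by simp
    then show False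
      using z one_notin c unfolding z_def by simp
  qed
qed

lemma archimedean_commute:
  assumes "x \<in> carrier G" "y \<in> carrier G"
  shows "x \<otimes> y = y \<otimes> x"
proof -
  have pos: "a \<otimes> b = b \<otimes> a" if "a \<in> P" "b \<in> P" for a b
    using no_commutator[OF that] no_commutator[OF that(2,1)] not_lt_iff[of "b \<otimes> a" "a \<otimes> b"]
      P_carrier that by auto
  have inv_comm: "a \<otimes> b = b \<otimes> a" if "inv a \<otimes> b = b \<otimes> inv a" "a \<in> carrier G" "b \<in> carrier G" for a b
  proof -
    have "a \<otimes> (inv a \<otimes> b) \<otimes> a = a \<otimes> (b \<otimes> inv a) \<otimes> a"
      using that by simp
    then show ?thesis
      using that(2,3) by (simp add: m_assoc)
  qed
  have half: "a \<otimes> b = b \<otimes> a" if "a \<in> P" "b \<in> carrier G" for a b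
    using pos[of a b] pos[of a "inv b"] inv_comm[of b a] that inv_P_iff[of b] P_carrier[of a] by force
  show ?thesis
    using half[of x y] half[of "inv x" y] inv_comm[of x y] assms inv_P_iff[of x] by force
qed

end

subsection \<open>Conradian orders\<close>

locale conradian_group = left_ordered_group +
  assumes conrad: "\<And>f g. f \<in> P \<Longrightarrow> g \<in> P \<Longrightarrow> \<exists>n::nat. g \<sqsubset> f \<otimes> g [^] n"
begin

text \<open>If \<open>f g\<^sup>2\<close> does not exceed \<open>g\<close>, then all powers of \<open>h = f g\<close> stay below \<open>g\<close>, so
  \<open>f h\<^sup>n\<close> stays below \<open>h\<close>.\<close>

lemma conrad_square:
  assumes f: "f \<in> P" and g: "g \<in> P"
  shows "g \<sqsubset> f \<otimes> g \<otimes> g"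
proof (rule ccontr)
  have c: "f \<in> carrier G" "g \<in> carrier G"
    using f g P_carrier by auto
  define h where "h = f \<otimes> g"
  have h: "h \<in> P" "h \<in> carrier G"
    using P_mult[OF f g] c unfolding h_def by auto
  assume "\<not> g \<sqsubset> f \<otimes> g \<otimes> g"
  then have 1: "\<not> g \<sqsubset> h \<otimes> g"
    unfolding h_def .
  have pow: "\<not> g \<sqsubset> h [^] n \<otimes> g" for n :: nat
  proof (induction n)
    case 0
    then show ?case
      using c lt_irrefl by simp
  next
    case (Suc n)
    have "\<not> h [^] n \<otimes> g \<sqsubset> h [^] n \<otimes> (h \<otimes> g)"
      using 1 lt_mult_left_iff c h by simp
    then have "\<not> h [^] n \<otimes> g \<sqsubset> h [^] Suc n \<otimes> g"
      using c h by (simp add: m_assoc)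
    then show ?case
      using Suc not_lt_lt_trans[of g "h [^] n \<otimes> g" "h [^] Suc n \<otimes> g"] c h
      by (metis m_closed nat_pow_closed)
  qed
  obtain n :: nat where n: "h \<sqsubset> f \<otimes> h [^] n"
    using conrad[OF f h(1)] by blast
  have "h [^] n \<sqsubset> g"
    using lt_not_lt_trans[OF lt_mult_P[of "h [^] n" g] pow] c h g by simp
  then have "f \<otimes> h [^] n \<sqsubset> f \<otimes> g"
    using lt_mult_left_iff c h by simp
  then show False
    using lt_trans[OF n, of h] lt_irrefl c h unfolding h_def by simp
qed

lemma conrad_square':
  assumes "f \<in> P" "g \<in> P"
  shows "\<not> f \<otimes> g \<otimes> g \<sqsubset> g"
  using conrad_square[OF assms] not_lt_iff[of "f \<otimes> g \<otimes> g" g] assms P_carrier by auto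

text \<open>Serves as an upper bound of the convex span of a. The Conradian condition makes it
  closed under products: an unbounded product would yield some f > 1 and a power g = a^m with f g^2
  < g, against \<open>conrad_square\<close>.\<close>

lemma convex_subgroup_bounded:
  assumes a: "a \<in> P"
  shows "convex_subgroup G P {x \<in> carrier G. \<exists>n::nat. x \<sqsubset> a [^] n \<and> inv x \<sqsubset> a [^] n}"
proof -
  have ac: "a \<in> carrier G"
    using P_carrier[OF a] .
  define bd where "bd x \<longleftrightarrow> (\<exists>n::nat. x \<sqsubset> a [^] n)" for x
  have bd_mono: "bd x" if "bd y" "x \<sqsubset> y" "x \<in> carrier G" "y \<in> carrier G" for x y
    using that lt_trans[of x y] ac unfolding bd_def by blast
  have bd_neg: "bd x" if "x \<in> carrier G" "x \<notin> P" for x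
  proof -
    have "x = \<one> \<or> x \<sqsubset> \<one>"
      using that inv_P_iff[of x] by auto
    then have "x \<sqsubset> a"
      using lt_trans[of x \<one> a] that a ac by auto
    then show ?thesis
      unfolding bd_def using ac by (intro exI[of _ 1]) simp
  qed
  have pos_ge: "\<exists>m::nat. 0 < m \<and> y \<sqsubset> a [^] m" if y: "bd y" "y \<in> carrier G" for y
  proof -
    obtain m :: nat where "y \<sqsubset> a [^] m"
      using y(1) unfolding bd_def by blast
    then have "y \<sqsubset> a [^] Suc m"
      using lt_trans[of y "a [^] m" "a [^] Suc m"] pow_lt_iff[OF a, of m "Suc m"] y ac by blast
    then show ?thesis
      by blast
  qed
  have sq: "\<not> x \<otimes> a [^] (m + m) \<sqsubset> a [^] m" if "x \<in> P" "0 < m" for x and m :: nat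
    using conrad_square'[OF that(1) P_pow[OF a that(2)]] nat_pow_mult[OF ac, of m m]
      P_carrier[OF that(1)] ac by (simp add: m_assoc)
  have bd1: "bd (x \<otimes> y)" if x: "x \<in> P" "bd x" and y: "y \<in> P" "bd y" for x y
  proof (rule ccontr)
    assume nb: "\<not> bd (x \<otimes> y)"
    have c: "x \<in> carrier G" "y \<in> carrier G"
      using x y P_carrier by auto
    obtain n :: nat where n: "x \<sqsubset> a [^] n"
      using x(2) unfolding bd_def by blast
    obtain m :: nat where m: "0 < m" "y \<sqsubset> a [^] m"
      using pos_ge y c by blast
    define z where "z = inv x \<otimes> a [^] n"
    have "z \<in> P"
      using n unfolding z_def .
    have "x \<otimes> y \<sqsubset> x \<otimes> a [^] m"
      using m(2) lt_mult_left_iff c ac by simp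
    \<comment> \<open>The exponent n + 2m leaves \<open>z \<otimes> a [^] (m + m)\<close> below
      \<open>a [^] m\<close> once x is cancelled, and z > 1 by the choice of n.\<close>
    then have "a [^] (n + (m + m)) \<sqsubset> x \<otimes> a [^] m"
      using not_lt_lt_trans[of "x \<otimes> y" "a [^] (n + (m + m))" "x \<otimes> a [^] m"] nb c ac
      unfolding bd_def by simp
    then have "inv x \<otimes> a [^] (n + (m + m)) \<sqsubset> inv x \<otimes> (x \<otimes> a [^] m)"
      using lt_mult_left_iff[of "a [^] (n + (m + m))" "x \<otimes> a [^] m" "inv x"] c ac by simp
    then have "z \<otimes> a [^] (m + m) \<sqsubset> a [^] m"
      using c ac nat_pow_mult[OF ac, of n "m + m"] unfolding z_def by (simp add: m_assoc)
    then show False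
      using sq[OF \<open>z \<in> P\<close> m(1)] by blast
  qed
  have bd2: "bd (inv x \<otimes> y)" if x: "x \<in> P" "bd x" and y: "y \<in> P" "bd y" for x y
  proof (rule ccontr)
    assume nb: "\<not> bd (inv x \<otimes> y)"
    have c: "x \<in> carrier G" "y \<in> carrier G"
      using x y P_carrier by auto
    obtain m :: nat where m: "0 < m" "y \<sqsubset> a [^] m"
      using pos_ge y c by blast
    have "\<not> x \<otimes> (inv x \<otimes> y) \<sqsubset> x \<otimes> a [^] (m + m)"
      using nb lt_mult_left_iff[of "inv x \<otimes> y" "a [^] (m + m)" x] c ac unfolding bd_def by simp
    then have "x \<otimes> a [^] (m + m) \<sqsubset> a [^] m"
      using not_lt_lt_trans[of y "x \<otimes> a [^] (m + m)" "a [^] m"] m(2) c ac by simp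
    then show False
      using sq[OF x(1) m(1)] by blast
  qed
  have bd_mult: "bd (x \<otimes> y)"
    if c: "x \<in> carrier G" "y \<in> carrier G" and b: "bd x" "bd (inv x)" "bd y" "bd (inv y)" for x y
  proof -
    consider "x = \<one>" | "y = \<one>" | "x \<in> P" "y \<in> P" | "inv x \<in> P" "y \<in> P"
      | "x \<in> P" "inv y \<in> P" | "inv x \<in> P" "inv y \<in> P"
      using inv_P_iff[OF c(1)] inv_P_iff[OF c(2)] by blast
    then show ?thesis
    proof cases
      case 4
      then show ?thesis
        using bd2[of "inv x" y] b c by simp
    next
      case 5
      have "x \<otimes> y \<sqsubset> x"
        using 5 c by (simp add: inv_mult_group m_assoc)
      then show ?thesis
        using bd_mono[OF b(1)] c by simp
    next
      case 6
      then have "inv (x \<otimes> y) \<in> P"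
        using P_mult[OF 6(2,1)] c by (simp add: inv_mult_group)
      then show ?thesis
        using bd_neg inv_P_iff[of "x \<otimes> y"] c by simp
    qed (use b c bd1 in auto)
  qed
  have eq: "{x \<in> carrier G. \<exists>n::nat. x \<sqsubset> a [^] n \<and> inv x \<sqsubset> a [^] n} =
      {x \<in> carrier G. bd x \<and> bd (inv x)}" (is "?L = ?A")
  proof
    show "?L \<subseteq> ?A"
      unfolding bd_def by blast
    show "?A \<subseteq> ?L"
    proof
      fix x
      assume "x \<in> ?A"
      then obtain m n :: nat where x: "x \<in> carrier G" "x \<sqsubset> a [^] m" "inv x \<sqsubset> a [^] n"
        unfolding bd_def by blast
      have up: "y \<sqsubset> a [^] (max m n)" if "y \<sqsubset> a [^] k" "y \<in> carrier G" "k \<le> max m n" for y and k :: nat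
        using that lt_trans[of y "a [^] k" "a [^] max m n"] pow_lt_iff[OF a, of k "max m n"] ac
        by (cases "k = max m n") auto
      show "x \<in> ?L"
        using up[OF x(2)] up[OF x(3)] x(1) by (intro CollectI conjI exI[of _ "max m n"]) auto
    qed
  qed
  have "convex_subgroup G P ?A"
  proof (rule rel_cone_convexI[OF cone])
    show "subgroup ?A G"
    proof (rule subgroupI)
      show "x \<otimes> y \<in> ?A" if "x \<in> ?A" "y \<in> ?A" for x y
        using that bd_mult[of x y] bd_mult[of "inv y" "inv x"] by (simp add: inv_mult_group)
      have "\<one> \<in> ?A"
        using bd_neg[of \<one>] one_notin by simp
      then show "?A \<noteq> {}"
        by blast
    qed auto
    then show "{\<one>} \<subseteq> ?A"
      using subgroup.one_closed by blast
    show "x \<in> ?A" if x: "x \<in> P" and y: "y \<in> ?A" and xy: "x \<sqsubset> y" for x y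
    proof -
      have "bd x"
        using bd_mono[OF _ xy] y P_carrier[OF x] by blast
      moreover have "bd (inv x)"
        using bd_neg[of "inv x"] cone_inv[OF cone x] P_carrier[OF x] by blast
      ultimately show ?thesis
        using P_carrier[OF x] by blast
    qed
  qed auto
  then show ?thesis
    unfolding eq .
qed

text \<open>A convex subgroup missing a lies in \<open>convex_below G P a\<close>, so the span of x
  contains a and therefore y. The elements bounded by powers of x form a convex subgroup containing
  x, hence containing its span.\<close>

lemma span_archimedean:
  assumes a: "a \<in> P" and x: "x \<in> P" "x \<notin> convex_below G P a" and y: "y \<in> convex_span G P a"
  shows "\<exists>n::nat. y \<sqsubset> x [^] n"
proof -
  have c: "a \<in> carrier G" "x \<in> carrier G" "a \<noteq> \<one>"
    using a x P_carrier one_notin by auto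
  have "a \<in> convex_span G P x"
    using convex_below(3)[OF cone c(3) convex_span(1)[OF cone c(2)]] convex_span(2)[OF cone c(2)] x(2)
    by blast
  then have "y \<in> convex_span G P x"
    using convex_span_subset_iff[OF cone c(1,2)] y by blast
  moreover have "x \<sqsubset> x [^] (2::nat)"
    using pow_lt_iff[OF x(1), of 1 2] c by simp
  moreover have "inv x \<sqsubset> x [^] (2::nat)"
  proof -
    have "inv (inv x) \<otimes> x [^] (2::nat) = x [^] (3::nat)"
      using c by (simp add: numeral_2_eq_2 numeral_3_eq_3 m_assoc)
    then show ?thesis
      using P_pow[OF x(1), of 3] by simp
  qed
  ultimately show ?thesis
    using convex_span(3)[OF cone c(2) convex_subgroup_bounded[OF x(1)]] c by blast
qed

text \<open>If a conjugate of d were positive outside the lower subgroup, some power of it would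
  exceed c^2. From c^2 < c d^n c^-1 follows c < d^n, so c would lie in the lower subgroup. From c^2
  < c^-1 d^n c follows f c^2 < c for f = d^-n c, which is positive, against
  \<open>conrad_square'\<close>.\<close>

lemma below_normal_aux:
  assumes a: "a \<in> P" and c: "c \<in> P" "c \<in> convex_span G P a" "c \<notin> convex_below G P a"
    and d: "d \<in> convex_below G P a"
  shows "c \<otimes> d \<otimes> inv c \<notin> P - convex_below G P a" "inv c \<otimes> d \<otimes> c \<notin> P - convex_below G P a"
proof -
  let ?C = "convex_span G P a" and ?D = "convex_below G P a"
  have a1: "a \<in> carrier G" "a \<noteq> \<one>"
    using a P_carrier one_notin by auto
  note DD = convex_below(1)[OF cone a1(2)]
  note D = rel_coneD[OF DD]
  have cr: "c \<in> carrier G" "d \<in> carrier G"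
    using P_carrier[OF c(1)] D(3) d by auto
  have dn: "d [^] n \<in> ?D" for n :: nat
  proof (induction n)
    case (Suc n)
    then show ?case
      using subgroup.m_closed[OF D(1) Suc d] by simp
  qed (use subgroup.one_closed[OF D(1)] in simp)
  have conj: "(b \<otimes> d \<otimes> inv b) [^] n = b \<otimes> d [^] n \<otimes> inv b" if "b \<in> carrier G" for b and n :: nat
    using that cr by (induction n) (simp_all add: m_assoc)
  have CC: "c \<otimes> c \<in> ?C"
    using subgroup.m_closed[OF rel_coneD(1)[OF convex_span(1)[OF cone a1(1)]] c(2) c(2)] .
  show "c \<otimes> d \<otimes> inv c \<notin> P - ?D"
  proof
    assume e: "c \<otimes> d \<otimes> inv c \<in> P - ?D"
    then obtain n :: nat where "c \<otimes> c \<sqsubset> (c \<otimes> d \<otimes> inv c) [^] n"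
      using span_archimedean[OF a _ _ CC] by blast
    then have 1: "c \<otimes> c \<sqsubset> c \<otimes> d [^] n \<otimes> inv c"
      using conj[OF cr(1)] by simp
    have "c \<otimes> d [^] n \<otimes> inv c \<sqsubset> (c \<otimes> d [^] n \<otimes> inv c) \<otimes> c"
      using lt_mult_P[OF _ c(1)] cr by simp
    then have "c \<otimes> d [^] n \<otimes> inv c \<sqsubset> c \<otimes> d [^] n"
      using cr by (simp add: m_assoc)
    then have "c \<otimes> c \<sqsubset> c \<otimes> d [^] n"
      using lt_trans[OF 1] cr by simp
    then have "c \<sqsubset> d [^] n"
      using lt_mult_left_iff cr by simp
    then show False
      using rel_cone_convexD[OF cone DD c(1) _ dn] c(3) by blast
  qed
  show "inv c \<otimes> d \<otimes> c \<notin> P - ?D"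
  proof
    assume e: "inv c \<otimes> d \<otimes> c \<in> P - ?D"
    then obtain n :: nat where "c \<otimes> c \<sqsubset> (inv c \<otimes> d \<otimes> c) [^] n"
      using span_archimedean[OF a _ _ CC] by blast
    then have "c \<otimes> c \<sqsubset> inv c \<otimes> d [^] n \<otimes> c"
      using conj[of "inv c" n] cr by simp
    then have "c \<otimes> (c \<otimes> c) \<sqsubset> c \<otimes> (inv c \<otimes> d [^] n \<otimes> c)"
      using lt_mult_left_iff[of "c \<otimes> c" "inv c \<otimes> d [^] n \<otimes> c" c] cr by simp
    then have "c \<otimes> (c \<otimes> c) \<sqsubset> d [^] n \<otimes> c"
      using cr by (simp add: m_assoc)
    then have "inv (d [^] n) \<otimes> (c \<otimes> (c \<otimes> c)) \<sqsubset> inv (d [^] n) \<otimes> (d [^] n \<otimes> c)"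
      using lt_mult_left_iff[of "c \<otimes> (c \<otimes> c)" "d [^] n \<otimes> c" "inv (d [^] n)"] cr by simp
    then have "(inv (d [^] n) \<otimes> c) \<otimes> c \<otimes> c \<sqsubset> c"
      using cr by (simp add: m_assoc)
    moreover have "inv (d [^] n) \<otimes> c \<in> P"
      using D(9)[of c "inv (d [^] n)"] c(1,3) subgroup.m_inv_closed[OF D(1) dn] by blast
    ultimately show False
      using conrad_square'[OF _ c(1)] by blast
  qed
qed

lemma below_normal:
  assumes a: "a \<in> P" and c: "c \<in> convex_span G P a" and d: "d \<in> convex_below G P a"
  shows "c \<otimes> d \<otimes> inv c \<in> convex_below G P a"
proof (cases "c \<in> convex_below G P a")
  let ?C = "convex_span G P a" and ?D = "convex_below G P a"
  have a1: "a \<in> carrier G" "a \<noteq> \<one>"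
    using a P_carrier one_notin by auto
  note D = rel_coneD[OF convex_below(1)[OF cone a1(2)]]
  note C = rel_coneD[OF convex_span(1)[OF cone a1(1)]]
  {
    case True
    then show ?thesis
      using subgroup.m_closed[OF D(1)] subgroup.m_inv_closed[OF D(1)] d by blast
  next
    case False
    have cr: "c \<in> carrier G" "d \<in> carrier G"
      using C(3) c D(3) d by auto
    have di: "inv d \<in> ?D"
      using subgroup.m_inv_closed[OF D(1) d] .
    have ci: "inv c \<in> ?C" "inv c \<notin> ?D"
      using subgroup.m_inv_closed[OF C(1) c] False subgroup_inv_iff[OF D(1) cr(1)] by auto
    define e where "e = c \<otimes> d \<otimes> inv c"
    have ec: "e \<in> carrier G"
      using cr unfolding e_def by simp
    have ei: "inv e = c \<otimes> inv d \<otimes> inv c"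
      using cr unfolding e_def by (simp add: inv_mult_group m_assoc)
    have "e \<notin> P - ?D \<and> inv e \<notin> P - ?D"
    proof (cases "c \<in> P")
      case True
      then show ?thesis
        using below_normal_aux(1)[OF a True c False d] below_normal_aux(1)[OF a True c False di]
        unfolding ei unfolding e_def by blast
    next
      case F: False
      then have "inv c \<in> P"
        using D(11)[OF cr(1) False] by blast
      then show ?thesis
        using below_normal_aux(2)[OF a _ ci d] below_normal_aux(2)[OF a _ ci di] cr
        unfolding ei unfolding e_def by simp
    qed
    then show ?thesis
      using D(11)[OF ec] subgroup_inv_iff[OF D(1) ec] unfolding e_def by blast
  }
qed

end

subsection \<open>Orders on abelian groups\<close>

inductive_set submonoid_span :: "('a, 'b) monoid_scheme \<Rightarrow> 'a set \<Rightarrow> 'a set"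
  for G (structure) and F
  where
    one: "\<one> \<in> submonoid_span G F"
  | step: "f \<in> F \<Longrightarrow> x \<in> submonoid_span G F \<Longrightarrow> f \<otimes> x \<in> submonoid_span G F"

text \<open>For a subgroup \<open>D\<close>: the nonnegative elements of a left-invariant preorder
  in which exactly the elements of \<open>D\<close> are equivalent to 1.\<close>

definition preorder_cone :: "('a, 'b) monoid_scheme \<Rightarrow> 'a set \<Rightarrow> 'a set \<Rightarrow> bool"
  where "preorder_cone G D M \<longleftrightarrow> M \<subseteq> carrier G \<and> D \<subseteq> M \<and>
    (\<forall>x\<in>M. \<forall>y\<in>M. x \<otimes>\<^bsub>G\<^esub> y \<in> M) \<and> (\<forall>x\<in>M. inv\<^bsub>G\<^esub> x \<in> M \<longrightarrow> x \<in> D)"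

definition adjoin :: "('a, 'b) monoid_scheme \<Rightarrow> 'a set \<Rightarrow> 'a \<Rightarrow> 'a set"
  where "adjoin G M a = {m \<otimes>\<^bsub>G\<^esub> a [^]\<^bsub>G\<^esub> (k::nat) | m k. m \<in> M}"

context group
begin

lemma submonoid_span_carrier: "F \<subseteq> carrier G \<Longrightarrow> submonoid_span G F \<subseteq> carrier G"
proof
  fix x
  assume F: "F \<subseteq> carrier G" and "x \<in> submonoid_span G F"
  from this(2) show "x \<in> carrier G"
    by induction (use F in auto)
qed

lemma submonoid_span_incl:
  assumes "F \<subseteq> carrier G" "f \<in> F"
  shows "f \<in> submonoid_span G F"
proof -
  have "f \<otimes> \<one> \<in> submonoid_span G F"
    by (rule submonoid_span.step[OF assms(2) submonoid_span.one])
  then show ?thesis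
    using assms by auto
qed

lemma submonoid_span_mult:
  assumes F: "F \<subseteq> carrier G" and x: "x \<in> submonoid_span G F" and y: "y \<in> submonoid_span G F"
  shows "x \<otimes> y \<in> submonoid_span G F"
  using x
proof induction
  case one
  then show ?case
    using y submonoid_span_carrier[OF F] by auto
next
  case (step f x)
  have "f \<in> carrier G" "x \<in> carrier G" "y \<in> carrier G"
    using step y F submonoid_span_carrier[OF F] by auto
  then show ?case
    using submonoid_span.step[OF step(1) step.IH] by (simp add: m_assoc)
qed

lemma submonoid_span_pow:
  assumes F: "F \<subseteq> carrier G" and x: "x \<in> submonoid_span G F"
  shows "x [^] (n::nat) \<in> submonoid_span G F"
  by (induction n) (simp_all add: submonoid_span.one submonoid_span_mult[OF F _ x])

lemma countable_submonoid_span: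
  assumes "countable F"
  shows "countable (submonoid_span G F)"
proof -
  have "submonoid_span G F \<subseteq> (\<lambda>l. foldr (\<otimes>) l \<one>) ` lists F"
  proof
    fix x
    assume "x \<in> submonoid_span G F"
    then show "x \<in> (\<lambda>l. foldr (\<otimes>) l \<one>) ` lists F"
    proof induction
      case one
      show ?case
        by (rule image_eqI[of _ _ "[]"]) simp_all
    next
      case (step f x)
      then obtain l where l: "l \<in> lists F" "x = foldr (\<otimes>) l \<one>"
        by blast
      then have "f # l \<in> lists F" "f \<otimes> x = foldr (\<otimes>) (f # l) \<one>"
        using step(1) by simp_all
      then show ?case
        by blast
    qed
  qed
  then show ?thesis
    by (rule countable_subset) (intro countable_image countable_lists assms)
qed

lemma submonoid_span_cone:
  assumes P: "cone G P" and F: "F \<subseteq> P" and x: "x \<in> submonoid_span G F"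
  shows "x = \<one> \<or> x \<in> P"
  using x
proof induction
  case (step f x)
  have f: "f \<in> P" "f \<in> carrier G"
    using step(1) F rel_coneD(5)[OF P] by auto
  then show ?case
    using step.IH rel_coneD(8)[OF P f(1)] by auto
qed simp

end

context comm_group
begin

text \<open>If m a^k and its inverse m' a^k' are both in the new set, then the inverse of a^(k + k')
  equals m m', which is in \<open>M\<close>; so \<open>neg\<close> forces k + k' = 0, and both
  elements were already in \<open>M\<close>.\<close>

lemma preorder_cone_adjoin:
  assumes D: "subgroup D G" and M: "preorder_cone G D M" and a: "a \<in> carrier G"
    and neg: "\<And>k::nat. 0 < k \<Longrightarrow> inv (a [^] k) \<notin> M"
  shows "preorder_cone G D (adjoin G M a)" "M \<subseteq> adjoin G M a" "a \<in> adjoin G M a"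
proof -
  have MD: "M \<subseteq> carrier G" "D \<subseteq> M" "\<And>x y. x \<in> M \<Longrightarrow> y \<in> M \<Longrightarrow> x \<otimes> y \<in> M"
    "\<And>x. x \<in> M \<Longrightarrow> inv x \<in> M \<Longrightarrow> x \<in> D"
    using M unfolding preorder_cone_def by auto
  have one: "\<one> \<in> M"
    using MD(2) subgroup.one_closed[OF D] by blast
  show sub: "M \<subseteq> adjoin G M a"
  proof
    fix m
    assume "m \<in> M"
    then have "m = m \<otimes> a [^] (0::nat)" "m \<in> M"
      using MD(1) by auto
    then show "m \<in> adjoin G M a"
      unfolding adjoin_def by blast
  qed
  have "a = \<one> \<otimes> a [^] (1::nat)"
    using a by simp
  then show "a \<in> adjoin G M a"
    unfolding adjoin_def using one by blast
  have prod: "(m \<otimes> a [^] k) \<otimes> (m' \<otimes> a [^] k') = (m \<otimes> m') \<otimes> a [^] (k + k')"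
    if "m \<in> M" "m' \<in> M" for m m' and k k' :: nat
  proof -
    have "m \<in> carrier G" "m' \<in> carrier G"
      using that MD(1) by auto
    then show ?thesis
      using a nat_pow_mult[OF a, of k k', symmetric] by (simp add: m_ac)
  qed
  have "x \<otimes> y \<in> adjoin G M a" if xy: "x \<in> adjoin G M a" "y \<in> adjoin G M a" for x y
  proof -
    obtain m k m' k' where "m \<in> M" "m' \<in> M" "x = m \<otimes> a [^] (k::nat)" "y = m' \<otimes> a [^] (k'::nat)"
      using xy unfolding adjoin_def by blast
    then show ?thesis
      using prod[of m m' k k'] MD(3)[of m m'] unfolding adjoin_def by blast
  qed
  moreover have "x \<in> D" if xx: "x \<in> adjoin G M a" "inv x \<in> adjoin G M a" for x
  proof -
    obtain m k where m: "m \<in> M" "x = m \<otimes> a [^] (k::nat)"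
      using xx(1) unfolding adjoin_def by blast
    obtain m' k' where m': "m' \<in> M" "inv x = m' \<otimes> a [^] (k'::nat)"
      using xx(2) unfolding adjoin_def by blast
    have c: "m \<in> carrier G" "m' \<in> carrier G" "x \<in> carrier G"
      using m m' MD(1) a by auto
    have "(m \<otimes> m') \<otimes> a [^] (k + k') = \<one>"
      using prod[OF m(1) m'(1), of k k'] r_inv[OF c(3)] m(2) m'(2) by simp
    then have "inv (a [^] (k + k')) = m \<otimes> m'"
      using inv_equality[of "m \<otimes> m'" "a [^] (k + k')"] a c by auto
    then have "inv (a [^] (k + k')) \<in> M"
      using MD(3)[OF m(1) m'(1)] by simp
    then have "k + k' = 0"
      using neg[of "k + k'"] by blast
    then have "x = m" "inv x = m'"
      using m m' c by auto
    then show ?thesis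
      using MD(4) m(1) m'(1) by blast
  qed
  moreover have "adjoin G M a \<subseteq> carrier G"
    unfolding adjoin_def using MD(1) a by auto
  ultimately show "preorder_cone G D (adjoin G M a)"
    unfolding preorder_cone_def using sub MD(2) by blast
qed

text \<open>By Zorn's lemma there is a maximal \<open>N\<close>, and it is total: if it contained
  neither a nor its inverse, neither could be adjoined, so \<open>N\<close> would contain some a^j
  and the inverse of some a^k, hence a^(jk) and its inverse; then a^(jk), and with it a, would lie
  in \<open>D\<close>.\<close>

lemma preorder_cone_extend:
  assumes D: "subgroup D G" and M: "preorder_cone G D M"
    and torsion_free: "\<And>x (n::nat). x \<in> carrier G \<Longrightarrow> 0 < n \<Longrightarrow> x [^] n \<in> D \<Longrightarrow> x \<in> D"
  shows "\<exists>P. rel_cone G D (carrier G) P \<and> M - D \<subseteq> P"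
proof -
  let ?\<A> = "{N. preorder_cone G D N \<and> M \<subseteq> N}"
  have "\<exists>N\<in>?\<A>. \<forall>X\<in>?\<A>. N \<subseteq> X \<longrightarrow> X = N"
  proof (rule subset_Zorn_nonempty)
    show "?\<A> \<noteq> {}"
      using M by blast
    fix \<C>
    assume ne: "\<C> \<noteq> {}" and ch: "subset.chain ?\<A> \<C>"
    have mem: "preorder_cone G D N" "M \<subseteq> N" if "N \<in> \<C>" for N
      using ch that unfolding subset_chain_def by auto
    have common: "\<exists>N\<in>\<C>. x \<in> N \<and> y \<in> N" if xy: "x \<in> \<Union>\<C>" "y \<in> \<Union>\<C>" for x y
    proof -
      obtain N N' where N: "N \<in> \<C>" "N' \<in> \<C>" "x \<in> N" "y \<in> N'"
        using xy by blast
      then have "N \<subseteq> N' \<or> N' \<subseteq> N"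
        using ch unfolding subset_chain_def by blast
      then show ?thesis
        using N by blast
    qed
    obtain N0 where N0: "N0 \<in> \<C>"
      using ne by blast
    have "N \<subseteq> carrier G" if "N \<in> \<C>" for N
      using mem(1)[OF that] unfolding preorder_cone_def by blast
    then have sub: "\<Union>\<C> \<subseteq> carrier G" "D \<subseteq> \<Union>\<C>" "M \<subseteq> \<Union>\<C>"
      using mem[OF N0] N0 unfolding preorder_cone_def by blast+
    have "x \<otimes> y \<in> \<Union>\<C>" if xy: "x \<in> \<Union>\<C>" "y \<in> \<Union>\<C>" for x y
    proof -
      obtain N where N: "N \<in> \<C>" "x \<in> N" "y \<in> N"
        using common[OF xy] by blast
      then have "x \<otimes> y \<in> N"
        using mem(1)[OF N(1)] unfolding preorder_cone_def by blast
      then show ?thesis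
        using N by blast
    qed
    moreover have "x \<in> D" if xx: "x \<in> \<Union>\<C>" "inv x \<in> \<Union>\<C>" for x
    proof -
      obtain N where N: "N \<in> \<C>" "x \<in> N" "inv x \<in> N"
        using common[OF xx] by blast
      then show ?thesis
        using mem(1)[OF N(1)] unfolding preorder_cone_def by blast
    qed
    ultimately have "preorder_cone G D (\<Union>\<C>)"
      unfolding preorder_cone_def using sub by blast
    then show "\<Union>\<C> \<in> ?\<A>"
      using sub by blast
  qed
  then obtain N where N_max: "N \<in> ?\<A>" "\<forall>X\<in>?\<A>. N \<subseteq> X \<longrightarrow> X = N"
    by (rule bexE)
  then have N: "preorder_cone G D N" "M \<subseteq> N"
    by auto
  have max: "X = N" if "preorder_cone G D X" "N \<subseteq> X" for X
    using N_max(2) N(2) that by auto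
  have ND: "N \<subseteq> carrier G" "D \<subseteq> N" "\<And>x y. x \<in> N \<Longrightarrow> y \<in> N \<Longrightarrow> x \<otimes> y \<in> N"
    "\<And>x. x \<in> N \<Longrightarrow> inv x \<in> N \<Longrightarrow> x \<in> D"
    using N(1) unfolding preorder_cone_def by auto
  have pow: "x [^] n \<in> N" if "x \<in> N" for x and n :: nat
    using that ND(2,3) subgroup.one_closed[OF D] by (induction n) auto
  have neg: "\<exists>k::nat. 0 < k \<and> inv (a [^] k) \<in> N" if a: "a \<in> carrier G" "a \<notin> N" for a
  proof (rule ccontr)
    assume "\<not> ?thesis"
    then have n: "\<And>k::nat. 0 < k \<Longrightarrow> inv (a [^] k) \<notin> N"
      by blast
    show False
      using preorder_cone_adjoin[OF D N(1) a(1) n] max[of "adjoin G N a"] a(2) by blast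
  qed
  have total: "a \<in> N \<or> inv a \<in> N" if a: "a \<in> carrier G" for a
  proof (rule ccontr)
    assume "\<not> ?thesis"
    then have n: "a \<notin> N" "inv a \<notin> N"
      by auto
    obtain k :: nat where k: "0 < k" "inv (a [^] k) \<in> N"
      using neg[OF a n(1)] by blast
    obtain j :: nat where j: "0 < j" "inv (inv a [^] j) \<in> N"
      using neg[OF _ n(2)] a by blast
    have "a [^] j \<in> N"
      using j(2) a nat_pow_inv[of a j] by simp
    then have "a [^] (j * k) \<in> N"
      using pow[of "a [^] j" k] a by (simp add: nat_pow_pow)
    moreover have "inv (a [^] (j * k)) \<in> N"
      using pow[OF k(2), of j] a by (simp add: nat_pow_pow nat_pow_inv mult.commute)
    ultimately have "a [^] (j * k) \<in> D"
      by (rule ND(4))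
    then have "a \<in> D"
      using torsion_free[OF a, of "j * k"] j k by simp
    then show False
      using n ND(2) by blast
  qed
  have "rel_cone G D (carrier G) (N - D)"
  proof (rule rel_coneI)
    show "x \<otimes> y \<in> N - D" if xy: "x \<in> N - D" "y \<in> N - D" for x y
    proof -
      have c: "x \<in> carrier G" "y \<in> carrier G"
        using xy ND(1) by auto
      have "x \<otimes> y \<notin> D"
      proof
        assume "x \<otimes> y \<in> D"
        then have "inv (x \<otimes> y) \<in> N"
          using subgroup.m_inv_closed[OF D] ND(2) by blast
        then have "y \<otimes> inv (x \<otimes> y) \<in> N"
          using ND(3) xy by blast
        then have "inv x \<in> N"
          using c by (simp add: inv_mult_group)
        then show False
          using ND(4) xy by blast
      qed
      then show ?thesis
        using ND(3) xy by blast
    qed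
    show "d \<otimes> x \<in> N - D" "x \<otimes> d \<in> N - D" if "x \<in> N - D" "d \<in> D" for x d
      using that ND(1,2,3) subgroup_mult_left_iff[OF D, of d x] subgroup_mult_right_iff[OF D, of d x]
      by blast+
    show "inv x \<in> N - D" if "x \<in> carrier G" "x \<notin> D" "x \<notin> N - D" for x
      using that total[of x] subgroup_inv_iff[OF D] by blast
  qed (use D subgroup_self subgroup.subset[OF D] ND(1) in auto)
  then show ?thesis
    using N(2) by blast
qed

lemma submonoid_span_split:
  assumes F: "F \<subseteq> carrier G" and f: "f \<in> F" and x: "x \<in> submonoid_span G F"
  shows "\<exists>(c::nat) u. u \<in> submonoid_span G (F - {f}) \<and> x = f [^] c \<otimes> u"
  using x
proof induction
  case one
  show ?case
    by (rule exI[of _ 0], rule exI[of _ \<one>]) (simp add: submonoid_span.one)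
next
  case (step g x)
  then obtain c :: nat and u where u: "u \<in> submonoid_span G (F - {f})" "x = f [^] c \<otimes> u"
    by blast
  have cr: "u \<in> carrier G" "f \<in> carrier G" "g \<in> carrier G"
    using u(1) submonoid_span_carrier[of "F - {f}"] F f step(1) by auto
  show ?case
  proof (cases "g = f")
    case True
    then have "g \<otimes> x = f [^] Suc c \<otimes> u"
      using u(2) cr by (simp add: m_ac)
    then show ?thesis
      using u(1) by blast
  next
    case False
    then have "g \<otimes> u \<in> submonoid_span G (F - {f})"
      using step(1) u(1) by (intro submonoid_span.step) auto
    moreover have "g \<otimes> x = f [^] c \<otimes> (g \<otimes> u)"
      using u(2) cr by (simp add: m_ac)
    ultimately show ?thesis
      by blast
  qed
qed

text \<open>A generator which exceeds another one has a power in the span of the remaining generators,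
  so an isolated order would be generated by a single element.\<close>

lemma finitely_generated_cone_cyclic:
  assumes P: "cone G P" and F: "finite F" "F \<subseteq> P"
    and gen: "\<And>a. a \<in> P \<Longrightarrow> \<exists>k::nat. 0 < k \<and> a [^] k \<in> submonoid_span G F"
  shows "\<exists>f\<in>carrier G. \<forall>a\<in>P. \<exists>(k::nat) (c::nat). 0 < k \<and> a [^] k = f [^] c"
  using F gen
proof (induction "card F" arbitrary: F rule: less_induct)
  case less
  have Pc: "P \<subseteq> carrier G"
    using rel_coneD(5)[OF P] .
  then have Fc: "F \<subseteq> carrier G"
    using less.prems(2) by blast
  show ?case
  proof (cases "\<exists>f\<in>carrier G. F \<subseteq> {f}")
    case True
    then obtain f where f: "f \<in> carrier G" "F \<subseteq> {f}"
      by blast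
    have span: "\<exists>c::nat. x = f [^] c" if "x \<in> submonoid_span G F" for x
      using that
    proof induction
      case one
      have "\<one> = f [^] (0::nat)"
        by simp
      then show ?case
        by blast
    next
      case (step g x)
      then obtain c :: nat where "x = f [^] c"
        by blast
      then have "g \<otimes> x = f [^] Suc c"
        using step(1) f by (auto simp: m_ac)
      then show ?case
        by blast
    qed
    show ?thesis
      using f(1) less.prems(3) span by meson
  next
    case False
    have "F \<noteq> {}"
      using False by auto
    then obtain g where g: "g \<in> F"
      by blast
    then obtain h where h: "h \<in> F" "h \<noteq> g"
      using False Fc by blast
    have c: "g \<in> carrier G" "h \<in> carrier G"
      using g h Fc by auto
    have "g \<otimes> inv h \<in> P \<or> h \<otimes> inv g \<in> P"
    proof -
      have "g \<otimes> inv h \<noteq> \<one>"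
        using h(2) c inv_equality[of g "inv h"] by auto
      then show ?thesis
        using rel_coneD(11)[OF P, of "g \<otimes> inv h"] c by (auto simp: inv_mult_group)
    qed
    then obtain f1 f2 where f: "f1 \<in> F" "f2 \<in> F" "f1 \<noteq> f2" and b: "f1 \<otimes> inv f2 \<in> P"
      using g h by metis
    have fc: "f1 \<in> carrier G" "f2 \<in> carrier G" "f2 \<in> P"
      using f Fc less.prems(2) by auto
    obtain n :: nat where n: "0 < n" "(f1 \<otimes> inv f2) [^] n \<in> submonoid_span G F"
      using less.prems(3)[OF b] by blast
    obtain c :: nat and u where u: "u \<in> submonoid_span G (F - {f1})"
        "(f1 \<otimes> inv f2) [^] n = f1 [^] c \<otimes> u"
      using submonoid_span_split[OF Fc f(1) n(2)] by blast
    have uc: "u \<in> carrier G"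
      using u(1) submonoid_span_carrier[of "F - {f1}"] Fc by blast
    have "f1 [^] n = (f1 \<otimes> inv f2) [^] n \<otimes> f2 [^] n"
      using fc by (simp add: nat_pow_distrib nat_pow_inv m_assoc)
    then have eq: "f1 [^] n = f1 [^] c \<otimes> (u \<otimes> f2 [^] n)"
      using u(2) fc uc by (simp add: m_assoc)
      have cancel: "y = z" if "x \<otimes> y = x \<otimes> z" "x \<in> carrier G" "y \<in> carrier G" "z \<in> carrier G"
      for x y z
      using that by simp
  have f2n: "f2 [^] n \<in> P"
      using cone_pow[OF P fc(3) n(1)] .
    have "u = \<one> \<or> u \<in> P"
      using submonoid_span_cone[OF P _ u(1)] less.prems(2) by blast
    then have uf2: "u \<otimes> f2 [^] n \<in> P"
      using rel_coneD(8)[OF P _ f2n] f2n Pc by auto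
    \<comment> \<open>Otherwise cancelling f1^n exhibits the neutral element as a member of the
      cone.\<close>
    have "c < n"
    proof (rule ccontr)
      assume "\<not> c < n"
      then have "f1 [^] c = f1 [^] n \<otimes> f1 [^] (c - n)"
        using nat_pow_mult[OF fc(1), of n "c - n"] by simp
      then have "f1 [^] n = f1 [^] n \<otimes> f1 [^] (c - n) \<otimes> (u \<otimes> f2 [^] n)"
        using eq by metis
      also have "\<dots> = f1 [^] n \<otimes> (f1 [^] (c - n) \<otimes> (u \<otimes> f2 [^] n))"
        by (rule m_assoc) (use fc uc in auto)
      finally have "f1 [^] n \<otimes> \<one> = f1 [^] n \<otimes> (f1 [^] (c - n) \<otimes> (u \<otimes> f2 [^] n))"
        by (rule trans[OF r_one, rotated]) (use fc in simp)
      then have "\<one> = f1 [^] (c - n) \<otimes> (u \<otimes> f2 [^] n)"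
        by (rule cancel) (use fc uc in auto)
      moreover have "f1 [^] (c - n) \<otimes> (u \<otimes> f2 [^] n) \<in> P"
      proof (cases "c - n = 0")
        case True
        then show ?thesis
          using uf2 fc uc by simp
      next
        case False
        then have "f1 [^] (c - n) \<in> P"
          using cone_pow[OF P, of f1 "c - n"] f(1) less.prems(2) by auto
        then show ?thesis
          using rel_coneD(8)[OF P _ uf2] by blast
      qed
      ultimately show False
        using rel_coneD(7)[OF P, of \<one>] by auto
    qed
    then have "f1 [^] n = f1 [^] c \<otimes> f1 [^] (n - c)"
      using nat_pow_mult[OF fc(1), of c "n - c"] by simp
    then have "f1 [^] c \<otimes> f1 [^] (n - c) = f1 [^] c \<otimes> (u \<otimes> f2 [^] n)"
      using eq by simp
    then have q: "f1 [^] (n - c) = u \<otimes> f2 [^] n"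
      by (rule cancel) (use fc uc in auto)
    let ?F = "F - {f1}"
    have F': "?F \<subseteq> carrier G"
      using Fc by blast
    have f2: "f2 \<in> submonoid_span G ?F"
      using submonoid_span_incl[OF F'] f by blast
    have q': "f1 [^] (n - c) \<in> submonoid_span G ?F"
      unfolding q by (rule submonoid_span_mult[OF F' u(1) submonoid_span_pow[OF F' f2]])
    show ?thesis
    proof (rule less.hyps)
      show "card ?F < card F"
        by (rule card_Diff1_less[OF less.prems(1) f(1)])
      show "finite ?F" "?F \<subseteq> P"
        using less.prems by auto
      fix a
      assume a: "a \<in> P"
      then obtain k :: nat where k: "0 < k" "a [^] k \<in> submonoid_span G F"
        using less.prems(3) by blast
      obtain d :: nat and v where v: "v \<in> submonoid_span G ?F" "a [^] k = f1 [^] d \<otimes> v"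
        using submonoid_span_split[OF Fc f(1) k(2)] by blast
      have vc: "v \<in> carrier G" "a \<in> carrier G"
        using v(1) submonoid_span_carrier[OF F'] a Pc by auto
      \<comment> \<open>The exponent n - c turns the powers of f1 into powers of an element spanned
        by the other generators.\<close>
      have "a [^] (k * (n - c)) = (f1 [^] d \<otimes> v) [^] (n - c)"
        using v(2) nat_pow_pow[OF vc(2), of k "n - c"] by simp
      also have "\<dots> = (f1 [^] (n - c)) [^] d \<otimes> v [^] (n - c)"
        using fc vc by (simp add: nat_pow_distrib nat_pow_pow mult.commute)
      finally have "a [^] (k * (n - c)) \<in> submonoid_span G ?F"
        using submonoid_span_mult[OF F' submonoid_span_pow[OF F' q'] submonoid_span_pow[OF F' v(1)]]
        by simp
      then show "\<exists>k::nat. 0 < k \<and> a [^] k \<in> submonoid_span G ?F"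
        using k(1) \<open>c < n\<close> by (intro exI[of _ "k * (n - c)"]) simp
    qed
  qed
qed

text \<open>If finitely many signs determined \<open>P\<close>, each a in \<open>P\<close> would
  have a power in the submonoid spanned by a finite \<open>F\<close>, since otherwise
  \<open>inv a\<close> could be adjoined to this span and a second cone would contain
  \<open>F\<close>. By \<open>finitely_generated_cone_cyclic\<close> all positive elements would
  then be commensurable with a single one, contrary to the independence of x and y.\<close>

lemma no_isolated_cone:
  assumes P: "cone G P" and S: "finite S"
    and xy: "x \<in> P" "y \<in> P" and indep: "\<And>(m::nat) (n::nat). 0 < m \<Longrightarrow> 0 < n \<Longrightarrow> x [^] m \<noteq> y [^] n"
  shows "\<exists>P'. cone G P' \<and> P' \<noteq> P \<and> P' \<inter> S = P \<inter> S"
proof (rule ccontr)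
  assume "\<not> ?thesis"
  then have uniq: "\<And>P'. cone G P' \<Longrightarrow> P' \<inter> S = P \<inter> S \<Longrightarrow> P' = P"
    by blast
  have Pc: "P \<subseteq> carrier G"
    using rel_coneD(5)[OF P] .
  \<comment> \<open>Adding inverses turns the negative elements of \<open>S\<close> into positivity
    conditions as well.\<close>
  define F where "F = P \<inter> (S \<union> m_inv G ` S)"
  have F: "finite F" "F \<subseteq> P" "F \<subseteq> carrier G"
    unfolding F_def using S Pc by auto
  have uniq': "P' = P" if P': "cone G P'" and sub: "F \<subseteq> P'" for P'
  proof (rule uniq[OF P'])
    have "P \<inter> S \<subseteq> P'"
      using sub unfolding F_def by blast
    moreover have "z \<in> P" if z: "z \<in> P'" "z \<in> S" for z
    proof (rule ccontr)
      assume "z \<notin> P"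
      moreover have "z \<in> carrier G" "z \<noteq> \<one>"
        using z(1) rel_coneD(5)[OF P'] rel_coneD(7)[OF P'] by blast+
      ultimately have "inv z \<in> P"
        using rel_coneD(11)[OF P, of z] by blast
      then have "inv z \<in> P'"
        using sub z(2) unfolding F_def by blast
      then show False
        using cone_inv[OF P' z(1)] by blast
    qed
    ultimately show "P' \<inter> S = P \<inter> S"
      by blast
  qed
  have gen: "\<exists>k::nat. 0 < k \<and> a [^] k \<in> submonoid_span G F" if a: "a \<in> P" for a
  proof (rule ccontr)
    assume no: "\<not> ?thesis"
    have ac: "a \<in> carrier G" "inv a \<in> carrier G"
      using a Pc by auto
    let ?N = "submonoid_span G F"
    have "preorder_cone G {\<one>} ?N"
      unfolding preorder_cone_def
    proof (intro conjI ballI impI)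
      show "?N \<subseteq> carrier G"
        using submonoid_span_carrier[OF F(3)] .
      show "{\<one>} \<subseteq> ?N"
        using submonoid_span.one by blast
      show "u \<otimes> v \<in> ?N" if "u \<in> ?N" "v \<in> ?N" for u v
        using submonoid_span_mult[OF F(3) that] .
      show "u \<in> {\<one>}" if u: "u \<in> ?N" "inv u \<in> ?N" for u
      proof (rule ccontr)
        assume "u \<notin> {\<one>}"
        moreover have uc: "u \<in> carrier G"
          using u(1) submonoid_span_carrier[OF F(3)] by blast
        ultimately have "u \<in> P" "inv u \<noteq> \<one>"
          using submonoid_span_cone[OF P F(2) u(1)] inv_eq_1_iff[OF uc] by auto
        then show False
          using submonoid_span_cone[OF P F(2) u(2)] cone_inv[OF P] by blast
      qed
    qed
    moreover have "inv (inv a [^] k) \<notin> ?N" if "0 < k" for k :: nat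
    proof -
      have "a [^] k \<notin> ?N"
        using no that by blast
      then show ?thesis
        using ac by (simp add: nat_pow_inv)
    qed
    ultimately have "preorder_cone G {\<one>} (adjoin G ?N (inv a))" "?N \<subseteq> adjoin G ?N (inv a)"
      "inv a \<in> adjoin G ?N (inv a)"
      using preorder_cone_adjoin[OF triv_subgroup _ ac(2)] by blast+
    then obtain P' where P': "cone G P'" "adjoin G ?N (inv a) - {\<one>} \<subseteq> P'"
      using preorder_cone_extend[OF triv_subgroup] cone_isolated[OF P] by (metis (no_types, lifting))
    have "F \<subseteq> ?N - {\<one>}"
      using submonoid_span_incl[OF F(3)] F(2) rel_coneD(7)[OF P, of \<one>] by blast
    then have "F \<subseteq> P'"
      using P'(2) \<open>?N \<subseteq> adjoin G ?N (inv a)\<close> by blast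
    then have "P' = P"
      by (rule uniq'[OF P'(1)])
    moreover have "inv a \<noteq> \<one>"
      using a inv_eq_1_iff[OF ac(1)] rel_coneD(7)[OF P, of \<one>] by auto
    ultimately have "inv a \<in> P"
      using P'(2) \<open>inv a \<in> adjoin G ?N (inv a)\<close> by blast
    then show False
      using cone_inv[OF P a] by blast
  qed
  obtain f where f: "f \<in> carrier G"
    and cyc: "\<And>a. a \<in> P \<Longrightarrow> \<exists>(k::nat) (c::nat). 0 < k \<and> a [^] k = f [^] c"
    using finitely_generated_cone_cyclic[OF P F(1,2) gen] by blast
  have pos: "\<exists>(k::nat) (c::nat). 0 < k \<and> 0 < c \<and> a [^] k = f [^] c" if a: "a \<in> P" for a
  proof -
    obtain k c :: nat where k: "0 < k" "a [^] k = f [^] c"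
      using cyc[OF a] by blast
    have "a [^] k \<in> P"
      using cone_pow[OF P a k(1)] .
    then have "c \<noteq> 0"
      using k(2) rel_coneD(7)[OF P, of \<one>] by (cases "c = 0") auto
    then show ?thesis
      using k by blast
  qed
  obtain k c :: nat where k: "0 < k" "0 < c" "x [^] k = f [^] c"
    using pos[OF xy(1)] by blast
  obtain l d :: nat where l: "0 < l" "0 < d" "y [^] l = f [^] d"
    using pos[OF xy(2)] by blast
  have xc: "x \<in> carrier G" "y \<in> carrier G"
    using xy Pc by auto
  have "x [^] (k * d) = (f [^] c) [^] d"
    using k(3) nat_pow_pow[OF xc(1)] by metis
  also have "\<dots> = (f [^] d) [^] c"
    using f by (simp add: nat_pow_pow mult.commute)
  also have "\<dots> = y [^] (l * c)"
    using l(3) nat_pow_pow[OF xc(2)] by metis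
  finally show False
    using indep[of "k * d" "l * c"] k l by simp
qed

text \<open>The family consists of all cones. Independence of x and y passes to another cone after
  replacing each by its inverse where it is negative. Elements outside the carrier are in no cone
  and are tested by the neutral element.\<close>

lemma cantor_many_countable_abelian:
  assumes P: "cone G P" and F: "finite F" "F \<subseteq> P" and countable: "countable (carrier G)"
    and xy: "x \<in> P" "y \<in> P" and indep: "\<And>(m::nat) (n::nat). 0 < m \<Longrightarrow> 0 < n \<Longrightarrow> x [^] m \<noteq> y [^] n"
  shows "cantor_many G {\<one>} (carrier G) F"
proof (rule cantor_manyI[where \<X> = "{P. cone G P}"])
  have c: "x \<in> carrier G" "y \<in> carrier G"
    using xy rel_coneD(5)[OF P] by auto
  show "\<exists>P'\<in>{P. cone G P}. P' \<noteq> Q \<and> P' \<inter> S = Q \<inter> S"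
    if Q: "Q \<in> {P. cone G P}" and S: "finite S" for Q S
  proof -
    have Q': "cone G Q"
      using Q by blast
    have "\<exists>a\<in>Q. a = z \<or> a = inv z" if "z \<in> P" for z
      using rel_coneD(11)[OF Q', of z] rel_coneD(5,7)[OF P] that by blast
    then obtain a b where ab: "a \<in> Q" "b \<in> Q" "a = x \<or> a = inv x" "b = y \<or> b = inv y"
      using xy by metis
    have "a [^] m \<noteq> b [^] n" if mn: "0 < m" "0 < n" for m n :: nat
    proof
      assume eq: "a [^] m = b [^] n"
      have px: "x [^] m \<in> P" and py: "y [^] n \<in> P"
        using cone_pow[OF P] xy mn by auto
      have "x [^] m \<noteq> inv (y [^] n)" "inv (x [^] m) \<noteq> y [^] n"
        using px py cone_inv[OF P px] cone_inv[OF P py] by metis+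
      moreover have "inv (x [^] m) \<noteq> inv (y [^] n)"
        using indep[OF mn] c by (metis inv_inv nat_pow_closed)
      moreover note indep[OF mn]
      ultimately show False
        using eq ab(3,4) c by (auto simp: nat_pow_inv)
    qed
    then show ?thesis
      using no_isolated_cone[OF Q' S ab(1,2)] by blast
  qed
  show "\<exists>t\<in>carrier G. \<forall>P\<in>{P. cone G P}. z \<in> P \<longleftrightarrow> t \<in> P" for z
  proof (cases "z \<in> carrier G")
    case False
    have "z \<notin> P \<and> \<one> \<notin> P" if "cone G P" for P
      using False rel_coneD(5)[OF that] rel_coneD(7)[OF that, of \<one>] by blast
    then show ?thesis
      by (intro bexI[of _ \<one>]) auto
  qed blast
qed (use P F countable in auto)

text \<open>The isolator of the subgroup \<open>E\<close> generated by \<open>S\<close>: all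
  elements with a positive power in \<open>E\<close>. It is countable because taking n-th powers is
  injective in a torsion-free abelian group.\<close>

lemma countable_isolated_subgroup:
  assumes torsion_free: "\<And>x (n::nat). x \<in> carrier G \<Longrightarrow> 0 < n \<Longrightarrow> x [^] n = \<one> \<Longrightarrow> x = \<one>"
    and S: "countable S" "S \<subseteq> carrier G"
  shows "\<exists>B. subgroup B G \<and> S \<subseteq> B \<and> countable B \<and>
    (\<forall>x\<in>carrier G. \<forall>n::nat. 0 < n \<longrightarrow> x [^] n \<in> B \<longrightarrow> x \<in> B)"
proof -
  let ?N = "submonoid_span G S"
  have Nc: "?N \<subseteq> carrier G"
    using submonoid_span_carrier[OF S(2)] .
  define E where "E = {u \<otimes> inv v | u v. u \<in> ?N \<and> v \<in> ?N}"
  define B where "B = {x \<in> carrier G. \<exists>n::nat. 0 < n \<and> x [^] n \<in> E}"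
  have E_mult: "x \<otimes> y \<in> E" if xy: "x \<in> E" "y \<in> E" for x y
  proof -
    obtain u v u' v' where uv: "u \<in> ?N" "v \<in> ?N" "u' \<in> ?N" "v' \<in> ?N"
      "x = u \<otimes> inv v" "y = u' \<otimes> inv v'"
      using xy unfolding E_def by blast
    have c: "u \<in> carrier G" "v \<in> carrier G" "u' \<in> carrier G" "v' \<in> carrier G"
      using uv Nc by auto
    have "x \<otimes> y = (u \<otimes> u') \<otimes> inv (v \<otimes> v')"
      using uv(5,6) c by (simp add: inv_mult m_ac)
    moreover have "u \<otimes> u' \<in> ?N" "v \<otimes> v' \<in> ?N"
      using submonoid_span_mult[OF S(2)] uv by auto
    ultimately show ?thesis
      unfolding E_def by blast
  qed
  have E_inv: "inv x \<in> E" if x: "x \<in> E" for x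
  proof -
    obtain u v where uv: "u \<in> ?N" "v \<in> ?N" "x = u \<otimes> inv v"
      using x unfolding E_def by blast
    moreover from this have "u \<in> carrier G" "v \<in> carrier G"
      using Nc by auto
    ultimately have "inv x = v \<otimes> inv u"
      by (simp add: inv_mult_group)
    then show ?thesis
      using uv unfolding E_def by blast
  qed
  have E_incl: "x \<in> E" if "x \<in> ?N" for x
  proof -
    have "x = x \<otimes> inv \<one>"
      using that Nc by auto
    then show ?thesis
      unfolding E_def using that submonoid_span.one by blast
  qed
  have E_pow: "x [^] n \<in> E" if "x \<in> E" for x and n :: nat
    using that by (induction n) (auto intro: E_mult E_incl submonoid_span.one)
  have "countable E"
  proof -
    have "E = (\<lambda>(u, v). u \<otimes> inv v) ` (?N \<times> ?N)"
      unfolding E_def by auto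
    then show ?thesis
      using countable_submonoid_span[OF S(1)] by simp
  qed
  have "B \<subseteq> (\<Union>n\<in>{0<..}. {x \<in> carrier G. x [^] (n::nat) \<in> E})"
    unfolding B_def by auto
  moreover have "countable {x \<in> carrier G. x [^] (n::nat) \<in> E}" if "0 < n" for n
  proof (rule countable_image_inj_on)
    show "countable ((\<lambda>x. x [^] n) ` {x \<in> carrier G. x [^] n \<in> E})"
      by (rule countable_subset[OF _ \<open>countable E\<close>]) auto
    show "inj_on (\<lambda>x. x [^] n) {x \<in> carrier G. x [^] n \<in> E}"
    proof (rule inj_onI)
      fix x y
      assume xy: "x \<in> {x \<in> carrier G. x [^] n \<in> E}" "y \<in> {x \<in> carrier G. x [^] n \<in> E}"
        and eq: "x [^] n = y [^] n"
      then have "(inv x \<otimes> y) [^] n = \<one>"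
        by (simp add: nat_pow_distrib nat_pow_inv)
      then have "inv x \<otimes> y = \<one>"
        using torsion_free[of "inv x \<otimes> y" n] xy that by auto
      then show "x = y"
        using inv_mult_eq_one_iff xy by auto
    qed
  qed
  ultimately have "countable B"
    by (meson countable_UN countable_subset greaterThan_iff uncountable_def countableI_type)
  moreover have sub: "S \<subseteq> B"
  proof
    fix x
    assume x: "x \<in> S"
    then have "x [^] (1::nat) \<in> E"
      using E_incl[OF submonoid_span_incl[OF S(2) x]] S(2) by auto
    then show "x \<in> B"
      unfolding B_def using x S(2) by (intro CollectI conjI exI[of _ 1]) auto
  qed
  moreover have "subgroup B G"
  proof (rule subgroupI)
    have "\<one> [^] (1::nat) \<in> E"
      using E_incl[OF submonoid_span.one] by simp
    then have "\<one> \<in> B"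
      unfolding B_def by (intro CollectI conjI exI[of _ 1]) auto
    then show "B \<noteq> {}"
      by blast
    show "inv x \<in> B" if "x \<in> B" for x
      using that E_inv unfolding B_def by (auto simp: nat_pow_inv)
    show "x \<otimes> y \<in> B" if xy: "x \<in> B" "y \<in> B" for x y
    proof -
      obtain m n :: nat where mn: "0 < m" "x [^] m \<in> E" "0 < n" "y [^] n \<in> E"
        and c: "x \<in> carrier G" "y \<in> carrier G"
        using xy unfolding B_def by blast
      have "(x \<otimes> y) [^] (m * n) = (x [^] m) [^] n \<otimes> (y [^] n) [^] m"
        using c by (simp add: nat_pow_distrib nat_pow_pow mult.commute)
      then have "(x \<otimes> y) [^] (m * n) \<in> E"
        using E_mult E_pow mn by simp
      then show ?thesis
        unfolding B_def using c mn by (intro CollectI conjI exI[of _ "m * n"]) auto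
    qed
  qed (auto simp: B_def)
  moreover have "x \<in> B" if x: "x \<in> carrier G" and n: "0 < n" "x [^] n \<in> B" for x and n :: nat
  proof -
    obtain m :: nat where "0 < m" "(x [^] n) [^] m \<in> E"
      using n(2) unfolding B_def by blast
    then show ?thesis
      unfolding B_def using x n(1) by (intro CollectI conjI exI[of _ "n * m"]) (auto simp: nat_pow_pow)
  qed
  ultimately show ?thesis
    by blast
qed

end

context group
begin

lemma rel_cone_subgroup_iff:
  assumes B: "subgroup B G"
  shows "rel_cone (G\<lparr>carrier := B\<rparr>) {\<one>} B P \<longleftrightarrow> rel_cone G {\<one>} B P"
proof -
  interpret B: group "G\<lparr>carrier := B\<rparr>"
    by (rule subgroup.subgroup_is_group[OF B is_group])
  have "subgroup {\<one>} (G\<lparr>carrier := B\<rparr>)" "subgroup B (G\<lparr>carrier := B\<rparr>)"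
    using B.triv_subgroup B.subgroup_self by simp_all
  then show ?thesis
    using B triv_subgroup m_inv_consistent[OF B] unfolding rel_cone_def by auto
qed

lemma cantor_many_subgroup_iff:
  assumes B: "subgroup B G"
  shows "cantor_many (G\<lparr>carrier := B\<rparr>) {\<one>} B F \<longleftrightarrow> cantor_many G {\<one>} B F"
  unfolding cantor_many_def rel_cone_subgroup_iff[OF B] ..

end

text \<open>The orders vary on a countable isolated subgroup \<open>B\<close> containing
  \<open>F\<close>, x and y. The quotient by \<open>B\<close> is torsion-free, so it has an order,
  and one such order extends all of them lexicographically.\<close>

lemma (in comm_group) cantor_many_abelian:
  assumes P: "cone G P" and F: "finite F" "F \<subseteq> P"
    and xy: "x \<in> P" "y \<in> P" and indep: "\<And>(m::nat) (n::nat). 0 < m \<Longrightarrow> 0 < n \<Longrightarrow> x [^] m \<noteq> y [^] n"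
  shows "cantor_many G {\<one>} (carrier G) F"
proof -
  have Pc: "P \<subseteq> carrier G"
    using rel_coneD(5)[OF P] .
  have tf: "z = \<one>" if "z \<in> carrier G" "0 < n" "z [^] n = \<one>" for z and n :: nat
    using cone_isolated[OF P that(1) _ that(2)] that(3) by auto
  have "countable (insert x (insert y F))" "insert x (insert y F) \<subseteq> carrier G"
    using F xy Pc by (auto simp: countable_finite)
  from countable_isolated_subgroup[OF _ this] tf
  have "\<exists>B. subgroup B G \<and> insert x (insert y F) \<subseteq> B \<and> countable B \<and>
      (\<forall>x\<in>carrier G. \<forall>n::nat. 0 < n \<longrightarrow> x [^] n \<in> B \<longrightarrow> x \<in> B)"
    by simp
  then obtain B where B: "subgroup B G" "insert x (insert y F) \<subseteq> B" "countable B"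
    and iso': "\<forall>x\<in>carrier G. \<forall>n::nat. 0 < n \<longrightarrow> x [^] n \<in> B \<longrightarrow> x \<in> B"
    by (elim exE conjE)
  have iso: "z \<in> B" if "z \<in> carrier G" "0 < n" "z [^] n \<in> B" for z and n :: nat
    using iso' that by simp
  \<comment> \<open>The trivial preorder of the quotient by \<open>B\<close>, to be extended to a
    total one.\<close>
  have pre: "preorder_cone G B B"
    unfolding preorder_cone_def using subgroup.subset[OF B(1)] subgroup.m_closed[OF B(1)] by auto
  have "\<exists>Q. rel_cone G B (carrier G) Q \<and> B - B \<subseteq> Q"
    by (rule preorder_cone_extend[OF B(1) pre]) (rule iso)
  then obtain Q where Q: "rel_cone G B (carrier G) Q"
    by blast
  interpret B: group "G\<lparr>carrier := B\<rparr>"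
    by (rule subgroup.subgroup_is_group[OF B(1) is_group])
  interpret B: comm_group "G\<lparr>carrier := B\<rparr>"
    by (rule B.group_comm_groupI) (use subgroup.mem_carrier[OF B(1)] in \<open>simp add: m_comm\<close>)
  have PB: "rel_cone G {\<one>} B (P \<inter> B)"
    using rel_cone_restrict[OF P B(1)] subgroup.one_closed[OF B(1)] subgroup.subset[OF B(1)] by auto
  have "cantor_many (G\<lparr>carrier := B\<rparr>) {\<one>} B F"
    using B.cantor_many_countable_abelian[of "P \<inter> B" F x y] rel_cone_subgroup_iff[OF B(1)] PB F B xy
      indep nat_pow_consistent by auto
  then have many: "cantor_many G {\<one>} B F"
    unfolding cantor_many_subgroup_iff[OF B(1)] .
  have triv: "rel_cone G {\<one>} {\<one>} {}"
    using triv_subgroup by (intro rel_coneI) auto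
  show ?thesis
    using cantor_many_extend[OF triv Q many] by blast
qed

subsection \<open>Quotients\<close>

text \<open>Describes the quotient of \<open>C\<close> by \<open>D\<close> up to isomorphism, so
  that later arguments avoid cosets; \<open>quotient_map_exists\<close> supplies the coset group.
  The values of \<pi> outside \<open>C\<close> are arbitrary.\<close>

definition quotient_map :: "('a, 'b) monoid_scheme \<Rightarrow> 'a set \<Rightarrow> 'a set \<Rightarrow> 'c monoid \<Rightarrow> ('a \<Rightarrow> 'c) \<Rightarrow> bool"
  where "quotient_map G D C Q \<pi> \<longleftrightarrow> group Q \<and> \<pi> ` C = carrier Q \<and>
    (\<forall>x\<in>C. \<forall>y\<in>C. \<pi> (x \<otimes>\<^bsub>G\<^esub> y) = \<pi> x \<otimes>\<^bsub>Q\<^esub> \<pi> y) \<and> (\<forall>x\<in>C. \<pi> x = \<one>\<^bsub>Q\<^esub> \<longleftrightarrow> x \<in> D)"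

context group
begin

lemma quotient_map_exists:
  assumes D: "subgroup D G" and C: "subgroup C G" and DC: "D \<subseteq> C"
    and normal: "\<And>c d. c \<in> C \<Longrightarrow> d \<in> D \<Longrightarrow> c \<otimes> d \<otimes> inv c \<in> D"
  shows "\<exists>(Q :: 'a set monoid) \<pi>. quotient_map G D C Q \<pi>"
proof -
  let ?H = "G\<lparr>carrier := C\<rparr>"
  interpret H: group ?H
    by (rule subgroup.subgroup_is_group[OF C is_group])
  have D': "subgroup D ?H"
    by (rule subgroup_incl[OF D C DC])
  interpret normal D ?H
    using D' normal m_inv_consistent[OF C] unfolding H.normal_inv_iff by simp
  have "quotient_map G D C (?H Mod D) (\<lambda>x. D #>\<^bsub>?H\<^esub> x)"
    unfolding quotient_map_def
  proof (intro conjI ballI)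
    show "group (?H Mod D)"
      by (rule factorgroup_is_group)
    show "(\<lambda>x. D #>\<^bsub>?H\<^esub> x) ` C = carrier (?H Mod D)"
      unfolding carrier_FactGroup by simp
    show "D #>\<^bsub>?H\<^esub> (x \<otimes> y) = (D #>\<^bsub>?H\<^esub> x) \<otimes>\<^bsub>?H Mod D\<^esub> (D #>\<^bsub>?H\<^esub> y)"
      if "x \<in> C" "y \<in> C" for x y
      using rcos_sum[of x y] that by simp
    show "D #>\<^bsub>?H\<^esub> x = \<one>\<^bsub>?H Mod D\<^esub> \<longleftrightarrow> x \<in> D" if "x \<in> C" for x
      using H.coset_join1[of D x] H.coset_join2[of x D] D' that by auto
  qed
  then show ?thesis
    by blast
qed

lemma quotient_mapD:
  assumes q: "quotient_map G D C Q \<pi>" and D: "subgroup D G" and C: "subgroup C G"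
  shows "group Q" "\<And>x. x \<in> C \<Longrightarrow> \<pi> x \<in> carrier Q"
    and "\<And>x y. x \<in> C \<Longrightarrow> y \<in> C \<Longrightarrow> \<pi> (x \<otimes> y) = \<pi> x \<otimes>\<^bsub>Q\<^esub> \<pi> y"
    and "\<And>x. x \<in> C \<Longrightarrow> \<pi> x = \<one>\<^bsub>Q\<^esub> \<longleftrightarrow> x \<in> D"
    and "\<And>x. x \<in> C \<Longrightarrow> \<pi> (inv x) = inv\<^bsub>Q\<^esub> (\<pi> x)"
    and "\<And>x n. x \<in> C \<Longrightarrow> \<pi> (x [^] (n::nat)) = \<pi> x [^]\<^bsub>Q\<^esub> n"
    and "\<And>x y. x \<in> C \<Longrightarrow> y \<in> C \<Longrightarrow> \<pi> x = \<pi> y \<longleftrightarrow> inv x \<otimes> y \<in> D"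
proof -
  show Q: "group Q" and cl: "\<And>x. x \<in> C \<Longrightarrow> \<pi> x \<in> carrier Q"
    and mult: "\<And>x y. x \<in> C \<Longrightarrow> y \<in> C \<Longrightarrow> \<pi> (x \<otimes> y) = \<pi> x \<otimes>\<^bsub>Q\<^esub> \<pi> y"
    and ker: "\<And>x. x \<in> C \<Longrightarrow> \<pi> x = \<one>\<^bsub>Q\<^esub> \<longleftrightarrow> x \<in> D"
    using q unfolding quotient_map_def by auto
  interpret Q: group Q
    by (rule Q)
  have ic: "inv x \<in> C" "x \<in> carrier G" if "x \<in> C" for x
    using subgroup.m_inv_closed[OF C] subgroup.mem_carrier[OF C] that by auto
  have one: "\<pi> \<one> = \<one>\<^bsub>Q\<^esub>"
    using ker[of \<one>] subgroup.one_closed[OF C] subgroup.one_closed[OF D] by simp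
  show inv: "\<pi> (inv x) = inv\<^bsub>Q\<^esub> (\<pi> x)" if "x \<in> C" for x
    using mult[of "inv x" x] that ic[OF that] one cl Q.inv_equality by simp
  show "\<pi> (x [^] n) = \<pi> x [^]\<^bsub>Q\<^esub> n" if "x \<in> C" for x and n :: nat
  proof (induction n)
    case (Suc n)
    have "x [^] n \<in> C"
      using that by (induction n) (auto intro: subgroup.m_closed[OF C] subgroup.one_closed[OF C])
    then show ?case
      using mult[of "x [^] n" x] that Suc by simp
  qed (simp add: one)
  show "\<pi> x = \<pi> y \<longleftrightarrow> inv x \<otimes> y \<in> D" if "x \<in> C" "y \<in> C" for x y
  proof -
    have "inv x \<otimes> y \<in> C"
      using subgroup.m_closed[OF C] ic that by blast
    then have "inv x \<otimes> y \<in> D \<longleftrightarrow> inv\<^bsub>Q\<^esub> (\<pi> x) \<otimes>\<^bsub>Q\<^esub> \<pi> y = \<one>\<^bsub>Q\<^esub>"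
      using ker[of "inv x \<otimes> y"] mult[of "inv x" y] inv that ic by simp
    then show ?thesis
      using Q.inv_mult_eq_one_iff[of "\<pi> x" "\<pi> y"] cl that by simp
  qed
qed

text \<open>\<open>P\<close> absorbs \<open>D\<close>, hence is a union of cosets, and membership
  can be read off in the quotient.\<close>

lemma quotient_cone:
  assumes q: "quotient_map G D C Q \<pi>" and P: "rel_cone G D C P"
  shows "cone Q (\<pi> ` P)" "\<And>x. x \<in> C \<Longrightarrow> \<pi> x \<in> \<pi> ` P \<longleftrightarrow> x \<in> P"
proof -
  note PD = rel_coneD[OF P]
  note qD = quotient_mapD[OF q PD(1,2)]
  interpret Q: group Q
    by (rule qD(1))
  show mem: "\<pi> x \<in> \<pi> ` P \<longleftrightarrow> x \<in> P" if x: "x \<in> C" for x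
  proof
    assume "\<pi> x \<in> \<pi> ` P"
    then obtain p where p: "p \<in> P" "\<pi> p = \<pi> x"
      by (metis imageE)
    then have "inv p \<otimes> x \<in> D"
      using qD(7)[of p x] x PD(4) by blast
    then have "p \<otimes> (inv p \<otimes> x) \<in> P"
      by (rule PD(10)[OF p(1)])
    then show "x \<in> P"
      using p(1) PD(5,6) x by (simp add: subset_iff)
  qed blast
  have img: "\<pi> ` C = carrier Q"
    using q unfolding quotient_map_def by blast
  show "cone Q (\<pi> ` P)"
  proof (rule Q.rel_coneI[OF Q.triv_subgroup Q.subgroup_self])
    show "\<pi> ` P \<subseteq> carrier Q"
      using qD(2) PD(4) by blast
    show "\<pi> ` P \<inter> {\<one>\<^bsub>Q\<^esub>} = {}"
    proof -
      have "\<one>\<^bsub>Q\<^esub> \<noteq> \<pi> p" if "p \<in> P" for p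
        using qD(4)[of p] PD(4,7) that by auto
      then show ?thesis
        by auto
    qed
    show "a \<otimes>\<^bsub>Q\<^esub> b \<in> \<pi> ` P" if ab: "a \<in> \<pi> ` P" "b \<in> \<pi> ` P" for a b
    proof -
      obtain x y where xy: "x \<in> P" "y \<in> P" "a = \<pi> x" "b = \<pi> y"
        using ab by blast
      moreover from this have "x \<in> C" "y \<in> C"
        using PD(4) by auto
      ultimately have "a \<otimes>\<^bsub>Q\<^esub> b = \<pi> (x \<otimes> y)"
        using qD(3)[of x y] by simp
      then show ?thesis
        using PD(8)[OF xy(1,2)] by simp
    qed
    show "d \<otimes>\<^bsub>Q\<^esub> a \<in> \<pi> ` P" "a \<otimes>\<^bsub>Q\<^esub> d \<in> \<pi> ` P" if "a \<in> \<pi> ` P" "d \<in> {\<one>\<^bsub>Q\<^esub>}" for a d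
    proof -
      have "a \<in> carrier Q"
        using that qD(2) PD(4) by blast
      then show "d \<otimes>\<^bsub>Q\<^esub> a \<in> \<pi> ` P" "a \<otimes>\<^bsub>Q\<^esub> d \<in> \<pi> ` P"
        using that by auto
    qed
    show "inv\<^bsub>Q\<^esub> a \<in> \<pi> ` P" if a: "a \<in> carrier Q" "a \<notin> {\<one>\<^bsub>Q\<^esub>}" "a \<notin> \<pi> ` P" for a
    proof -
      obtain x where x: "x \<in> C" "a = \<pi> x"
        using a(1) img by blast
      then have "inv x \<in> P"
        using PD(11)[OF x(1)] a(2,3) qD(4)[OF x(1)] by blast
      then show ?thesis
        using qD(5)[OF x(1)] x(2) by (metis imageI)
    qed
  qed simp
qed

lemma quotient_cone_vimage:
  assumes q: "quotient_map G D C Q \<pi>" and D: "subgroup D G" and C: "subgroup C G" "D \<subseteq> C"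
    and P: "cone Q P"
  shows "rel_cone G D C {x \<in> C. \<pi> x \<in> P}"
proof -
  note qD = quotient_mapD[OF q D C(1)]
  interpret Q: group Q
    by (rule qD(1))
  note PD = rel_coneD[OF P]
  show ?thesis
  proof (rule rel_coneI[OF D C])
    show "{x \<in> C. \<pi> x \<in> P} \<inter> D = {}"
    proof -
      have "\<pi> x \<notin> P" if "x \<in> D" for x
        using qD(4)[of x] PD(7)[of "\<pi> x"] C(2) that by blast
      then show ?thesis
        by blast
    qed
    show "x \<otimes> y \<in> {x \<in> C. \<pi> x \<in> P}" if "x \<in> {x \<in> C. \<pi> x \<in> P}" "y \<in> {x \<in> C. \<pi> x \<in> P}" for x y
      using that qD(3)[of x y] PD(8) subgroup.m_closed[OF C(1)] by simp
    show "d \<otimes> x \<in> {x \<in> C. \<pi> x \<in> P}" "x \<otimes> d \<in> {x \<in> C. \<pi> x \<in> P}"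
      if "x \<in> {x \<in> C. \<pi> x \<in> P}" "d \<in> D" for x d
    proof -
      have "d \<in> C" "\<pi> d = \<one>\<^bsub>Q\<^esub>"
        using qD(4)[of d] that(2) C(2) by auto
      then show "d \<otimes> x \<in> {x \<in> C. \<pi> x \<in> P}" "x \<otimes> d \<in> {x \<in> C. \<pi> x \<in> P}"
        using that(1) qD(2,3) subgroup.m_closed[OF C(1)] by simp_all
    qed
    show "inv x \<in> {x \<in> C. \<pi> x \<in> P}" if "x \<in> C" "x \<notin> D" "x \<notin> {x \<in> C. \<pi> x \<in> P}" for x
      using that PD(11)[of "\<pi> x"] qD(2,4,5)[of x] subgroup.m_inv_closed[OF C(1)] by auto
  qed auto
qed

lemma cantor_many_quotient:
  assumes q: "quotient_map G D C Q \<pi>" and D: "subgroup D G" and C: "subgroup C G" "D \<subseteq> C"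
    and F: "F \<subseteq> C" and many: "cantor_many Q {\<one>\<^bsub>Q\<^esub>} (carrier Q) (\<pi> ` F)"
  shows "cantor_many G D C F"
proof -
  obtain \<Phi> where \<Phi>: "cantor_family \<Phi>" "\<And>b. cone Q (\<Phi> b)" "\<And>b. \<pi> ` F \<subseteq> \<Phi> b"
    using many unfolding cantor_many_def by blast
  have img: "\<pi> ` C = carrier Q"
    using q unfolding quotient_map_def by blast
  define \<Psi> where "\<Psi> b = {x \<in> C. \<pi> x \<in> \<Phi> b}" for b
  have \<Psi>: "\<pi> ` \<Psi> b = \<Phi> b" for b
    using rel_coneD(5)[OF \<Phi>(2), of b] img unfolding \<Psi>_def by auto
  have "inj \<Psi>"
  proof (rule injI)
    fix b b'
    assume "\<Psi> b = \<Psi> b'"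
    then have "\<Phi> b = \<Phi> b'"
      using \<Psi> by metis
    then show "b = b'"
      using \<Phi>(1) unfolding cantor_family_def by (metis injD)
  qed
  moreover have "\<exists>n. \<forall>b b'. (\<forall>i<n. b i = b' i) \<longrightarrow> (x \<in> \<Psi> b \<longleftrightarrow> x \<in> \<Psi> b')" for x
  proof -
    obtain n where "\<And>b b'. (\<forall>i<n. b i = b' i) \<Longrightarrow> (\<pi> x \<in> \<Phi> b \<longleftrightarrow> \<pi> x \<in> \<Phi> b')"
      using \<Phi>(1) unfolding cantor_family_def by blast
    then show ?thesis
      unfolding \<Psi>_def by (intro exI[of _ n]) blast
  qed
  ultimately have "cantor_family \<Psi>"
    unfolding cantor_family_def by blast
  moreover have "rel_cone G D C (\<Psi> b)" for b
    unfolding \<Psi>_def by (rule quotient_cone_vimage[OF q D C \<Phi>(2)])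
  moreover have "F \<subseteq> \<Psi> b" for b
    using \<Phi>(3)[of b] F unfolding \<Psi>_def by blast
  ultimately show ?thesis
    unfolding cantor_many_def by blast
qed

lemma comm_group_quotient:
  assumes q: "quotient_map G D C Q \<pi>" and D: "subgroup D G" and C: "subgroup C G"
    and abelian: "\<And>x y. x \<in> C \<Longrightarrow> y \<in> C \<Longrightarrow> inv (y \<otimes> x) \<otimes> (x \<otimes> y) \<in> D"
  shows "comm_group Q"
proof -
  note qD = quotient_mapD[OF q D C]
  interpret Q: group Q
    by (rule qD(1))
  have img: "\<pi> ` C = carrier Q"
    using q unfolding quotient_map_def by blast
  show ?thesis
  proof (rule Q.group_comm_groupI)
    fix a b
    assume "a \<in> carrier Q" "b \<in> carrier Q"
    then have "a \<in> \<pi> ` C" "b \<in> \<pi> ` C"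
      using img by simp_all
    then obtain x y where xy: "x \<in> C" "y \<in> C" "a = \<pi> x" "b = \<pi> y"
      by (elim imageE)
    have "\<pi> (y \<otimes> x) = \<pi> (x \<otimes> y)"
      using qD(7)[of "y \<otimes> x" "x \<otimes> y"] abelian[OF xy(1,2)] subgroup.m_closed[OF C] xy by simp
    then show "a \<otimes>\<^bsub>Q\<^esub> b = b \<otimes>\<^bsub>Q\<^esub> a"
      using qD(3) xy by simp
  qed
qed

text \<open>\<open>indep\<close> says that the images of x and y in the abelian quotient have no
  common positive power, which is what \<open>cantor_many_abelian\<close> asks for.\<close>

lemma cantor_many_abelian_quotient:
  assumes P: "rel_cone G D C P"
    and normal: "\<And>c d. c \<in> C \<Longrightarrow> d \<in> D \<Longrightarrow> c \<otimes> d \<otimes> inv c \<in> D"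
    and abelian: "\<And>x y. x \<in> C \<Longrightarrow> y \<in> C \<Longrightarrow> inv (y \<otimes> x) \<otimes> (x \<otimes> y) \<in> D"
    and F: "finite F" "F \<subseteq> P" and xy: "x \<in> P" "y \<in> P"
    and indep: "\<And>(m::nat) (n::nat). 0 < m \<Longrightarrow> 0 < n \<Longrightarrow> inv (x [^] m) \<otimes> y [^] n \<notin> D"
  shows "cantor_many G D C F"
proof -
  note PD = rel_coneD[OF P]
  obtain Q :: "'a set monoid" and \<pi> where q: "quotient_map G D C Q \<pi>"
    using quotient_map_exists[OF PD(1-3) normal] by blast
  note qD = quotient_mapD[OF q PD(1,2)]
  interpret Q: comm_group Q
    by (rule comm_group_quotient[OF q PD(1,2) abelian])
  have xyC: "x \<in> C" "y \<in> C"
    using xy PD(4) by auto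
  have pow: "z [^] n \<in> C" if "z \<in> C" for z and n :: nat
    using that by (induction n) (auto intro: subgroup.m_closed[OF PD(2)] subgroup.one_closed[OF PD(2)])
  have "cantor_many Q {\<one>\<^bsub>Q\<^esub>} (carrier Q) (\<pi> ` F)"
  proof (rule Q.cantor_many_abelian[OF quotient_cone(1)[OF q P]])
    show "\<pi> x \<in> \<pi> ` P" "\<pi> y \<in> \<pi> ` P" "finite (\<pi> ` F)" "\<pi> ` F \<subseteq> \<pi> ` P"
      using xy F by auto
    show "\<pi> x [^]\<^bsub>Q\<^esub> m \<noteq> \<pi> y [^]\<^bsub>Q\<^esub> n" if "0 < m" "0 < n" for m n :: nat
      using qD(7)[of "x [^] m" "y [^] n"] qD(6) pow xyC indep[OF that] by simp
  qed
  then show ?thesis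
    using cantor_many_quotient[OF q PD(1-3)] F(2) PD(4) by blast
qed

end

subsection \<open>Jumps of rank one\<close>

text \<open>An x with x^m = b^n goes to n/m. The value is unambiguous because b, being positive, has
  infinite order.\<close>

lemma (in comm_group) rational_hom:
  assumes P: "cone G P" and b: "b \<in> P"
    and rank1: "\<And>x. x \<in> P \<Longrightarrow> \<exists>(m::nat) (n::nat). 0 < m \<and> 0 < n \<and> x [^] m = b [^] n"
  shows "\<exists>\<phi> :: 'a \<Rightarrow> real. (\<forall>x\<in>carrier G. \<forall>y\<in>carrier G. \<phi> (x \<otimes> y) = \<phi> x + \<phi> y) \<and>
    (\<forall>x\<in>carrier G. \<phi> x \<in> \<rat>) \<and> (\<forall>x\<in>carrier G. \<phi> x > 0 \<longleftrightarrow> x \<in> P) \<and> \<phi> b = 1"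
proof -
  have Pc: "P \<subseteq> carrier G"
    using rel_coneD(5)[OF P] .
  have bc: "b \<in> carrier G"
    using b Pc by blast
  have order: "k = 0" if "b [^] (k::int) = \<one>" for k
  proof (rule ccontr)
    assume "k \<noteq> 0"
    have "b [^] nat \<bar>k\<bar> = \<one>"
    proof (cases "k \<ge> 0")
      case True
      then show ?thesis
        using that by (simp add: pow_nat)
    next
      case False
      then have "b [^] nat (- k) = b [^] (- k)"
        by (simp add: pow_nat)
      then show ?thesis
        using that False int_pow_neg[OF bc, of k] by simp
    qed
    then show False
      using cone_pow[OF P b, of "nat \<bar>k\<bar>"] \<open>k \<noteq> 0\<close> rel_coneD(7)[OF P, of \<one>] by auto
  qed
  \<comment> \<open>Integer exponents n extend the relation from positive elements to the neutral
    and the negative ones.\<close>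
  define rel where "rel x q \<longleftrightarrow> (\<exists>(m::nat) (n::int). 0 < m \<and> x [^] m = b [^] n \<and> q = of_int n / of_nat m)"
    for x and q :: real
  have rel_unique: "q = q'" if x: "x \<in> carrier G" and "rel x q" "rel x q'" for x q q'
  proof -
    obtain m :: nat and n :: int where m: "0 < m" "x [^] m = b [^] n" "q = of_int n / of_nat m"
      using \<open>rel x q\<close> unfolding rel_def by blast
    obtain m' :: nat and n' :: int
      where m': "0 < m'" "x [^] m' = b [^] n'" "q' = of_int n' / of_nat m'"
      using \<open>rel x q'\<close> unfolding rel_def by blast
    have "b [^] (n * int m') = (x [^] m) [^] m'"
      using m(2) int_pow_pow[OF bc, of n "int m'"] by (simp add: int_pow_int)
    also have "\<dots> = (x [^] m') [^] m"
      using x by (simp add: nat_pow_pow mult.commute)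
    also have "\<dots> = b [^] (n' * int m)"
      using m'(2) int_pow_pow[OF bc, of n' "int m"] by (simp add: int_pow_int)
    finally have "b [^] (n * int m' - n' * int m) = \<one>"
      using bc by (simp add: int_pow_diff)
    then have "n * int m' = n' * int m"
      using order by fastforce
    then have "of_int n * real m' = of_int n' * real m"
      by (metis of_int_mult of_int_of_nat_eq)
    then show ?thesis
      unfolding m(3) m'(3) using m(1) m'(1) by (simp add: frac_eq_eq)
  qed
  have rel_mult: "rel (x \<otimes> y) (q + q')"
    if xy: "x \<in> carrier G" "y \<in> carrier G" and "rel x q" "rel y q'" for x y q q'
  proof -
    obtain m :: nat and n :: int where m: "0 < m" "x [^] m = b [^] n" "q = of_int n / of_nat m"
      using \<open>rel x q\<close> unfolding rel_def by blast
    obtain m' :: nat and n' :: int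
      where m': "0 < m'" "y [^] m' = b [^] n'" "q' = of_int n' / of_nat m'"
      using \<open>rel y q'\<close> unfolding rel_def by blast
    have "(x \<otimes> y) [^] (m * m') = (x [^] m) [^] m' \<otimes> (y [^] m') [^] m"
      using xy by (simp add: nat_pow_distrib nat_pow_pow mult.commute)
    also have "\<dots> = b [^] (n * int m') \<otimes> b [^] (n' * int m)"
      using m(2) m'(2) int_pow_pow[OF bc, of n "int m'"] int_pow_pow[OF bc, of n' "int m"]
      by (simp add: int_pow_int)
    also have "\<dots> = b [^] (n * int m' + n' * int m)"
      using bc by (simp add: int_pow_mult)
    finally have "(x \<otimes> y) [^] (m * m') = b [^] (n * int m' + n' * int m)" .
    moreover have "q + q' = of_int (n * int m' + n' * int m) / of_nat (m * m')"
      using m m' by (simp add: field_simps)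
    ultimately show ?thesis
      unfolding rel_def using m(1) m'(1)
      by (intro exI[of _ "m * m'"] exI[of _ "n * int m' + n' * int m"]) simp
  qed
  have pos: "\<exists>q>0. rel x q" if x: "x \<in> P" for x
  proof -
    obtain m n :: nat where mn: "0 < m" "0 < n" "x [^] m = b [^] n"
      using rank1[OF x] by blast
    then have "rel x (of_int (int n) / of_nat m)"
      unfolding rel_def by (intro exI[of _ m] exI[of _ "int n"]) (simp add: int_pow_int)
    then show ?thesis
      using mn by (intro exI[of _ "of_int (int n) / of_nat m"]) simp
  qed
  have one: "rel \<one> 0"
    unfolding rel_def by (intro exI[of _ 1] exI[of _ 0]) simp
  have inv: "rel (inv x) (- q)" if x: "x \<in> carrier G" "rel x q" for x q
  proof -
    obtain m :: nat and n :: int where m: "0 < m" "x [^] m = b [^] n" "q = of_int n / of_nat m"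
      using x(2) unfolding rel_def by blast
    have "inv x [^] m = b [^] (- n)"
      using m(2) x(1) bc by (simp add: nat_pow_inv int_pow_neg)
    then show ?thesis
      unfolding rel_def using m by (intro exI[of _ m] exI[of _ "- n"]) simp
  qed
  have neg: "\<exists>q<0. rel x q" if x: "inv x \<in> P" "x \<in> carrier G" for x
  proof -
    obtain q where "q > 0" "rel (inv x) q"
      using pos[OF x(1)] by blast
    then show ?thesis
      using inv[of "inv x" q] x(2) by (intro exI[of _ "- q"]) simp
  qed
  have ex: "\<exists>q. rel x q" if x: "x \<in> carrier G" for x
    using pos[of x] neg[of x] one rel_coneD(11)[OF P x] x by blast
  define \<phi> where "\<phi> x = (SOME q. rel x q)" for x
  have \<phi>_rel: "rel x (\<phi> x)" if "x \<in> carrier G" for x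
    unfolding \<phi>_def using ex[OF that] by (rule someI_ex)
  have \<phi>_eq: "\<phi> x = q" if "x \<in> carrier G" "rel x q" for x q
    using rel_unique[OF that(1) \<phi>_rel[OF that(1)] that(2)] .
  have add: "\<phi> (x \<otimes> y) = \<phi> x + \<phi> y" if "x \<in> carrier G" "y \<in> carrier G" for x y
    using \<phi>_eq[OF _ rel_mult[OF that \<phi>_rel[OF that(1)] \<phi>_rel[OF that(2)]]] that by simp
  have rat: "\<phi> x \<in> \<rat>" if "x \<in> carrier G" for x
    using \<phi>_rel[OF that] unfolding rel_def by auto
  have sign: "\<phi> x > 0 \<longleftrightarrow> x \<in> P" if x: "x \<in> carrier G" for x
  proof -
    have 1: "\<phi> x > 0" if "x \<in> P"
      using pos[OF that] \<phi>_eq[OF x] by auto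
    have 2: "\<phi> x < 0" if "inv x \<in> P"
      using neg[OF that x] \<phi>_eq[OF x] by auto
    have 3: "\<phi> \<one> = 0"
      using \<phi>_eq[OF _ one] by simp
    show ?thesis
      using 1 2 3 rel_coneD(11)[OF P x] by fastforce
  qed
  have "rel b 1"
    unfolding rel_def using bc by (intro exI[of _ 1] exI[of _ 1]) simp
  then have "\<phi> b = 1"
    using \<phi>_eq bc by blast
  then show ?thesis
    using add rat sign by blast
qed

text \<open>Commensurability of all positive elements modulo \<open>D\<close>; an abelian quotient
  with this property embeds in the rationals by \<open>rational_hom_quotient\<close>.\<close>

definition rank_one :: "('a, 'b) monoid_scheme \<Rightarrow> 'a set \<Rightarrow> 'a set \<Rightarrow> bool"
  where "rank_one G D P \<longleftrightarrow> (\<forall>x\<in>P. \<forall>y\<in>P. \<exists>(m::nat) (n::nat).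
    0 < m \<and> 0 < n \<and> inv\<^bsub>G\<^esub> (x [^]\<^bsub>G\<^esub> m) \<otimes>\<^bsub>G\<^esub> y [^]\<^bsub>G\<^esub> n \<in> D)"

context group
begin

lemma subgroup_pow:
  assumes "subgroup H G" "x \<in> H"
  shows "x [^] (n::nat) \<in> H"
  using assms by (induction n) (auto intro: subgroup.m_closed subgroup.one_closed)

lemma rational_hom_quotient:
  assumes P: "rel_cone G D C P"
    and normal: "\<And>c d. c \<in> C \<Longrightarrow> d \<in> D \<Longrightarrow> c \<otimes> d \<otimes> inv c \<in> D"
    and abelian: "\<And>x y. x \<in> C \<Longrightarrow> y \<in> C \<Longrightarrow> inv (y \<otimes> x) \<otimes> (x \<otimes> y) \<in> D"
    and b: "b \<in> P" and rank1: "rank_one G D P"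
  shows "\<exists>\<phi> :: 'a \<Rightarrow> real. (\<forall>x\<in>C. \<forall>y\<in>C. \<phi> (x \<otimes> y) = \<phi> x + \<phi> y) \<and>
    (\<forall>x\<in>C. \<phi> x \<in> \<rat>) \<and> (\<forall>x\<in>C. \<phi> x > 0 \<longleftrightarrow> x \<in> P) \<and> \<phi> b = 1"
proof -
  note PD = rel_coneD[OF P]
  obtain Q :: "'a set monoid" and \<pi> where q: "quotient_map G D C Q \<pi>"
    using quotient_map_exists[OF PD(1-3) normal] by blast
  note qD = quotient_mapD[OF q PD(1,2)]
  interpret Q: comm_group Q
    by (rule comm_group_quotient[OF q PD(1,2) abelian])
  have "\<exists>(m::nat) (n::nat). 0 < m \<and> 0 < n \<and> a [^]\<^bsub>Q\<^esub> m = \<pi> b [^]\<^bsub>Q\<^esub> n" if a: "a \<in> \<pi> ` P" for a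
  proof -
    obtain x where x: "x \<in> P" "a = \<pi> x"
      using a by blast
    obtain m n :: nat where mn: "0 < m" "0 < n" "inv (x [^] m) \<otimes> b [^] n \<in> D"
      using rank1 x(1) b unfolding rank_one_def by blast
    have c: "x \<in> C" "b \<in> C"
      using x(1) b PD(4) by auto
    then have "\<pi> (x [^] m) = \<pi> (b [^] n)"
      using qD(7)[of "x [^] m" "b [^] n"] mn(3) subgroup_pow[OF PD(2)] by simp
    then show ?thesis
      using qD(6) c x(2) mn by metis
  qed
  then obtain \<phi> :: "'a set \<Rightarrow> real" where \<phi>: "\<forall>x\<in>carrier Q. \<forall>y\<in>carrier Q. \<phi> (x \<otimes>\<^bsub>Q\<^esub> y) = \<phi> x + \<phi> y"
    "\<forall>x\<in>carrier Q. \<phi> x \<in> \<rat>" "\<forall>x\<in>carrier Q. \<phi> x > 0 \<longleftrightarrow> x \<in> \<pi> ` P" "\<phi> (\<pi> b) = 1"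
    using Q.rational_hom[OF quotient_cone(1)[OF q P], of "\<pi> b"] b by blast
  show ?thesis
  proof (intro exI[of _ "\<phi> \<circ> \<pi>"] conjI ballI)
    show "(\<phi> \<circ> \<pi>) (x \<otimes> y) = (\<phi> \<circ> \<pi>) x + (\<phi> \<circ> \<pi>) y" if "x \<in> C" "y \<in> C" for x y
      using that qD(2,3) \<phi>(1) by simp
    show "(\<phi> \<circ> \<pi>) x \<in> \<rat>" if "x \<in> C" for x
      using that qD(2) \<phi>(2) by simp
    show "(\<phi> \<circ> \<pi>) x > 0 \<longleftrightarrow> x \<in> P" if "x \<in> C" for x
      using that qD(2) \<phi>(3) quotient_cone(2)[OF q P that] by simp
  qed (use \<phi>(4) in simp)
qed

end

text \<open>Two consecutive jumps of rank one, with \<open>\<phi>\<close> identifying \<open>K/L\<close> with a subgroup of the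
  rationals.\<close>

locale rank_one_tower = group +
  fixes L K H PK PH :: "'a set" and b :: 'a and \<phi> :: "'a \<Rightarrow> real"
  assumes PK: "rel_cone G L K PK" and PH: "rel_cone G K H PH"
    and L_normal: "\<And>h l. h \<in> H \<Longrightarrow> l \<in> L \<Longrightarrow> h \<otimes> l \<otimes> inv h \<in> L"
    and K_normal: "\<And>h k. h \<in> H \<Longrightarrow> k \<in> K \<Longrightarrow> h \<otimes> k \<otimes> inv h \<in> K"
    and H_abelian: "\<And>x y. x \<in> H \<Longrightarrow> y \<in> H \<Longrightarrow> inv (y \<otimes> x) \<otimes> (x \<otimes> y) \<in> K"
    and K_rank_one: "rank_one G L PK" and H_rank_one: "rank_one G K PH"
    and b: "b \<in> PK"
    and \<phi>_mult: "\<And>x y. x \<in> K \<Longrightarrow> y \<in> K \<Longrightarrow> \<phi> (x \<otimes> y) = \<phi> x + \<phi> y"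
    and \<phi>_rat: "\<And>x. x \<in> K \<Longrightarrow> \<phi> x \<in> \<rat>"
    and \<phi>_pos: "\<And>x. x \<in> K \<Longrightarrow> \<phi> x > 0 \<longleftrightarrow> x \<in> PK"
    and \<phi>_b: "\<phi> b = 1"
begin

lemmas L = rel_coneD(1)[OF PK] and K = rel_coneD(2)[OF PK] and H = rel_coneD(2)[OF PH]
  and LK = rel_coneD(3)[OF PK] and KH = rel_coneD(3)[OF PH]
  and PK_K = rel_coneD(4)[OF PK] and PH_H = rel_coneD(4)[OF PH]

lemma H_carrier: "x \<in> H \<Longrightarrow> x \<in> carrier G"
  using rel_coneD(6)[OF PH] by blast

lemma K_carrier: "x \<in> K \<Longrightarrow> x \<in> carrier G"
  using H_carrier KH by blast

lemma H_closed [simp]: "x \<in> H \<Longrightarrow> y \<in> H \<Longrightarrow> x \<otimes> y \<in> H" "x \<in> H \<Longrightarrow> inv x \<in> H"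
  using subgroup.m_closed[OF H] subgroup.m_inv_closed[OF H] by auto

lemma K_closed [simp]: "x \<in> K \<Longrightarrow> y \<in> K \<Longrightarrow> x \<otimes> y \<in> K" "x \<in> K \<Longrightarrow> inv x \<in> K"
  using subgroup.m_closed[OF K] subgroup.m_inv_closed[OF K] by auto

lemma K_H: "x \<in> K \<Longrightarrow> x \<in> H"
  using KH by blast

lemma b_K: "b \<in> K"
  using b PK_K by blast

lemma \<phi>_one: "\<phi> \<one> = 0"
  using \<phi>_mult[of \<one> \<one>] subgroup.one_closed[OF K] by simp

lemma \<phi>_inv: "x \<in> K \<Longrightarrow> \<phi> (inv x) = - \<phi> x"
  using \<phi>_mult[of "inv x" x] \<phi>_one K_carrier[of x] by simp

lemma \<phi>_zero_iff:
  assumes "x \<in> K"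
  shows "\<phi> x = 0 \<longleftrightarrow> x \<in> L"
proof
  assume "\<phi> x = 0"
  then have "x \<notin> PK" "inv x \<notin> PK"
    using \<phi>_pos[of x] \<phi>_pos[of "inv x"] \<phi>_inv assms by auto
  then show "x \<in> L"
    using rel_coneD(11)[OF PK assms] by blast
next
  assume "x \<in> L"
  then have "x \<notin> PK" "inv x \<notin> PK"
    using rel_coneD(7)[OF PK] subgroup.m_inv_closed[OF L] by blast+
  then show "\<phi> x = 0"
    using \<phi>_pos[of x] \<phi>_pos[of "inv x"] \<phi>_inv assms by fastforce
qed

lemma additive_pow:
  fixes \<psi> :: "'a \<Rightarrow> real"
  assumes "\<And>x y. x \<in> K \<Longrightarrow> y \<in> K \<Longrightarrow> \<psi> (x \<otimes> y) = \<psi> x + \<psi> y" and x: "x \<in> K"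
  shows "\<psi> (x [^] (n::nat)) = of_nat n * \<psi> x"
proof (induction n)
  case 0
  show ?case
    using assms(1)[of \<one> \<one>] subgroup.one_closed[OF K] by simp
next
  case (Suc n)
  then show ?case
    using assms(1)[OF subgroup_pow[OF K x, of n] x] by (simp add: algebra_simps)
qed

text \<open>Every positive z of \<open>K\<close> is commensurable with b modulo \<open>L\<close>,
  and the same exponents m and n compute both \<psi> z and \<phi> z from the values at b.\<close>

lemma additive_unique:
  fixes \<psi> :: "'a \<Rightarrow> real"
  assumes add: "\<And>x y. x \<in> K \<Longrightarrow> y \<in> K \<Longrightarrow> \<psi> (x \<otimes> y) = \<psi> x + \<psi> y"
    and zero: "\<And>x. x \<in> L \<Longrightarrow> \<psi> x = 0" and x: "x \<in> K"
  shows "\<psi> x = \<psi> b * \<phi> x"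
proof -
  have inv: "\<psi> (inv z) = - \<psi> z" if "z \<in> K" for z
    using add[of "inv z" z] that zero[of \<one>] subgroup.one_closed[OF L] K_carrier[of z] by simp
  have pos: "\<psi> z = \<psi> b * \<phi> z" if z: "z \<in> PK" for z
  proof -
    have zK: "z \<in> K"
      using z PK_K by blast
    obtain m n :: nat where mn: "0 < m" "0 < n" "inv (z [^] m) \<otimes> b [^] n \<in> L"
      using K_rank_one z b unfolding rank_one_def by blast
    have eq: "of_nat m * \<theta> z = of_nat n * \<theta> b"
      if "\<And>x y. x \<in> K \<Longrightarrow> y \<in> K \<Longrightarrow> \<theta> (x \<otimes> y) = \<theta> x + \<theta> y" "\<And>x. x \<in> L \<Longrightarrow> \<theta> x = 0"
      for \<theta> :: "'a \<Rightarrow> real"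
    proof -
      let ?w = "inv (z [^] m) \<otimes> b [^] n"
      have "z [^] m \<otimes> ?w = b [^] n"
        using K_carrier zK b_K by simp
      then have "\<theta> (b [^] n) = \<theta> (z [^] m) + \<theta> ?w"
        using that(1)[of "z [^] m" ?w] subgroup_pow[OF K] zK mn(3) LK by auto
      then show ?thesis
        using that(2)[OF mn(3)] additive_pow[OF that(1)] zK b_K by simp
    qed
    have 1: "of_nat m * \<psi> z = of_nat n * \<psi> b"
      by (rule eq[OF add zero])
    have 2: "of_nat m * \<phi> z = of_nat n"
      using eq[OF \<phi>_mult] \<phi>_zero_iff LK \<phi>_b by auto
    have "of_nat m * \<psi> z = of_nat m * (\<psi> b * \<phi> z)"
      unfolding 1 2[symmetric] by (simp add: ac_simps)
    then show ?thesis
      using mn(1) by simp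
  qed
  consider "x \<in> L" | "x \<in> PK" | "inv x \<in> PK"
    using rel_coneD(11)[OF PK x] by blast
  then show ?thesis
  proof cases
    case 1
    then show ?thesis
      using zero \<phi>_zero_iff[OF x] by simp
  next
    case 3
    then show ?thesis
      using pos[OF 3] inv[OF x] \<phi>_inv[OF x] by simp
  qed (use pos in blast)
qed

text \<open>Conjugation by h followed by \<phi> is additive on \<open>K\<close> and vanishes on
  \<open>L\<close>, so it is a constant multiple of \<phi>. The constant is the value at b, as
  \<open>\<phi> b = 1\<close>.\<close>

definition mult_factor :: "'a \<Rightarrow> real" ("\<lambda>\<^sub>c")
  where "\<lambda>\<^sub>c h = \<phi> (h \<otimes> b \<otimes> inv h)"

lemma \<phi>_conj:
  assumes h: "h \<in> H" and x: "x \<in> K"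
  shows "\<phi> (h \<otimes> x \<otimes> inv h) = \<lambda>\<^sub>c h * \<phi> x"
  unfolding mult_factor_def
proof (rule additive_unique[of "\<lambda>x. \<phi> (h \<otimes> x \<otimes> inv h)", OF _ _ x])
  fix x y
  assume xy: "x \<in> K" "y \<in> K"
  have "h \<otimes> (x \<otimes> y) \<otimes> inv h = (h \<otimes> x \<otimes> inv h) \<otimes> (h \<otimes> y \<otimes> inv h)"
    using H_carrier[OF h] K_carrier xy by (simp add: m_assoc)
  then show "\<phi> (h \<otimes> (x \<otimes> y) \<otimes> inv h) = \<phi> (h \<otimes> x \<otimes> inv h) + \<phi> (h \<otimes> y \<otimes> inv h)"
    using \<phi>_mult K_normal[OF h] xy by simp
next
  fix x
  assume "x \<in> L"
  then have "h \<otimes> x \<otimes> inv h \<in> L"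
    by (rule L_normal[OF h])
  then show "\<phi> (h \<otimes> x \<otimes> inv h) = 0"
    using \<phi>_zero_iff LK by blast
qed

lemma factor_mult:
  assumes "g \<in> H" "h \<in> H"
  shows "\<lambda>\<^sub>c (g \<otimes> h) = \<lambda>\<^sub>c g * \<lambda>\<^sub>c h"
proof -
  have "(g \<otimes> h) \<otimes> b \<otimes> inv (g \<otimes> h) = g \<otimes> (h \<otimes> b \<otimes> inv h) \<otimes> inv g"
    using assms H_carrier K_carrier b_K by (simp add: m_assoc inv_mult_group)
  then show ?thesis
    using \<phi>_conj[OF assms(1) K_normal[OF assms(2) b_K]] unfolding mult_factor_def by simp
qed

lemma factor_K:
  assumes "k \<in> K"
  shows "\<lambda>\<^sub>c k = 1"
  using assms b_K \<phi>_mult \<phi>_inv \<phi>_b unfolding mult_factor_def by simp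

lemma factor_inv_mult:
  assumes "h \<in> H"
  shows "\<lambda>\<^sub>c (inv h) * \<lambda>\<^sub>c h = 1"
  using factor_mult[of "inv h" h] factor_K[of \<one>] subgroup.one_closed[OF K] H_carrier assms by simp

lemma factor_pow:
  assumes "h \<in> H"
  shows "\<lambda>\<^sub>c (h [^] (n::nat)) = \<lambda>\<^sub>c h ^ n"
proof (induction n)
  case 0
  show ?case
    using factor_K[of \<one>] subgroup.one_closed[OF K] by simp
next
  case (Suc n)
  then show ?case
    using factor_mult[OF subgroup_pow[OF H assms, of n] assms] by simp
qed

lemma factor_rat: "h \<in> H \<Longrightarrow> \<lambda>\<^sub>c h \<in> \<rat>"
  unfolding mult_factor_def by (rule \<phi>_rat[OF K_normal[OF _ b_K]])

text \<open>For fixed y this is a crossed homomorphism in h, twisted by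
  \<open>\<lambda>\<^sub>c\<close>. It supplies the translation part of the affine action.\<close>

definition commutator_hom :: "'a \<Rightarrow> 'a \<Rightarrow> real"
  where "commutator_hom y h = \<phi> (h \<otimes> y \<otimes> inv h \<otimes> inv y)"

lemma commutator_K:
  assumes "x \<in> H" "y \<in> H"
  shows "x \<otimes> y \<otimes> inv x \<otimes> inv y \<in> K"
proof -
  have "x \<otimes> y \<otimes> inv x \<otimes> inv y = (y \<otimes> x) \<otimes> (inv (y \<otimes> x) \<otimes> (x \<otimes> y)) \<otimes> inv (y \<otimes> x)"
    using assms H_carrier by (simp add: m_assoc inv_mult_group)
  then show ?thesis
    using K_normal[OF _ H_abelian[OF assms], of "y \<otimes> x"] assms by simp
qed

text \<open>The commutator identity [gh, y] = g [h, y] g^-1 [g, y].\<close>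

lemma commutator_hom_mult:
  assumes "y \<in> H" "g \<in> H" "h \<in> H"
  shows "commutator_hom y (g \<otimes> h) = commutator_hom y g + \<lambda>\<^sub>c g * commutator_hom y h"
proof -
  let ?c = "\<lambda>h. h \<otimes> y \<otimes> inv h \<otimes> inv y"
  have "?c (g \<otimes> h) = (g \<otimes> ?c h \<otimes> inv g) \<otimes> ?c g"
    using assms H_carrier by (simp add: m_assoc inv_mult_group)
  then show ?thesis
    using \<phi>_mult[of "g \<otimes> ?c h \<otimes> inv g" "?c g"] \<phi>_conj[OF assms(2)]
      commutator_K assms K_normal unfolding commutator_hom_def by simp
qed

lemma commutator_hom_K:
  assumes "y \<in> H" "k \<in> K"
  shows "commutator_hom y k = (1 - \<lambda>\<^sub>c y) * \<phi> k"
proof -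
  have "k \<otimes> y \<otimes> inv k \<otimes> inv y = k \<otimes> (y \<otimes> inv k \<otimes> inv y)"
    using assms H_carrier K_carrier by (simp add: m_assoc)
  then show ?thesis
    using \<phi>_mult[of k "y \<otimes> inv k \<otimes> inv y"] \<phi>_conj[OF assms(1), of "inv k"] K_normal[OF assms(1)]
      assms(2) \<phi>_inv unfolding commutator_hom_def by (simp add: algebra_simps)
qed

lemma commutator_hom_self:
  assumes "y \<in> H"
  shows "commutator_hom y y = 0" "commutator_hom y (inv y) = 0"
  using assms H_carrier \<phi>_one unfolding commutator_hom_def by (simp_all add: m_assoc)

text \<open>Rank one compares positive elements, so opposite signs bring in \<open>inv h\<close>.
  After inverting, the factor from \<open>K\<close> stands on the left and is conjugated to the
  right, by normality of \<open>K\<close>.\<close>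

lemma H_relation:
  assumes x: "x \<in> H" "x \<notin> K" and h: "h \<in> H" "h \<notin> K"
  shows "\<exists>(m::nat) (n::nat) q. 0 < m \<and> 0 < n \<and> q \<in> K \<and>
    (x [^] m = h [^] n \<otimes> q \<or> x [^] m = inv h [^] n \<otimes> q)"
proof -
  have aux: "\<exists>(m::nat) (n::nat) q. 0 < m \<and> 0 < n \<and> q \<in> K \<and> y [^] m = z [^] n \<otimes> q"
    if yz: "y \<in> PH" "z \<in> PH" for y z
  proof -
    obtain m n :: nat where mn: "0 < m" "0 < n" "inv (z [^] n) \<otimes> y [^] m \<in> K"
      using H_rank_one yz unfolding rank_one_def by blast
    moreover have "y [^] m = z [^] n \<otimes> (inv (z [^] n) \<otimes> y [^] m)"
      using yz H_carrier PH_H by (simp add: subset_iff)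
    ultimately show ?thesis
      by blast
  qed
  have aux': "\<exists>(m::nat) (n::nat) q. 0 < m \<and> 0 < n \<and> q \<in> K \<and> x [^] m = inv z [^] n \<otimes> q"
    if z: "inv x \<in> PH" "z \<in> PH" for z
  proof -
    have zH: "z \<in> H"
      using z PH_H by blast
    obtain m n :: nat and q where mn: "0 < m" "0 < n" "q \<in> K" "inv x [^] m = z [^] n \<otimes> q"
      using aux[OF z] by blast
    have c: "x \<in> carrier G" "z \<in> carrier G" "q \<in> carrier G"
      using H_carrier K_carrier x zH mn by auto
    have "inv (inv x [^] m) = inv q \<otimes> inv (z [^] n)"
      using mn(4) c by (simp add: inv_mult_group)
    then have "x [^] m = inv q \<otimes> inv (z [^] n)"
      using c by (simp add: nat_pow_inv)
    also have "\<dots> = inv z [^] n \<otimes> (z [^] n \<otimes> inv q \<otimes> inv (z [^] n))"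
      using c by (simp add: nat_pow_inv m_assoc)
    finally have "x [^] m = inv z [^] n \<otimes> (z [^] n \<otimes> inv q \<otimes> inv (z [^] n))" .
    moreover have "z [^] n \<otimes> inv q \<otimes> inv (z [^] n) \<in> K"
      using K_normal[OF subgroup_pow[OF H zH]] mn(3) by simp
    ultimately show ?thesis
      using mn by blast
  qed
  have hh: "inv (inv h) = h"
    using h H_carrier by simp
  show ?thesis
    using aux[of x h] aux[of x "inv h"] aux'[of h] aux'[of "inv h"] rel_coneD(11)[OF PH x]
      rel_coneD(11)[OF PH h] unfolding hh by blast
qed

lemma tower_cone: "rel_cone G L H (PK \<union> PH)"
  by (rule rel_cone_trans[OF PK PH])

end

context rank_one_tower
begin

subsection \<open>Negative multiplication factors\<close>

text \<open>If a positive x outside \<open>K\<close> lay below an element of \<open>K\<close>, so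
  would all its powers. But some power of x equals, up to \<open>K\<close>, a power of h or of
  \<open>inv h\<close>: the former exceeds all of \<open>K\<close>, the latter is negative.\<close>

lemma convex_of_dominating:
  assumes R: "rel_cone G {\<one>} H R" and h: "h \<in> H" "h \<in> R" "h \<notin> K"
    and dom: "\<And>k. k \<in> K \<Longrightarrow> inv k \<otimes> h \<in> R"
  shows "rel_cone G K H (R - K)"
proof (rule rel_cone_convexI[OF R K _ KH])
  show "{\<one>} \<subseteq> K"
    using subgroup.one_closed[OF K] by blast
  note RD = rel_coneD[OF R]
  have dom_pow: "inv k \<otimes> h [^] n \<in> R" if k: "k \<in> K" and n: "0 < n" for k and n :: nat
  proof -
    obtain j where j: "n = Suc j"
      using n gr0_implies_Suc by blast
    show ?thesis
    proof (cases "j = 0")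
      case True
      then show ?thesis
        using dom[OF k] j H_carrier[OF h(1)] by simp
    next
      case False
      have "inv k \<otimes> h \<otimes> h [^] j \<in> R"
        using RD(8)[OF dom[OF k] cone_pow[OF R h(2)]] False by simp
      moreover have "h [^] n = h \<otimes> h [^] j"
        using nat_pow_Suc2[OF H_carrier[OF h(1)]] j by simp
      ultimately show ?thesis
        using H_carrier[OF h(1)] K_carrier[OF k] by (simp add: m_assoc)
    qed
  qed
  show "x \<in> K" if x: "x \<in> R" and y: "y \<in> K" and xy: "inv x \<otimes> y \<in> R" for x y
  proof (rule ccontr)
    assume xK: "x \<notin> K"
    have xH: "x \<in> H"
      using RD(4) x by blast
    have c: "x \<in> carrier G" "y \<in> carrier G" "h \<in> carrier G"
      using H_carrier K_carrier xH y h by auto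
    \<comment> \<open>By left invariance w x < w y = (w y w^-1) w < (w y w^-1) k, and the conjugate
      stays in \<open>K\<close>.\<close>
    have bound: "\<exists>k\<in>K. inv (x [^] Suc j) \<otimes> k \<in> R" for j
    proof (induction j)
      case 0
      then show ?case
        using xy y c by (intro bexI[of _ y]) simp_all
    next
      case (Suc j)
      define w where "w = x [^] Suc j"
      have wH: "w \<in> H"
        unfolding w_def by (rule subgroup_pow[OF H xH])
      obtain k where k: "k \<in> K" "inv w \<otimes> k \<in> R"
        using Suc unfolding w_def by blast
      have "inv (w \<otimes> x) \<otimes> ((w \<otimes> y \<otimes> inv w) \<otimes> k) = (inv x \<otimes> y) \<otimes> (inv w \<otimes> k)"
        using c H_carrier[OF wH] K_carrier[OF k(1)] by (simp add: m_assoc inv_mult_group)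
      then have "inv (w \<otimes> x) \<otimes> ((w \<otimes> y \<otimes> inv w) \<otimes> k) \<in> R"
        using RD(8)[OF xy k(2)] by simp
      moreover have "(w \<otimes> y \<otimes> inv w) \<otimes> k \<in> K"
        using K_normal[OF wH y] k(1) by simp
      moreover have "x [^] Suc (Suc j) = w \<otimes> x"
        unfolding w_def by simp
      ultimately show ?case
        by (intro bexI[of _ "(w \<otimes> y \<otimes> inv w) \<otimes> k"]) simp_all
    qed
    obtain m n :: nat and q where mn: "0 < m" "0 < n" "q \<in> K"
      and eq: "x [^] m = h [^] n \<otimes> q \<or> x [^] m = inv h [^] n \<otimes> q"
      using H_relation[OF xH xK h(1,3)] by blast
    have qc: "q \<in> carrier G"
      using K_carrier mn(3) .
    from eq show False
    proof
      assume eq: "x [^] m = h [^] n \<otimes> q"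
      obtain k where k: "k \<in> K" "inv (x [^] m) \<otimes> k \<in> R"
        using bound[of "m - 1"] mn(1) by auto
      have kc: "k \<in> carrier G"
        using K_carrier k(1) .
      define q' where "q' = h [^] n \<otimes> q \<otimes> inv (h [^] n)"
      have q': "q' \<in> K" "q' \<in> carrier G"
        using K_normal[OF subgroup_pow[OF H h(1)] mn(3)] K_carrier unfolding q'_def by auto
      have "inv (inv (x [^] m) \<otimes> k) = inv (inv q' \<otimes> k) \<otimes> h [^] n"
        unfolding eq q'_def using c qc kc by (simp add: m_assoc inv_mult_group)
      moreover have "inv (inv q' \<otimes> k) \<otimes> h [^] n \<in> R"
        using dom_pow[OF _ mn(2)] q' k by simp
      ultimately show False
        using cone_inv[OF R k(2)] by simp
    next
      assume eq: "x [^] m = inv h [^] n \<otimes> q"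
      have "x [^] m \<in> R"
        by (rule cone_pow[OF R x mn(1)])
      moreover have "inv (x [^] m) = inv q \<otimes> h [^] n"
        unfolding eq using c qc by (simp add: inv_mult_group nat_pow_inv)
      ultimately show False
        using cone_inv[OF R] dom_pow[OF mn(3,2)] by metis
    qed
  qed
qed

text \<open>If conjugation by \<open>h\<close> reverses the order of \<open>K/L\<close> and \<open>1 < h < k\<close>, then
  \<open>(h\<^sup>-\<^sup>1 k\<^sup>n) (h\<^sup>-\<^sup>1 k)\<close> is positive, although it is the product of \<open>h\<^sup>-\<^sup>2\<close> with a negative
  element of \<open>K\<close> for large \<open>n\<close>.\<close>

lemma convex_of_negative_factor_aux:
  assumes R: "rel_cone G {\<one>} H R" and RK: "R \<inter> K - L = PK"
    and h: "h \<in> H" "\<lambda>\<^sub>c h < 0" "h \<in> R"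
  shows "rel_cone G K H (R - K)"
proof (rule convex_of_dominating[OF R h(1,3)])
  note RD = rel_coneD[OF R]
  show hK: "h \<notin> K"
    using factor_K[of h] h(2) by auto
  have hc: "h \<in> carrier G"
    using H_carrier h(1) .
  have PKR: "PK \<subseteq> R"
    using RK by blast
  show "inv k \<otimes> h \<in> R" if k: "k \<in> K" for k
  proof (rule ccontr)
    assume neg: "inv k \<otimes> h \<notin> R"
    have kc: "k \<in> carrier G"
      using K_carrier k .
    have "inv k \<otimes> h \<notin> K"
      using subgroup_mult_left_iff[OF K, of "inv k" h] k hK hc by simp
    then have "inv k \<otimes> h \<noteq> \<one>"
      using subgroup.one_closed[OF K] by auto
    then have "inv (inv k \<otimes> h) \<in> R"
      using RD(11)[of "inv k \<otimes> h"] neg K_H[OF k] h(1) by simp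
    then have hk: "inv h \<otimes> k \<in> R"
      using hc kc by (simp add: inv_mult_group)
    \<comment> \<open>The bound k may lie in \<open>L\<close>; then b is a bound too, since
      \<open>inv k \<otimes> b\<close> is positive.\<close>
    have "\<exists>k1\<in>PK. inv h \<otimes> k1 \<in> R"
    proof (cases "k \<in> L")
      case True
      have ib: "inv k \<otimes> b \<in> R"
        using rel_coneD(9)[OF PK b] subgroup.m_inv_closed[OF L True] PKR by blast
      have "(inv h \<otimes> k) \<otimes> (inv k \<otimes> b) = inv h \<otimes> b"
        using hc kc K_carrier[OF b_K] by (simp add: m_assoc)
      then show ?thesis
        using RD(8)[OF hk ib] b by auto
    next
      case False
      have "h \<otimes> (inv h \<otimes> k) \<in> R"
        by (rule RD(8)[OF h(3) hk])
      then have "k \<in> PK"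
        using hc kc k False RK by auto
      then show ?thesis
        using hk by blast
    qed
    then obtain k1 where k1: "k1 \<in> PK" "inv h \<otimes> k1 \<in> R"
      by blast
    have k1K: "k1 \<in> K" "k1 \<in> carrier G"
      using k1 PK_K K_carrier by auto
    have \<phi>1: "\<phi> k1 > 0"
      using \<phi>_pos k1 k1K by blast
    \<comment> \<open>Makes \<open>\<phi> k1 * (1 + n * \<lambda>\<^sub>c h)\<close> negative; this
      is \<phi> w for the w in \<open>K\<close> with \<open>(inv h \<otimes> k1 [^] n) \<otimes>
      (inv h \<otimes> k1) = inv h \<otimes> inv h \<otimes> w\<close>.\<close>
    obtain n :: nat where n: "1 < of_nat n * (- \<lambda>\<^sub>c h)"
    proof -
      have "0 < - \<lambda>\<^sub>c h"
        using h(2) by simp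
      from reals_Archimedean3[OF this] show ?thesis
        using that by blast
    qed
    have "n \<noteq> 0"
      using n by (cases "n = 0") auto
    then obtain j where j: "n = Suc j"
      using not0_implies_Suc by blast
    have "inv h \<otimes> k1 [^] n \<in> R"
    proof (cases "j = 0")
      case True
      then show ?thesis
        using k1 k1K j by simp
    next
      case False
      have "(inv h \<otimes> k1) \<otimes> k1 [^] j \<in> R"
        using RD(8)[OF k1(2)] cone_pow[OF R, of k1 j] k1(1) PKR False by blast
      then show ?thesis
        using nat_pow_Suc2[OF k1K(2)] j hc k1K by (simp add: m_assoc)
    qed
    then have 1: "(inv h \<otimes> k1 [^] n) \<otimes> (inv h \<otimes> k1) \<in> R"
      by (rule RD(8)[OF _ k1(2)])
    define w where "w = (h \<otimes> k1 [^] n \<otimes> inv h) \<otimes> k1"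
    have wK: "w \<in> K" "w \<in> carrier G"
      using K_normal[OF h(1) subgroup_pow[OF K k1K(1)]] k1K(1) K_carrier unfolding w_def by auto
    have "\<phi> w = \<lambda>\<^sub>c h * (of_nat n * \<phi> k1) + \<phi> k1"
      unfolding w_def using \<phi>_mult K_normal[OF h(1) subgroup_pow[OF K k1K(1)]] k1K(1)
        \<phi>_conj[OF h(1) subgroup_pow[OF K k1K(1)]] additive_pow[OF \<phi>_mult k1K(1)] by simp
    also have "\<dots> = \<phi> k1 * (1 - of_nat n * (- \<lambda>\<^sub>c h))"
      by (simp add: algebra_simps)
    also have "\<dots> < 0"
      using \<phi>1 n by (simp add: mult_pos_neg)
    finally have "inv w \<in> PK"
      using \<phi>_pos[of "inv w"] \<phi>_inv[OF wK(1)] wK(1) by simp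
    then have iw: "inv w \<in> R"
      using PKR by blast
    have "(inv h \<otimes> k1 [^] n) \<otimes> (inv h \<otimes> k1) = inv h \<otimes> inv h \<otimes> w"
      unfolding w_def using hc k1K by (simp add: m_assoc)
    then have "inv h \<otimes> inv h \<otimes> w \<otimes> inv w \<in> R"
      using RD(8)[OF 1 iw] by simp
    then have "inv (h \<otimes> h) \<in> R"
      using hc wK by (simp add: m_assoc inv_mult_group)
    then show False
      using cone_inv[OF R RD(8)[OF h(3) h(3)]] by blast
  qed
qed

lemma factor_inv_neg:
  assumes "h \<in> H" "\<lambda>\<^sub>c h < 0"
  shows "\<lambda>\<^sub>c (inv h) < 0"
proof (rule ccontr)
  assume "\<not> \<lambda>\<^sub>c (inv h) < 0"
  then have "\<lambda>\<^sub>c (inv h) * \<lambda>\<^sub>c h \<le> 0"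
    using assms(2) by (simp add: mult_nonneg_nonpos)
  then show False
    using factor_inv_mult[OF assms(1)] by simp
qed

text \<open>Two normalisations lead to \<open>convex_of_negative_factor_aux\<close>: h is made
  positive by passing to its inverse, and the order induced on K/L is made equal to
  \<open>PK\<close> by reversing \<open>R\<close> if b is negative.\<close>

lemma convex_of_negative_factor:
  assumes R: "rel_cone G {\<one>} H R" and RL: "rel_cone G L K (R \<inter> K - L)"
    and h: "h \<in> H" "\<lambda>\<^sub>c h < 0"
  shows "rel_cone G K H (R - K)"
proof -
  have Hc: "x \<in> carrier G" if "x \<in> H" for x
    using H_carrier that .
  obtain h' where h': "h' \<in> H" "\<lambda>\<^sub>c h' < 0" "h' \<in> R"
  proof (cases "h \<in> R")
    case True
    then show ?thesis
      using that h by blast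
  next
    case False
    have "h \<noteq> \<one>"
      using factor_K[of \<one>] subgroup.one_closed[OF K] h(2) by auto
    then have "inv h \<in> R"
      using rel_coneD(11)[OF R h(1)] False by blast
    moreover have "\<lambda>\<^sub>c (inv h) < 0"
      by (rule factor_inv_neg[OF h(1,2)])
    ultimately show ?thesis
      using that[of "inv h"] h(1) by simp
  qed
  \<comment> \<open>The rank one group K/L has only two orders, and the sign of b tells which one is
    induced.\<close>
  have agree: "R' \<inter> K - L = PK" if R': "rel_cone G L K (R' \<inter> K - L)" and b': "b \<in> R'" for R'
  proof -
    have bR: "b \<in> R' \<inter> K - L"
      using b' b_K rel_coneD(7)[OF PK b] by blast
    have sub: "PK \<subseteq> R' \<inter> K - L"
    proof
      fix x
      assume x: "x \<in> PK"
      have xK: "x \<in> K" "x \<notin> L"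
        using x PK_K rel_coneD(7)[OF PK] by auto
      obtain m n :: nat where mn: "0 < m" "0 < n" "inv (b [^] m) \<otimes> x [^] n \<in> L"
        using K_rank_one x b unfolding rank_one_def by blast
      have "b [^] m \<otimes> (inv (b [^] m) \<otimes> x [^] n) \<in> R' \<inter> K - L"
        by (rule rel_coneD(10)[OF R' cone_pow[OF R' bR mn(1)] mn(3)])
      then have "x [^] n \<in> R' \<inter> K - L"
        using K_carrier b_K xK by simp
      then show "x \<in> R' \<inter> K - L"
        using cone_pow_iff[OF R' xK mn(2)] by blast
    qed
    moreover have "x \<in> PK" if x: "x \<in> R' \<inter> K - L" for x
    proof (rule ccontr)
      assume "x \<notin> PK"
      then have "inv x \<in> PK"
        using rel_coneD(11)[OF PK, of x] x by blast
      then show False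
        using sub cone_inv[OF R' x] by blast
    qed
    ultimately show ?thesis
      by blast
  qed
  show ?thesis
  proof (cases "b \<in> R")
    case True
    then show ?thesis
      using convex_of_negative_factor_aux[OF R agree[OF RL] h'] by blast
  next
    case False
    define R' where "R' = {x \<in> H. inv x \<in> R}"
    have R': "rel_cone G {\<one>} H R'"
      unfolding R'_def by (rule rel_cone_inverse[OF R])
    have iL: "inv x \<in> L \<longleftrightarrow> x \<in> L" if "x \<in> H" for x
      using subgroup_inv_iff[OF L Hc[OF that]] .
    have iK: "inv x \<in> K \<longleftrightarrow> x \<in> K" if "x \<in> H" for x
      using subgroup_inv_iff[OF K Hc[OF that]] .
    have "R' \<inter> K - L = {x \<in> K. inv x \<in> R \<inter> K - L}"
      unfolding R'_def using iL iK K_H by auto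
    then have RL': "rel_cone G L K (R' \<inter> K - L)"
      using rel_cone_inverse[OF RL] by simp
    have "b \<noteq> \<one>"
      using rel_coneD(7)[OF PK b] subgroup.one_closed[OF L] by auto
    then have "b \<in> R'"
      using rel_coneD(11)[OF R, of b] False K_H[OF b_K] unfolding R'_def by auto
    then have eq: "R' \<inter> K - L = PK"
      by (rule agree[OF RL'])
    have inv': "\<lambda>\<^sub>c (inv h') < 0"
      by (rule factor_inv_neg[OF h'(1,2)])
    have "inv h' \<in> R'"
      using h' Hc unfolding R'_def by simp
    then have "rel_cone G K H (R' - K)"
      using convex_of_negative_factor_aux[OF R' eq _ inv'] h'(1) by simp
    from rel_cone_inverse[OF this] have "rel_cone G K H {x \<in> H. inv x \<in> R' - K}" .
    moreover have "{x \<in> H. inv x \<in> R' - K} = R - K"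
      unfolding R'_def using iK Hc rel_coneD(4)[OF R] by auto
    ultimately show ?thesis
      by simp
  qed
qed

subsection \<open>Trivial multiplication factors\<close>

text \<open>With all factors 1, \<open>commutator_hom y\<close> is a homomorphism that vanishes on
  \<open>K\<close> and at y. For x and y outside \<open>K\<close> some power of x is a power of y or
  \<open>inv y\<close> up to \<open>K\<close>, so it vanishes at x as well and H/L is abelian. No
  positive power of h lies in \<open>K\<close>, so b and h are independent modulo
  \<open>L\<close>.\<close>

lemma cantor_many_trivial_factor:
  assumes triv: "\<And>h. h \<in> H \<Longrightarrow> \<lambda>\<^sub>c h = 1" and F: "finite F" "F \<subseteq> PK \<union> PH" and h: "h \<in> PH"
  shows "cantor_many G L H F"
proof -
  have hH: "h \<in> H" "h \<notin> K" "h \<in> carrier G"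
    using h PH_H rel_coneD(7)[OF PH h] H_carrier by auto
  have c_pow: "commutator_hom y (x [^] (n::nat)) = of_nat n * commutator_hom y x"
    if "x \<in> H" "y \<in> H" for x y n
  proof (induction n)
    case 0
    show ?case
      using commutator_hom_K[OF that(2), of \<one>] subgroup.one_closed[OF K] \<phi>_one by simp
  next
    case (Suc n)
    then show ?case
      using commutator_hom_mult[OF that(2) subgroup_pow[OF H that(1)] that(1), of n]
        triv[OF subgroup_pow[OF H that(1)]] by (simp add: algebra_simps)
  qed
  have c_K: "commutator_hom y k = 0" if "y \<in> H" "k \<in> K" for y k
    using commutator_hom_K[OF that] triv[OF that(1)] by simp
  have zero: "commutator_hom y x = 0" if x: "x \<in> H" and y: "y \<in> H" for x y
  proof -
    consider "x \<in> K" | "y \<in> K" | "x \<notin> K" "y \<notin> K"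
      by blast
    then show ?thesis
    proof cases
      case 1
      then show ?thesis
        using c_K[OF y] by blast
    next
      case 2
      then show ?thesis
        using \<phi>_mult[OF K_normal[OF x 2], of "inv y"] \<phi>_conj[OF x 2] triv[OF x] \<phi>_inv[OF 2]
        unfolding commutator_hom_def by simp
    next
      case 3
      obtain m n :: nat and q where mn: "0 < m" "0 < n" "q \<in> K"
        and eq: "x [^] m = y [^] n \<otimes> q \<or> x [^] m = inv y [^] n \<otimes> q"
        using H_relation[OF x 3(1) y 3(2)] by blast
      have pow0: "commutator_hom y (z [^] n \<otimes> q) = 0" if "z = y \<or> z = inv y" for z
      proof -
        have "z \<in> H" "commutator_hom y z = 0"
          using that y commutator_hom_self[OF y] by auto
        then show ?thesis
          using commutator_hom_mult[OF y subgroup_pow[OF H, of z n] K_H[OF mn(3)]] c_K[OF y mn(3)]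
            c_pow[OF _ y, of z n] by simp
      qed
      have "commutator_hom y (x [^] m) = 0"
        using eq pow0 by auto
      then show ?thesis
        using c_pow[OF x y, of m] mn(1) by simp
    qed
  qed
  have abelian: "inv (y \<otimes> x) \<otimes> (x \<otimes> y) \<in> L" if xy: "x \<in> H" "y \<in> H" for x y
  proof -
    have "x \<otimes> y \<otimes> inv x \<otimes> inv y \<in> L"
      using zero[OF xy] \<phi>_zero_iff[OF commutator_K[OF xy]] unfolding commutator_hom_def by blast
    then have "inv (y \<otimes> x) \<otimes> (x \<otimes> y \<otimes> inv x \<otimes> inv y) \<otimes> inv (inv (y \<otimes> x)) \<in> L"
      using L_normal[of "inv (y \<otimes> x)"] xy by simp
    then show ?thesis
      using xy H_carrier by (simp add: m_assoc inv_mult_group)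
  qed
  show ?thesis
  proof (rule cantor_many_abelian_quotient[OF tower_cone L_normal abelian F])
    show "b \<in> PK \<union> PH" "h \<in> PK \<union> PH"
      using b h by auto
    show "inv (b [^] m) \<otimes> h [^] n \<notin> L" if "0 < m" "0 < n" for m n :: nat
    proof
      assume "inv (b [^] m) \<otimes> h [^] n \<in> L"
      then have "inv (b [^] m) \<otimes> h [^] n \<in> K"
        using LK by blast
      then have "h [^] n \<in> K"
        using subgroup_mult_left_iff[OF K, of "inv (b [^] m)" "h [^] n"] subgroup_pow[OF K b_K] hH
        by simp
      then show False
        using cone_isolated[OF PH hH(1) _ that(2)] hH(2) by blast
    qed
  qed
qed

subsection \<open>Affine orders\<close>

lemma \<phi>_multiple:
  assumes e: "e \<in> K"
  shows "\<exists>k\<in>K. \<phi> k = of_int n * \<phi> e"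
proof (cases n rule: int_cases2)
  case (nonneg m)
  then show ?thesis
    using additive_pow[OF \<phi>_mult e, of m] by (intro bexI[of _ "e [^] m"] subgroup_pow[OF K e]) simp
next
  case (nonpos m)
  then have "\<phi> (inv (e [^] m)) = of_int n * \<phi> e"
    using additive_pow[OF \<phi>_mult e, of m] \<phi>_inv[OF subgroup_pow[OF K e]] by simp
  then show ?thesis
    by (intro bexI[of _ "inv (e [^] m)"] K_closed(2) subgroup_pow[OF K e])
qed

text \<open>The conjugates of b by powers of \<open>h0\<close> have the arbitrarily small positive
  values \<open>\<lambda>\<^sub>c h0 ^ j\<close>, and the image of \<phi> contains all integer
  multiples of them.\<close>

lemma \<phi>_dense:
  assumes h0: "h0 \<in> H" "0 < \<lambda>\<^sub>c h0" "\<lambda>\<^sub>c h0 < 1" and uv: "u < v"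
  shows "\<exists>k\<in>K. u < \<phi> k \<and> \<phi> k < v"
proof -
  obtain j :: nat where j: "\<lambda>\<^sub>c h0 ^ j < v - u"
    using real_arch_pow_inv[of "v - u" "\<lambda>\<^sub>c h0"] uv h0 by auto
  define e where "e = h0 [^] j \<otimes> b \<otimes> inv (h0 [^] j)"
  have eK: "e \<in> K"
    unfolding e_def by (rule K_normal[OF subgroup_pow[OF H h0(1)] b_K])
  have \<phi>e: "\<phi> e = \<lambda>\<^sub>c h0 ^ j"
    unfolding e_def using \<phi>_conj[OF subgroup_pow[OF H h0(1)] b_K] factor_pow[OF h0(1)] \<phi>_b by simp
  define \<epsilon> where "\<epsilon> = \<lambda>\<^sub>c h0 ^ j"
  have \<epsilon>: "\<epsilon> > 0" "\<epsilon> < v - u"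
    unfolding \<epsilon>_def using j h0 by auto
  \<comment> \<open>The least integer n with n \<epsilon> > u; as \<epsilon> < v - u, the multiple n
    \<epsilon> is still below v.\<close>
  define n where "n = \<lfloor>u / \<epsilon>\<rfloor> + 1"
  have "u / \<epsilon> < of_int n" "of_int n \<le> u / \<epsilon> + 1"
    unfolding n_def by linarith+
  then have "u < of_int n * \<epsilon>" "of_int n * \<epsilon> \<le> u + \<epsilon>"
    using \<epsilon>(1) by (simp_all add: field_simps)
  then have "u < of_int n * \<phi> e" "of_int n * \<phi> e < v"
    unfolding \<phi>e using \<epsilon> unfolding \<epsilon>_def by linarith+
  moreover obtain k where "k \<in> K" "\<phi> k = of_int n * \<phi> e"
    using \<phi>_multiple[OF eK, of n] by blast
  ultimately show ?thesis
    by (intro bexI[of _ k]) simp_all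
qed

text \<open>Fixing the point \<open>0\<close> by \<open>h0\<close>, the group \<open>H/L\<close> acts on the line by the affine maps
  \<open>x \<mapsto> \<lambda>(h) x + \<tau>(h)\<close>; an irrational point \<open>t\<close> has trivial stabiliser, so the sign of
  \<open>h(t) - t\<close> is an order, and this order tends to the given one as \<open>t\<close> tends to infinity.\<close>

lemma cantor_many_affine:
  assumes pos: "\<And>h. h \<in> H \<Longrightarrow> 0 < \<lambda>\<^sub>c h" and h0: "h0 \<in> H" "\<lambda>\<^sub>c h0 < 1"
    and F: "finite F" "F \<subseteq> PK \<union> PH"
  shows "cantor_many G L H F"
proof -
  define l0 where "l0 = \<lambda>\<^sub>c h0"
  have l0: "0 < l0" "l0 < 1"
    unfolding l0_def using pos h0 by auto
  have h0K: "h0 \<notin> K"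
    using factor_K[of h0] l0 unfolding l0_def by auto
  \<comment> \<open>The point followed is s t. A contraction moves points far on the left to the
    right, so the point must tend to minus infinity if the contracting \<open>h0\<close> is
    positive, and to plus infinity otherwise.\<close>
  define s :: real where "s = (if h0 \<in> PH then -1 else 1)"
  \<comment> \<open>Division by 1 - l0 makes \<tau> equal to \<phi> on \<open>K\<close>, by
    \<open>commutator_hom_K\<close>. Also \<tau> vanishes at \<open>h0\<close>, which therefore
    fixes 0.\<close>
  define \<tau> where "\<tau> h = commutator_hom h0 h / (1 - l0)" for h
  define \<sigma> where "\<sigma> t h = (\<lambda>\<^sub>c h - 1) * s * t + \<tau> h" for t h
  define Q where "Q t = {h \<in> H. \<sigma> t h > 0}" for t
  have ss: "s * s = 1" "s \<in> \<rat>" "s \<noteq> 0"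
    unfolding s_def by auto
  have \<tau>_mult: "\<tau> (g \<otimes> h) = \<tau> g + \<lambda>\<^sub>c g * \<tau> h" if "g \<in> H" "h \<in> H" for g h
    unfolding \<tau>_def using commutator_hom_mult[OF h0(1) that] by (simp add: add_divide_distrib)
  have \<tau>_K: "\<tau> k = \<phi> k" if "k \<in> K" for k
    unfolding \<tau>_def using commutator_hom_K[OF h0(1) that] l0 unfolding l0_def by simp
  have \<sigma>_mult: "\<sigma> t (g \<otimes> h) = \<sigma> t g + \<lambda>\<^sub>c g * \<sigma> t h" if "g \<in> H" "h \<in> H" for t g h
    unfolding \<sigma>_def using \<tau>_mult[OF that] factor_mult[OF that] by (simp add: algebra_simps)
  have \<sigma>_K: "\<sigma> t k = \<phi> k" if "k \<in> K" for t k
    unfolding \<sigma>_def using \<tau>_K[OF that] factor_K[OF that] by simp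
  have \<sigma>_inv: "\<lambda>\<^sub>c h * \<sigma> t (inv h) = - \<sigma> t h" if "h \<in> H" for t h
    using \<sigma>_mult[of h "inv h" t] \<sigma>_K[of \<one> t] \<phi>_one that H_carrier[OF that] subgroup.one_closed[OF K]
    by simp
  \<comment> \<open>H/K has rank one, so all of \<open>PH\<close> contracts or all of it expands,
    according to the sign of \<open>h0\<close>.\<close>
  have sign: "(\<lambda>\<^sub>c x - 1) * s > 0" if x: "x \<in> PH" for x
  proof -
    have xH: "x \<in> H"
      using x PH_H by blast
    define g where "g = (if h0 \<in> PH then h0 else inv h0)"
    have g: "g \<in> PH" "g \<in> H"
      using rel_coneD(11)[OF PH h0(1) h0K] h0(1) unfolding g_def by auto
    obtain m n :: nat where mn: "0 < m" "0 < n" "inv (g [^] m) \<otimes> x [^] n \<in> K"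
      using H_rank_one g x unfolding rank_one_def by blast
    have "g [^] m \<otimes> (inv (g [^] m) \<otimes> x [^] n) = x [^] n"
      using H_carrier g(2) xH by simp
    then have "\<lambda>\<^sub>c (x [^] n) = \<lambda>\<^sub>c (g [^] m) * \<lambda>\<^sub>c (inv (g [^] m) \<otimes> x [^] n)"
      using factor_mult[OF subgroup_pow[OF H g(2), of m] K_H[OF mn(3)]] by simp
    then have eq: "\<lambda>\<^sub>c x ^ n = \<lambda>\<^sub>c g ^ m"
      using factor_pow xH g(2) factor_K[OF mn(3)] by simp
    show ?thesis
    proof (cases "h0 \<in> PH")
      case True
      then have "\<lambda>\<^sub>c x ^ n < 1"
        unfolding eq g_def using l0 mn(1) by (simp add: l0_def power_less_one_iff)
      then have "\<lambda>\<^sub>c x < 1"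
        using one_le_power[of "\<lambda>\<^sub>c x" n] by linarith
      then show ?thesis
        using True unfolding s_def by simp
    next
      case False
      have "\<lambda>\<^sub>c (inv h0) * l0 = 1"
        using factor_inv_mult[OF h0(1)] unfolding l0_def .
      then have "\<lambda>\<^sub>c (inv h0) > 1"
        using l0 mult_right_mono[of "\<lambda>\<^sub>c (inv h0)" 1 l0] by (cases "\<lambda>\<^sub>c (inv h0) \<le> 1") auto
      then have "\<lambda>\<^sub>c x ^ n > 1"
        unfolding eq g_def using False mn(1) by (simp add: one_less_power)
      then have "\<lambda>\<^sub>c x > 1"
        using power_le_one[of "\<lambda>\<^sub>c x" n] pos[OF xH] by linarith
      then show ?thesis
        using False unfolding s_def by simp
    qed
  qed
  have one_K: "x \<in> K" if x: "x \<in> H" "\<lambda>\<^sub>c x = 1" for x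
  proof (rule ccontr)
    assume "x \<notin> K"
    moreover have "\<lambda>\<^sub>c (inv x) = 1"
      using factor_inv_mult[OF x(1)] x(2) by simp
    ultimately show False
      using sign[of x] sign[of "inv x"] rel_coneD(11)[OF PH x(1)] x(2) by auto
  qed
  have \<tau>_rat: "\<tau> h \<in> \<rat>" if "h \<in> H" for h
    unfolding \<tau>_def l0_def commutator_hom_def
    using \<phi>_rat[OF commutator_K[OF that h0(1)]] factor_rat[OF h0(1)] by simp
  \<comment> \<open>A factor other than 1 would make t the solution of a linear equation with
    rational coefficients.\<close>
  have zero: "\<sigma> t h = 0 \<longleftrightarrow> h \<in> L" if t: "t \<notin> \<rat>" and h: "h \<in> H" for t h
  proof
    assume "h \<in> L"
    then show "\<sigma> t h = 0"
      using \<sigma>_K[of h t] \<phi>_zero_iff[of h] LK by auto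
  next
    assume \<sigma>0: "\<sigma> t h = 0"
    have "\<lambda>\<^sub>c h = 1"
    proof (rule ccontr)
      assume ne: "\<lambda>\<^sub>c h \<noteq> 1"
      then have "t = - \<tau> h / ((\<lambda>\<^sub>c h - 1) * s)"
        using \<sigma>0 ss(3) unfolding \<sigma>_def by (simp add: field_simps)
      moreover have "- \<tau> h / ((\<lambda>\<^sub>c h - 1) * s) \<in> \<rat>"
        using \<tau>_rat[OF h] factor_rat[OF h] ss(2) by simp
      ultimately show False
        using t by simp
    qed
    then have "h \<in> K"
      by (rule one_K[OF h])
    then show "h \<in> L"
      using \<sigma>0 \<sigma>_K \<phi>_zero_iff by simp
  qed
  have cone: "rel_cone G L H (Q t)" if t: "t \<notin> \<rat>" for t
  proof (rule rel_coneI[OF L H])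
    show "L \<subseteq> H"
      using LK KH by blast
    show "Q t \<subseteq> H"
      unfolding Q_def by blast
    show "Q t \<inter> L = {}"
      using zero[OF t] unfolding Q_def by fastforce
    show "x \<otimes> y \<in> Q t" if "x \<in> Q t" "y \<in> Q t" for x y
      using that \<sigma>_mult[of x y t] pos[of x] unfolding Q_def by (simp add: add_pos_pos)
    show "d \<otimes> x \<in> Q t" if "x \<in> Q t" "d \<in> L" for x d
    proof -
      have "d \<in> K" "\<sigma> t d = 0" "\<lambda>\<^sub>c d = 1"
        using that(2) LK zero[OF t] K_H factor_K by auto
      then show ?thesis
        using that(1) \<sigma>_mult[of d x t] K_H[of d] unfolding Q_def by simp
    qed
    show "x \<otimes> d \<in> Q t" if "x \<in> Q t" "d \<in> L" for x d
    proof -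
      have "d \<in> K" "\<sigma> t d = 0"
        using that(2) LK zero[OF t] K_H by auto
      then show ?thesis
        using that(1) \<sigma>_mult[of x d t] K_H[of d] unfolding Q_def by simp
    qed
    show "inv x \<in> Q t" if x: "x \<in> H" "x \<notin> L" "x \<notin> Q t" for x
    proof -
      have "\<sigma> t x < 0"
        using x zero[OF t x(1)] unfolding Q_def by auto
      then have "\<lambda>\<^sub>c x * \<sigma> t (inv x) > 0"
        using \<sigma>_inv[OF x(1)] by simp
      then show ?thesis
        using pos[OF x(1)] x(1) unfolding Q_def by (simp add: zero_less_mult_iff)
    qed
  qed
  \<comment> \<open>On \<open>PK\<close> the value is independent of t; on \<open>PH\<close> it is
    affine in t with positive slope.\<close>
  have "\<exists>M. \<forall>t\<ge>M. \<forall>f\<in>F. \<sigma> t f > 0"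
  proof -
    have "eventually (\<lambda>t. \<sigma> t f > 0) at_top" if f: "f \<in> F" for f
    proof (cases "f \<in> PK")
      case True
      then have "\<sigma> t f > 0" for t
        using \<sigma>_K[of f t] \<phi>_pos[of f] PK_K by auto
      then show ?thesis
        by simp
    next
      case False
      then have "f \<in> PH"
        using f F(2) by blast
      define a where "a = (\<lambda>\<^sub>c f - 1) * s"
      have a: "a > 0"
        unfolding a_def by (rule sign[OF \<open>f \<in> PH\<close>])
      have "eventually (\<lambda>t. t > - \<tau> f / a) at_top"
        by (rule eventually_gt_at_top)
      then show ?thesis
      proof eventually_elim
        case (elim t)
        then have "a * t + \<tau> f > 0"
          using a by (simp add: field_simps)
        then show ?case
          unfolding \<sigma>_def a_def .
      qed
    qed
    then have "eventually (\<lambda>t. \<forall>f\<in>F. \<sigma> t f > 0) at_top"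
      using F(1) by (simp add: eventually_ball_finite)
    then show ?thesis
      unfolding eventually_at_top_linorder .
  qed
  then obtain M where M: "\<And>t f. t \<ge> M \<Longrightarrow> f \<in> F \<Longrightarrow> \<sigma> t f > 0"
    by blast
  have irrational: "\<exists>t. t \<notin> \<rat> \<and> u < t \<and> t < v" if "u < v" for u v :: real
  proof (rule ccontr)
    assume "\<not> ?thesis"
    then have "{u<..<v} \<subseteq> \<rat>"
      by auto
    then show False
      using countable_subset[OF _ countable_rat] uncountable_open_interval[of u v] that by blast
  qed
  obtain t0 where t0: "t0 \<notin> \<rat>" "M < t0"
    using irrational[of M "M + 1"] by auto
  have FH: "F \<subseteq> H"
    using F(2) rel_coneD(4)[OF tower_cone] by blast
  show ?thesis
  proof (rule cantor_manyI[where \<X> = "Q ` {t. t \<notin> \<rat> \<and> M < t}"])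
    show "rel_cone G L H (Q t0)"
      by (rule cone[OF t0(1)])
    show "Q t0 \<in> Q ` {t. t \<notin> \<rat> \<and> M < t}"
      using t0 by blast
    show "rel_cone G L H P" if "P \<in> Q ` {t. t \<notin> \<rat> \<and> M < t}" for P
      using that cone by blast
    show "finite F"
      by (rule F(1))
    show "F \<subseteq> Q t0"
      using FH M[of t0] t0(2) unfolding Q_def by auto
    \<comment> \<open>Membership of x in \<open>Q t\<close> depends on x through a pair of
      rationals, so one test element per pair suffices, with the neutral element standing for all x
      outside \<open>H\<close>.\<close>
    define r where "r x = (if x \<in> H then (\<lambda>\<^sub>c x, \<tau> x) else (1, 0))" for x
    have r_eq: "x \<in> Q t \<longleftrightarrow> y \<in> Q t" if "r x = r y" "x \<in> H" "y \<in> H" for x y t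
      using that unfolding r_def Q_def \<sigma>_def by simp
    have "r ` H \<subseteq> \<rat> \<times> \<rat>"
      unfolding r_def using factor_rat \<tau>_rat by auto
    then have "countable (r ` H)"
      by (rule countable_subset) (intro countable_SIGMA countable_rat)
    then show "countable (insert \<one> (inv_into H r ` r ` H))"
      by simp
    show "\<exists>y\<in>insert \<one> (inv_into H r ` r ` H). \<forall>P\<in>Q ` {t. t \<notin> \<rat> \<and> M < t}. x \<in> P \<longleftrightarrow> y \<in> P" for x
    proof (cases "x \<in> H")
      case True
      define y where "y = inv_into H r (r x)"
      have y: "r x = r y" "y \<in> H"
        unfolding y_def using True by (simp_all add: f_inv_into_f inv_into_into)
      have "y \<in> insert \<one> (inv_into H r ` r ` H)"
        unfolding y_def using True by blast
      moreover have "x \<in> Q t \<longleftrightarrow> y \<in> Q t" for t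
        by (rule r_eq[OF y(1) True y(2)])
      ultimately show ?thesis
        by (intro bexI[of _ y]) auto
    next
      case False
      have "\<one> \<notin> Q t" "x \<notin> Q t" for t
        using False \<sigma>_K[of \<one> t] \<phi>_one subgroup.one_closed[OF K] unfolding Q_def by auto
      then show ?thesis
        by (intro bexI[of _ \<one>]) auto
    qed
    fix P S
    assume P: "P \<in> Q ` {t. t \<notin> \<rat> \<and> M < t}" and S: "finite (S :: 'a set)"
    then obtain t where t: "t \<notin> \<rat>" "M < t" "P = Q t"
      by blast
    have "eventually (\<lambda>t'. x \<in> Q t' \<longleftrightarrow> x \<in> Q t) (nhds t)" for x
    proof (cases "x \<in> H - L")
      case True
      have tend: "((\<lambda>t'. \<sigma> t' x) \<longlongrightarrow> \<sigma> t x) (nhds t)"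
        unfolding \<sigma>_def by (intro tendsto_intros filterlim_ident)
      have "\<sigma> t x \<noteq> 0"
        using zero[OF t(1)] True by simp
      then consider "\<sigma> t x > 0" | "\<sigma> t x < 0"
        by linarith
      then show ?thesis
      proof cases
        case 1
        have "eventually (\<lambda>t'. \<sigma> t' x > 0) (nhds t)"
          using order_tendstoD(1)[OF tend 1] .
        then show ?thesis
          by eventually_elim (use 1 True in \<open>auto simp: Q_def\<close>)
      next
        case 2
        have "eventually (\<lambda>t'. \<sigma> t' x < 0) (nhds t)"
          using order_tendstoD(2)[OF tend 2] .
        then show ?thesis
          by eventually_elim (use 2 True in \<open>auto simp: Q_def\<close>)
      qed
    next
      case False
      have "x \<notin> Q t'" for t'
        using False \<sigma>_K[of x t'] \<phi>_zero_iff[of x] LK unfolding Q_def by auto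
      then show ?thesis
        by simp
    qed
    then have "eventually (\<lambda>t'. \<forall>x\<in>S. x \<in> Q t' \<longleftrightarrow> x \<in> Q t) (nhds t)"
      using S by (simp add: eventually_ball_finite)
    then obtain \<delta> where \<delta>: "\<delta> > 0" "\<And>t' x. dist t' t < \<delta> \<Longrightarrow> x \<in> S \<Longrightarrow> x \<in> Q t' \<longleftrightarrow> x \<in> Q t"
      unfolding eventually_nhds_metric by blast
    obtain t' where t': "t' \<notin> \<rat>" "t < t'" "t' < t + \<delta>"
      using irrational[of t "t + \<delta>"] \<delta>(1) by auto
    have "min (s * t) (s * t') < max (s * t) (s * t')"
      using t'(2) unfolding s_def by (auto simp: min_def max_def)
    then obtain k where k: "k \<in> K" "min (s * t) (s * t') < \<phi> k" "\<phi> k < max (s * t) (s * t')"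
      using \<phi>_dense[OF h0(1)] l0 unfolding l0_def by blast
    \<comment> \<open>The conjugate of \<open>h0\<close> that fixes \<phi> k, a point strictly
      between s t and s t'. A contraction moves the points left of its fixed point to the right and
      the others to the left, so g is positive in exactly one of \<open>Q t\<close> and
      \<open>Q t'\<close>.\<close>
    define g where "g = k \<otimes> (h0 \<otimes> inv k)"
    have kH: "k \<in> H" "inv k \<in> H" "g \<in> H"
      using K_H[OF k(1)] h0(1) unfolding g_def by auto
    have \<sigma>h0: "\<sigma> u h0 = (l0 - 1) * s * u" for u
      unfolding \<sigma>_def \<tau>_def using commutator_hom_self(1)[OF h0(1)] by (simp add: l0_def)
    have "\<sigma> u g = (l0 - 1) * (s * u - \<phi> k)" for u
      unfolding g_def using \<sigma>_mult[OF kH(1), of "h0 \<otimes> inv k" u] \<sigma>_mult[OF h0(1) kH(2), of u] h0(1) kH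
        \<sigma>_K[OF k(1)] \<sigma>_K[of "inv k" u] \<phi>_inv[OF k(1)] factor_K[OF k(1)] \<sigma>h0 k(1)
      by (simp add: l0_def algebra_simps)
    then have g: "g \<in> Q u \<longleftrightarrow> s * u < \<phi> k" for u
      unfolding Q_def using kH(3) l0 by (simp add: zero_less_mult_iff)
    have "Q t' \<noteq> Q t"
      using g[of t] g[of t'] k(2,3) by (auto simp: min_def max_def split: if_splits)
    moreover have "Q t' \<inter> S = Q t \<inter> S"
      using \<delta>(2)[of t'] t' by (auto simp: dist_real_def)
    ultimately show "\<exists>P'\<in>Q ` {t. t \<notin> \<rat> \<and> M < t}. P' \<noteq> P \<and> P' \<inter> S = P \<inter> S"
      using t t' by (intro bexI[of _ "Q t'"]) auto
  qed
qed

end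

subsection \<open>Conradian orders with finitely many convex subgroups\<close>

context group
begin

lemma rel_cone_conj:
  assumes P: "rel_cone G D C P" and g: "g \<in> carrier G"
  defines "cj \<equiv> \<lambda>x. g \<otimes> x \<otimes> inv g"
  shows "rel_cone G (cj ` D) (cj ` C) (cj ` P)"
proof -
  note PD = rel_coneD[OF P]
  have c: "x \<in> carrier G" if "x \<in> C" for x
    using PD(6) that by blast
  have DC: "x \<in> C" if "x \<in> D" for x
    using PD(3) that by blast
  have PC: "x \<in> C" if "x \<in> P" for x
    using PD(4) that by blast
  have mult: "cj x \<otimes> cj y = cj (x \<otimes> y)" if "x \<in> C" "y \<in> C" for x y
    unfolding cj_def using c that g by (simp add: m_assoc)
  have inv: "inv (cj x) = cj (inv x)" if "x \<in> C" for x
    unfolding cj_def using c that g by (simp add: m_assoc inv_mult_group)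
  have cl: "cj x \<in> carrier G" if "x \<in> C" for x
    unfolding cj_def using c that g by simp
  have inj: "x = y" if "cj x = cj y" "x \<in> C" "y \<in> C" for x y
  proof -
    have "inv g \<otimes> cj x \<otimes> g = inv g \<otimes> cj y \<otimes> g"
      using that(1) by simp
    then show ?thesis
      unfolding cj_def using c that(2,3) g by (simp add: m_assoc)
  qed
  have sub: "subgroup (cj ` E) G" if E: "subgroup E G" "E \<subseteq> C" for E
  proof (rule subgroupI)
    show "cj ` E \<subseteq> carrier G"
      using cl E(2) by blast
    show "cj ` E \<noteq> {}"
      using subgroup.one_closed[OF E(1)] by blast
    show "inv a \<in> cj ` E" if a: "a \<in> cj ` E" for a
    proof -
      obtain x where x: "x \<in> E" "a = cj x"
        using a by blast
      then show ?thesis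
        using inv[of x] E(2) subgroup.m_inv_closed[OF E(1) x(1)] by (simp add: subset_iff)
    qed
    show "a \<otimes> a' \<in> cj ` E" if aa: "a \<in> cj ` E" "a' \<in> cj ` E" for a a'
    proof -
      obtain x y where xy: "x \<in> E" "a = cj x" "y \<in> E" "a' = cj y"
        using aa by blast
      then show ?thesis
        using mult[of x y] E(2) subgroup.m_closed[OF E(1) xy(1,3)] by (simp add: subset_iff)
    qed
  qed
  show ?thesis
  proof (rule rel_coneI[OF sub[OF PD(1,3)] sub[OF PD(2) order_refl]])
    show "cj ` D \<subseteq> cj ` C" "cj ` P \<subseteq> cj ` C"
      using PD(3,4) by blast+
    show "cj ` P \<inter> cj ` D = {}"
    proof -
      have False if pd: "p \<in> P" "d \<in> D" "cj p = cj d" for p d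
        using inj[OF pd(3) PC[OF pd(1)] DC[OF pd(2)]] PD(7)[OF pd(1)] pd(2) by simp
      then show ?thesis
        by blast
    qed
    show "a \<otimes> a' \<in> cj ` P" if aa: "a \<in> cj ` P" "a' \<in> cj ` P" for a a'
    proof -
      obtain x y where xy: "x \<in> P" "a = cj x" "y \<in> P" "a' = cj y"
        using aa by blast
      then show ?thesis
        using mult[OF PC PC, of x y] PD(8)[OF xy(1,3)] by simp
    qed
    show "d \<otimes> a \<in> cj ` P" "a \<otimes> d \<in> cj ` P" if ad: "a \<in> cj ` P" "d \<in> cj ` D" for a d
    proof -
      obtain x y where xy: "x \<in> P" "a = cj x" "y \<in> D" "d = cj y"
        using ad by blast
      then show "d \<otimes> a \<in> cj ` P" "a \<otimes> d \<in> cj ` P"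
        using mult[OF PC DC, of x y] mult[OF DC PC, of y x] PD(9,10)[OF xy(1,3)] by simp_all
    qed
    show "inv a \<in> cj ` P" if a: "a \<in> cj ` C" "a \<notin> cj ` D" "a \<notin> cj ` P" for a
    proof -
      obtain x where x: "x \<in> C" "a = cj x"
        using a(1) by blast
      then have "inv x \<in> P"
        using PD(11)[OF x(1)] a(2,3) by blast
      then show ?thesis
        using inv[OF x(1)] x(2) by simp
    qed
  qed
qed

text \<open>The elements of \<open>F\<close> inside \<open>D\<close> or outside \<open>C\<close>
  keep the sign they have in \<open>P\<close>.\<close>

lemma cantor_many_between_convex:
  assumes P: "cone G P" and D: "convex_subgroup G P D" and C: "convex_subgroup G P C"
    and F: "F \<subseteq> P" and many: "cantor_many G D C (F \<inter> (C - D))"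
  shows "cantor_many G {\<one>} (carrier G) F"
proof (rule cantor_many_extend[OF _ C many])
  show "rel_cone G {\<one>} D (P \<inter> D)"
    using rel_coneD(1,3)[OF D] subgroup.one_closed[OF rel_coneD(1)[OF D]]
    by (intro rel_cone_restrict[OF P]) auto
qed (use F in blast)

end

context left_ordered_group
begin

lemma convex_span_carrier: "a \<in> P \<Longrightarrow> convex_subgroup G P (convex_span G P a)"
  using convex_span(1)[OF cone] P_carrier by blast

lemma convex_below_P: "a \<in> P \<Longrightarrow> convex_subgroup G P (convex_below G P a)"
  using convex_below(1)[OF cone] one_notin by metis

lemma below_span: "a \<in> P \<Longrightarrow> convex_below G P a \<subseteq> convex_span G P a"
  using convex_below_subset_span[OF cone] P_carrier one_notin by metis

lemma a_jump:
  assumes "a \<in> P"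
  shows "a \<in> P \<inter> convex_span G P a - convex_below G P a"
  using assms convex_span(2)[OF cone P_carrier[OF assms]] convex_below(2)[OF cone, of a] one_notin
  by auto

lemma rel_cone_between:
  assumes D: "convex_subgroup G P D" and C: "convex_subgroup G P C" and "D \<subseteq> C"
  shows "rel_cone G D C (P \<inter> C - D)"
proof -
  have "(P - D) \<inter> C = P \<inter> C - D"
    by blast
  then show ?thesis
    using rel_cone_restrict[OF D rel_coneD(1)[OF C] assms(3) rel_coneD(3)[OF C]] by simp
qed

text \<open>Among the finitely many spans of positive elements of \<open>E\<close> a maximal one
  contains all the others, as convex subgroups form a chain.\<close>

lemma convex_is_span:
  assumes fin: "finite (convex_span G P ` P)" and E: "convex_subgroup G P E" "E \<noteq> {\<one>}"
  shows "\<exists>a\<in>P. E = convex_span G P a"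
proof -
  note ED = rel_coneD[OF E(1)]
  have Ec: "E \<subseteq> carrier G"
    by (rule ED(3))
  have pos: "x = \<one> \<or> x \<in> P \<or> inv x \<in> P" if "x \<in> E" for x
    using inv_P_iff[of x] that Ec by blast
  have "E \<inter> P \<noteq> {}"
  proof -
    have "\<exists>x\<in>E. x \<noteq> \<one>"
      using E(2) subgroup.one_closed[OF ED(1)] by blast
    then show ?thesis
      using pos subgroup.m_inv_closed[OF ED(1)] by blast
  qed
  then have ne: "convex_span G P ` (E \<inter> P) \<noteq> {}"
    by blast
  have "finite (convex_span G P ` (E \<inter> P))"
    by (rule finite_subset[OF _ fin]) blast
  then have "\<exists>m\<in>convex_span G P ` (E \<inter> P). \<forall>X\<in>convex_span G P ` (E \<inter> P). m \<subseteq> X \<longrightarrow> m = X"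
    using finite_has_maximal[OF _ ne] by blast
  then obtain a where a: "a \<in> E" "a \<in> P"
    and max: "\<And>x. x \<in> E \<Longrightarrow> x \<in> P \<Longrightarrow> convex_span G P a \<subseteq> convex_span G P x \<Longrightarrow>
      convex_span G P a = convex_span G P x"
    by blast
  have in_span: "x \<in> convex_span G P a" if x: "x \<in> E" "x \<in> P" for x
    using convex_chain[OF cone convex_span_carrier[OF a(2)] convex_span_carrier[OF x(2)]] max[OF x]
      convex_span(2)[OF cone P_carrier[OF x(2)]] by blast
  have S: "subgroup (convex_span G P a) G"
    by (rule rel_coneD(1)[OF convex_span_carrier[OF a(2)]])
  have "E \<subseteq> convex_span G P a"
  proof
    fix x
    assume x: "x \<in> E"
    consider "x = \<one>" | "x \<in> P" | "inv x \<in> P"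
      using pos[OF x] by blast
    then show "x \<in> convex_span G P a"
    proof cases
      case 1
      then show ?thesis
        using subgroup.one_closed[OF S] by simp
    next
      case 2
      then show ?thesis
        using in_span x by blast
    next
      case 3
      then have "inv x \<in> convex_span G P a"
        using in_span subgroup.m_inv_closed[OF ED(1) x] by blast
      then show ?thesis
        using subgroup_inv_iff[OF S, of x] x Ec by blast
    qed
  qed
  moreover have "convex_span G P a \<subseteq> E"
    by (rule convex_span(3)[OF cone P_carrier[OF a(2)] E(1) a(1)])
  ultimately show ?thesis
    using a(2) by blast
qed

end

section \<open>Jumps of a Conradian order and convexity in all orders\<close>

context conradian_group
begin

text \<open>The quotient of a jump is archimedean by \<open>span_archimedean\<close>, so Hoelder's
  theorem applies to it.\<close>

lemma jump_abelian:
  assumes a: "a \<in> P" and xy: "x \<in> convex_span G P a" "y \<in> convex_span G P a"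
  shows "inv (y \<otimes> x) \<otimes> (x \<otimes> y) \<in> convex_below G P a"
proof -
  let ?C = "convex_span G P a" and ?D = "convex_below G P a"
  define J where "J = P \<inter> ?C - ?D"
  have J: "rel_cone G ?D ?C J"
    unfolding J_def
    by (rule rel_cone_between[OF convex_below_P[OF a] convex_span_carrier[OF a] below_span[OF a]])
  note JD = rel_coneD[OF J]
  obtain Q :: "'a set monoid" and \<pi> where q: "quotient_map G ?D ?C Q \<pi>"
    using quotient_map_exists[OF JD(1-3) below_normal[OF a]] by blast
  note qD = quotient_mapD[OF q JD(1,2)]
  interpret Q: group Q
    by (rule qD(1))
  interpret Q: archimedean_group Q "\<pi> ` J"
  proof unfold_locales
    show "cone Q (\<pi> ` J)"
      by (rule quotient_cone(1)[OF q J])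
    fix X Y
    assume "X \<in> \<pi> ` J" "Y \<in> \<pi> ` J"
    then obtain x y where x: "x \<in> J" "X = \<pi> x" and y: "y \<in> J" "Y = \<pi> y"
      by blast
    have c: "x \<in> ?C" "y \<in> ?C" "x \<in> P" "x \<notin> ?D"
      using x y unfolding J_def by auto
    obtain n :: nat where n: "inv y \<otimes> x [^] n \<in> P"
      using span_archimedean[OF a c(3,4,2)] by blast
    have cc: "x \<in> carrier G" "y \<in> carrier G"
      using JD(6) c by auto
    have wC: "inv y \<otimes> x [^] n \<in> ?C"
      using subgroup.m_closed[OF JD(2) subgroup.m_inv_closed[OF JD(2) c(2)] subgroup_pow[OF JD(2) c(1)]] .
    \<comment> \<open>The positive element \<open>inv y \<otimes> x [^] n\<close> may lie in
      \<open>?D\<close> and become trivial in the quotient; one more factor x takes it out.\<close>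
    have "(inv y \<otimes> x [^] n) \<otimes> x \<in> J"
    proof (cases "inv y \<otimes> x [^] n \<in> ?D")
      case True
      then show ?thesis
        using JD(9)[OF x(1)] by blast
    next
      case False
      then show ?thesis
        using JD(8)[OF _ x(1)] n wC unfolding J_def by blast
    qed
    then have "inv y \<otimes> x [^] Suc n \<in> J"
      using cc by (simp add: m_assoc)
    then have "\<pi> (inv y \<otimes> x [^] Suc n) \<in> \<pi> ` J"
      by blast
    moreover have "\<pi> (inv y \<otimes> x [^] Suc n) = inv\<^bsub>Q\<^esub> Y \<otimes>\<^bsub>Q\<^esub> X [^]\<^bsub>Q\<^esub> Suc n"
      using qD(3)[OF subgroup.m_inv_closed[OF JD(2) c(2)] subgroup_pow[OF JD(2) c(1), of "Suc n"]]
        qD(5)[OF c(2)] qD(6)[OF c(1), of "Suc n"] x(2) y(2) by simp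
    ultimately show "\<exists>n::nat. inv\<^bsub>Q\<^esub> Y \<otimes>\<^bsub>Q\<^esub> X [^]\<^bsub>Q\<^esub> n \<in> \<pi> ` J"
      by metis
  qed
  have "\<pi> (y \<otimes> x) = \<pi> (x \<otimes> y)"
    using Q.archimedean_commute[of "\<pi> x" "\<pi> y"] qD(2,3) xy by simp
  then show ?thesis
    using qD(7)[of "y \<otimes> x" "x \<otimes> y"] subgroup.m_closed[OF JD(2)] xy by simp
qed

lemma jump_cone:
  assumes "a \<in> P"
  shows "rel_cone G (convex_below G P a) (convex_span G P a)
    (P \<inter> convex_span G P a - convex_below G P a)"
  by (rule rel_cone_between[OF convex_below_P convex_span_carrier below_span]) (rule assms)+

text \<open>Two independent elements in a jump would give a Cantor family there by the abelian case,
  with the signs outside the jump kept.\<close>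

lemma jump_rank_one:
  assumes F: "finite F" "F \<subseteq> P" and no: "\<not> cantor_many G {\<one>} (carrier G) F" and a: "a \<in> P"
  shows "rank_one G (convex_below G P a) (P \<inter> convex_span G P a - convex_below G P a)"
proof (rule ccontr)
  let ?C = "convex_span G P a" and ?D = "convex_below G P a"
  assume "\<not> rank_one G ?D (P \<inter> ?C - ?D)"
  then obtain x y where xy: "x \<in> P \<inter> ?C - ?D" "y \<in> P \<inter> ?C - ?D"
    and indep: "\<And>(m::nat) (n::nat). 0 < m \<Longrightarrow> 0 < n \<Longrightarrow> inv (x [^] m) \<otimes> y [^] n \<notin> ?D"
    unfolding rank_one_def by blast
  have "cantor_many G ?D ?C (F \<inter> (?C - ?D))"
    by (rule cantor_many_abelian_quotient[OF jump_cone[OF a] below_normal[OF a] jump_abelian[OF a]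
          _ _ xy indep]) (use F in auto)
  then show False
    using no cantor_many_between_convex[OF cone convex_below_P[OF a] convex_span_carrier[OF a] F(2)]
    by blast
qed

definition convex_in_all_orders :: "'a set \<Rightarrow> bool"
  where "convex_in_all_orders H \<longleftrightarrow> (\<forall>R E. rel_cone G {\<one>} H R \<longrightarrow> convex_subgroup G P E \<longrightarrow>
    E \<subseteq> H \<longrightarrow> rel_cone G E H (R - E))"

text \<open>Conjugation by \<open>inv h\<close> turns the order of \<open>?K\<close> into another
  one, for which \<open>?L\<close> is convex by hypothesis. Conjugating back, the conjugate of
  \<open>?L\<close> by h is convex for \<open>P\<close>; it misses b, and \<open>?L\<close> is the
  largest convex subgroup that does.\<close>

lemma normal_of_convex_in_all_orders:
  assumes b: "b \<in> P" and all: "convex_in_all_orders (convex_span G P b)"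
    and h: "h \<in> carrier G"
    and normal: "\<And>k. k \<in> convex_span G P b \<Longrightarrow> h \<otimes> k \<otimes> inv h \<in> convex_span G P b"
      "\<And>k. k \<in> convex_span G P b \<Longrightarrow> inv h \<otimes> k \<otimes> h \<in> convex_span G P b"
    and l: "l \<in> convex_below G P b"
  shows "h \<otimes> l \<otimes> inv h \<in> convex_below G P b"
proof -
  let ?K = "convex_span G P b" and ?L = "convex_below G P b"
  note KD = rel_coneD[OF convex_span_carrier[OF b]]
  have Kc: "x \<in> carrier G" if "x \<in> ?K" for x
    using KD(3) that by blast
  define c where "c x = h \<otimes> x \<otimes> inv h" for x
  define d where "d x = inv h \<otimes> x \<otimes> inv (inv h)" for x
  have cd: "c (d x) = x" "d (c x) = x" if "x \<in> carrier G" for x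
    unfolding c_def d_def using that h by (simp_all add: m_assoc)
  have cK: "c x \<in> ?K" "d x \<in> ?K" if "x \<in> ?K" for x
    using normal that h unfolding c_def d_def by auto
  have cK': "c ` ?K = ?K" "d ` ?K = ?K"
  proof -
    have "x \<in> c ` ?K" "x \<in> d ` ?K" if x: "x \<in> ?K" for x
      using imageI[OF cK(2)[OF x], of c] imageI[OF cK(1)[OF x], of d] cd Kc[OF x] by simp_all
    then show "c ` ?K = ?K" "d ` ?K = ?K"
      using cK by blast+
  qed
  have "rel_cone G {\<one>} ?K (P \<inter> ?K)"
    using KD(1,3) subgroup.one_closed[OF KD(1)] by (intro rel_cone_restrict[OF cone]) auto
  from rel_cone_conj[OF this, of "inv h"] have "rel_cone G (d ` {\<one>}) (d ` ?K) (d ` (P \<inter> ?K))"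
    using h unfolding d_def by simp
  then have "rel_cone G {\<one>} ?K (d ` (P \<inter> ?K))"
    unfolding cK' using h by (simp add: d_def)
  then have "rel_cone G ?L ?K (d ` (P \<inter> ?K) - ?L)"
    using all convex_below_P[OF b] below_span[OF b] unfolding convex_in_all_orders_def by blast
  from rel_cone_conj[OF this h] have "rel_cone G (c ` ?L) (c ` ?K) (c ` (d ` (P \<inter> ?K) - ?L))"
    unfolding c_def .
  moreover have "c ` (d ` (P \<inter> ?K) - ?L) = P \<inter> ?K - c ` ?L"
  proof
    show "c ` (d ` (P \<inter> ?K) - ?L) \<subseteq> P \<inter> ?K - c ` ?L"
    proof
      fix y
      assume "y \<in> c ` (d ` (P \<inter> ?K) - ?L)"
      then obtain x where x: "x \<in> P" "x \<in> ?K" "d x \<notin> ?L" "y = c (d x)"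
        by blast
      then have "y = x"
        using cd Kc by simp
      moreover have "x \<notin> c ` ?L"
        using x(3) cd(2) Kc below_span[OF b] by (auto simp: subset_iff)
      ultimately show "y \<in> P \<inter> ?K - c ` ?L"
        using x by blast
    qed
    show "P \<inter> ?K - c ` ?L \<subseteq> c ` (d ` (P \<inter> ?K) - ?L)"
    proof
      fix x
      assume x: "x \<in> P \<inter> ?K - c ` ?L"
      then have "x = c (d x)"
        using cd Kc by simp
      moreover from this have "d x \<notin> ?L"
        using x by blast
      ultimately show "x \<in> c ` (d ` (P \<inter> ?K) - ?L)"
        using x by blast
    qed
  qed
  ultimately have 1: "rel_cone G (c ` ?L) ?K (P \<inter> ?K - c ` ?L)"
    using cK' by simp
  \<comment> \<open>Keeping \<open>P\<close> outside \<open>?K\<close> turns convexity inside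
    \<open>?K\<close> into convexity in the whole group.\<close>
  have "(P \<inter> ?K - c ` ?L) \<union> (P - ?K) = P - c ` ?L"
    using rel_coneD(3)[OF 1] by blast
  then have conv: "convex_subgroup G P (c ` ?L)"
    using rel_cone_trans[OF 1 convex_span_carrier[OF b]] by simp
  have "b \<notin> c ` ?L"
  proof
    assume "b \<in> c ` ?L"
    then have "?K \<subseteq> c ` ?L"
      using convex_span(3)[OF cone P_carrier[OF b] conv] by blast
    moreover have bK: "b \<in> ?K" "b \<notin> ?L"
      using a_jump[OF b] by auto
    ultimately have "c b \<in> c ` ?L"
      using cK by blast
    then obtain l where l: "l \<in> ?L" "c b = c l"
      by blast
    then have "b = l"
      using cd(2) Kc bK(1) below_span[OF b] by (metis subsetD)
    then show False
      using l(1) bK(2) by simp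
  qed
  then have "c ` ?L \<subseteq> ?L"
    using convex_below(3)[OF cone _ conv] b one_notin by metis
  then show ?thesis
    using l unfolding c_def by blast
qed

text \<open>Failure of convexity excludes negative factors, and positive factors give a Cantor
  family, against \<open>no\<close>. The hypothesis \<open>all\<close> is used twice: it makes
  \<open>L\<close> normal in \<open>H\<close>, and it makes \<open>L\<close> convex for the
  restriction of \<open>R\<close> to \<open>K\<close>, as \<open>convex_of_negative_factor\<close>
  requires.\<close>

lemma convex_in_all_orders_span:
  assumes F: "finite F" "F \<subseteq> P" and no: "\<not> cantor_many G {\<one>} (carrier G) F"
    and a: "a \<in> P" and b: "b \<in> P" and K_eq: "convex_span G P b = convex_below G P a"
    and all: "convex_in_all_orders (convex_span G P b)" and R: "rel_cone G {\<one>} (convex_span G P a) R"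
  shows "rel_cone G (convex_below G P a) (convex_span G P a) (R - convex_below G P a)"
proof (rule ccontr)
  define H where "H = convex_span G P a"
  define K where "K = convex_span G P b"
  define L where "L = convex_below G P b"
  have K: "K = convex_below G P a"
    unfolding K_def by (rule K_eq)
  define PK where "PK = P \<inter> K - L"
  define PH where "PH = P \<inter> H - K"
  assume not_convex: "\<not> rel_cone G (convex_below G P a) (convex_span G P a) (R - convex_below G P a)"
  have PK: "rel_cone G L K PK"
    unfolding PK_def K_def L_def by (rule jump_cone[OF b])
  have PH: "rel_cone G K H PH"
    unfolding PH_def K H_def by (rule jump_cone[OF a])
  have K_normal: "h \<otimes> k \<otimes> inv h \<in> K" if "h \<in> H" "k \<in> K" for h k
    using below_normal[OF a, of h k] that unfolding H_def K .
  have Hc: "h \<in> carrier G" if "h \<in> H" for h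
    using rel_coneD(6)[OF PH] that by blast
  have Hi: "inv h \<in> H" if "h \<in> H" for h
    using subgroup.m_inv_closed[OF rel_coneD(2)[OF PH] that] .
  have L_normal: "h \<otimes> l \<otimes> inv h \<in> L" if h: "h \<in> H" and l: "l \<in> L" for h l
    unfolding L_def
  proof (rule normal_of_convex_in_all_orders[OF b all Hc[OF h]])
    show "h \<otimes> k \<otimes> inv h \<in> convex_span G P b" if "k \<in> convex_span G P b" for k
      using K_normal[OF h] that unfolding K_def .
    show "inv h \<otimes> k \<otimes> h \<in> convex_span G P b" if "k \<in> convex_span G P b" for k
      using K_normal[OF Hi[OF h]] that Hc[OF h] unfolding K_def by simp
    show "l \<in> convex_below G P b"
      using l unfolding L_def .
  qed
  have KH: "K \<subseteq> H"
    by (rule rel_coneD(3)[OF PH])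
  have bPK: "b \<in> PK"
    unfolding PK_def K_def L_def by (rule a_jump[OF b])
  have K_rank_one: "rank_one G L PK"
    unfolding PK_def K_def L_def by (rule jump_rank_one[OF F no b])
  have "\<exists>\<phi> :: 'a \<Rightarrow> real. (\<forall>x\<in>K. \<forall>y\<in>K. \<phi> (x \<otimes> y) = \<phi> x + \<phi> y) \<and>
      (\<forall>x\<in>K. \<phi> x \<in> \<rat>) \<and> (\<forall>x\<in>K. \<phi> x > 0 \<longleftrightarrow> x \<in> PK) \<and> \<phi> b = 1"
  proof (rule rational_hom_quotient[OF PK _ _ bPK K_rank_one])
    show "c \<otimes> d \<otimes> inv c \<in> L" if "c \<in> K" "d \<in> L" for c d
      using L_normal that KH by blast
    show "inv (y \<otimes> x) \<otimes> (x \<otimes> y) \<in> L" if "x \<in> K" "y \<in> K" for x y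
      using jump_abelian[OF b, of x y] that unfolding K_def L_def .
  qed
  then obtain \<phi> :: "'a \<Rightarrow> real" where \<phi>: "\<forall>x\<in>K. \<forall>y\<in>K. \<phi> (x \<otimes> y) = \<phi> x + \<phi> y"
    "\<forall>x\<in>K. \<phi> x \<in> \<rat>" "\<forall>x\<in>K. \<phi> x > 0 \<longleftrightarrow> x \<in> PK" "\<phi> b = 1"
    by blast
  interpret T: rank_one_tower G L K H PK PH b \<phi>
  proof unfold_locales
    show "inv (y \<otimes> x) \<otimes> (x \<otimes> y) \<in> K" if "x \<in> H" "y \<in> H" for x y
      using jump_abelian[OF a, of x y] that unfolding K H_def .
    show "rank_one G K PH"
      unfolding PH_def K H_def by (rule jump_rank_one[OF F no a])
  qed (use PK PH L_normal K_normal K_rank_one bPK \<phi> in auto)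
  have RH: "rel_cone G {\<one>} H R"
    using R unfolding H_def .
  have RK: "rel_cone G {\<one>} K (R \<inter> K)"
    using rel_cone_restrict[OF RH] rel_coneD(2)[OF PK] subgroup.one_closed[OF rel_coneD(2)[OF PK]] KH
    by simp
  have RL: "rel_cone G L K (R \<inter> K - L)"
    using all RK convex_below_P[OF b] rel_coneD(3)[OF PK]
    unfolding convex_in_all_orders_def K_def L_def by blast
  have nonneg: "0 \<le> T.mult_factor h" if "h \<in> H" for h
    using T.convex_of_negative_factor[OF RH RL that] not_convex unfolding H_def K by linarith
  have pos: "0 < T.mult_factor h" if "h \<in> H" for h
    using nonneg[OF that] T.factor_inv_mult[OF that] by (cases "T.mult_factor h = 0") auto
  have "cantor_many G L H (F \<inter> (H - L))"
  proof -
    have F': "finite (F \<inter> (H - L))" "F \<inter> (H - L) \<subseteq> PK \<union> PH"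
      using F unfolding PK_def PH_def by auto
    have aPH: "a \<in> PH"
      unfolding PH_def K H_def by (rule a_jump[OF a])
    show ?thesis
    proof (cases "\<exists>h\<in>H. T.mult_factor h \<noteq> 1")
      case False
      then show ?thesis
        using T.cantor_many_trivial_factor[OF _ F' aPH] by blast
    next
      case True
      then obtain h where h: "h \<in> H" "T.mult_factor h \<noteq> 1"
        by blast
      \<comment> \<open>Inverse elements have reciprocal factors, so a factor other than 1 yields
        one below 1.\<close>
      have "\<exists>h0\<in>H. T.mult_factor h0 < 1"
      proof (cases "T.mult_factor h < 1")
        case True
        then show ?thesis
          using h(1) by blast
      next
        case False
        then have "T.mult_factor (inv h) * 1 < T.mult_factor (inv h) * T.mult_factor h"
          using h(2) pos[OF Hi[OF h(1)]] by (intro mult_strict_left_mono) auto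
        then have "T.mult_factor (inv h) < 1"
          using T.factor_inv_mult[OF h(1)] by simp
        then show ?thesis
          using Hi[OF h(1)] by blast
      qed
      then show ?thesis
        using T.cantor_many_affine[OF pos _ _ F'] by blast
    qed
  qed
  then have "cantor_many G {\<one>} (carrier G) F"
    using cantor_many_between_convex[OF cone convex_below_P[OF b] convex_span_carrier[OF a] F(2)]
    unfolding L_def H_def by blast
  then show False
    using no by blast
qed

text \<open>A minimal counterexample M exists because finitely many spans leave finitely many convex
  subgroups. A proper convex subgroup of M lies below the last jump of M, where minimality applies;
  the last jump itself is settled by \<open>convex_in_all_orders_span\<close>.\<close>

lemma all_convex_in_all_orders:
  assumes F: "finite F" "F \<subseteq> P" and no: "\<not> cantor_many G {\<one>} (carrier G) F"
    and H: "convex_subgroup G P H"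
  shows "convex_in_all_orders H"
proof (rule ccontr)
  assume "\<not> convex_in_all_orders H"
  have fin: "finite (convex_span G P ` P)"
    using cantor_many_infinite_spans[OF cone F] no by blast
  define \<B> where "\<B> = {H. convex_subgroup G P H \<and> \<not> convex_in_all_orders H}"
  have "\<B> \<subseteq> insert {\<one>} (convex_span G P ` P)"
    unfolding \<B>_def using convex_is_span[OF fin] by blast
  then have "finite \<B>"
    using fin finite_subset by blast
  moreover have "\<B> \<noteq> {}"
    unfolding \<B>_def using H \<open>\<not> convex_in_all_orders H\<close> by blast
  ultimately have "\<exists>m\<in>\<B>. \<forall>X\<in>\<B>. X \<subseteq> m \<longrightarrow> m = X"
    using finite_has_minimal[of \<B>] by blast
  then obtain M where M: "convex_subgroup G P M" "\<not> convex_in_all_orders M"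
    and min: "\<And>X. convex_subgroup G P X \<Longrightarrow> X \<subset> M \<Longrightarrow> convex_in_all_orders X"
    unfolding \<B>_def by blast
  obtain R E where R: "rel_cone G {\<one>} M R" and E: "convex_subgroup G P E" "E \<subseteq> M"
    and bad: "\<not> rel_cone G E M (R - E)"
    using M(2) unfolding convex_in_all_orders_def by blast
  have "E \<noteq> {\<one>}"
    using bad convex_trivial[OF R] by blast
  have "M \<noteq> {\<one>}"
    using E(2) \<open>E \<noteq> {\<one>}\<close> subgroup.one_closed[OF rel_coneD(1)[OF E(1)]] by blast
  then obtain a where a: "a \<in> P" "M = convex_span G P a"
    using convex_is_span[OF fin M(1)] by blast
  define K where "K = convex_below G P a"
  have K: "convex_subgroup G P K" "K \<subseteq> M" "a \<notin> K" "a \<in> M"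
    unfolding K_def a(2) using convex_below_P[OF a(1)] below_span[OF a(1)] a_jump[OF a(1)] by auto
  have K_all: "convex_in_all_orders K"
    using min[OF K(1)] K by blast
  have "E \<noteq> M"
    using bad convex_carrier[OF R] by blast
  then have "a \<notin> E"
    using convex_span(3)[OF cone P_carrier[OF a(1)] E(1)] E(2) unfolding a(2) by blast
  then have EK: "E \<subseteq> K"
    unfolding K_def using convex_below(3)[OF cone _ E(1)] a(1) one_notin by metis
  \<comment> \<open>This provides the second jump, below \<open>K\<close>, that
    \<open>convex_in_all_orders_span\<close> asks for.\<close>
  then have "K \<noteq> {\<one>}"
    using \<open>E \<noteq> {\<one>}\<close> subgroup.one_closed[OF rel_coneD(1)[OF E(1)]] by blast
  then obtain b where b: "b \<in> P" "K = convex_span G P b"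
    using convex_is_span[OF fin K(1)] by blast
  have KM: "rel_cone G K M (R - K)"
    unfolding K_def a(2)
    using convex_in_all_orders_span[OF F no a(1) b(1)] b(2) K_all R unfolding K_def a(2) by simp
  have "rel_cone G {\<one>} K (R \<inter> K)"
    using rel_cone_restrict[OF R rel_coneD(1)[OF K(1)]] subgroup.one_closed[OF rel_coneD(1)[OF K(1)]]
      K(2) by simp
  then have "rel_cone G E K (R \<inter> K - E)"
    using K_all E(1) EK unfolding convex_in_all_orders_def by blast
  then have "rel_cone G E M ((R \<inter> K - E) \<union> (R - K))"
    by (rule rel_cone_trans[OF _ KM])
  moreover have "(R \<inter> K - E) \<union> (R - K) = R - E"
    using EK by blast
  ultimately show False
    using bad by simp
qed

text \<open>Each jump has rank one and lower end convex in every order, so an order either agrees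
  with \<open>P\<close> on a whole jump or reverses it there. Finitely many jumps leave finitely
  many sign patterns.\<close>

lemma finite_orderings_if_not_cantor_many:
  assumes F: "finite F" "F \<subseteq> P" and no: "\<not> cantor_many G {\<one>} (carrier G) F"
  shows "finite (orderings G)"
proof -
  let ?C = "convex_span G P"
  have fin: "finite (?C ` P)"
    using cantor_many_infinite_spans[OF cone F] no by blast
  have all: "convex_in_all_orders (carrier G)"
    using all_convex_in_all_orders[OF F no convex_carrier[OF cone]] .
  have convex: "convex_subgroup G R (convex_below G P a)" if "cone G R" "a \<in> P" for R a
    using all that convex_below_P[OF that(2)] rel_coneD(3)[OF convex_below_P[OF that(2)]]
    unfolding convex_in_all_orders_def by blast
  \<comment> \<open>Positive elements with the same span have positive powers that differ by a
    factor from the subgroup below, which is convex for R, so that this factor cannot change the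
    sign.\<close>
  have transfer: "y \<in> R"
    if R: "cone G R" and x: "x \<in> P" "x \<in> R" and y: "y \<in> P" and eq: "?C x = ?C y" for R x y
  proof -
    let ?D = "convex_below G P x"
    have D: "?D = convex_below G P y"
      using convex_below_eq[OF cone _ _ _ _ eq] P_carrier x(1) y one_notin by metis
    have xJ: "x \<in> P \<inter> ?C x - ?D" and yJ: "y \<in> P \<inter> ?C x - ?D"
      using a_jump[OF x(1)] a_jump[OF y] unfolding D eq by auto
    obtain m n :: nat where mn: "0 < m" "0 < n" "inv (x [^] m) \<otimes> y [^] n \<in> ?D"
      using jump_rank_one[OF F no x(1)] xJ yJ unfolding rank_one_def by blast
    note RD = convex[OF R x(1)]
    have "x \<in> R - ?D"
      using x(2) xJ by blast
    then have "x [^] m \<otimes> (inv (x [^] m) \<otimes> y [^] n) \<in> R - ?D"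
      using rel_coneD(10)[OF RD cone_pow[OF RD _ mn(1)] mn(3)] by blast
    then have "y [^] n \<in> R - ?D"
      using P_carrier[OF x(1)] P_carrier[OF y] by simp
    then show ?thesis
      using cone_pow_iff[OF RD P_carrier[OF y] _ mn(2)] yJ by blast
  qed
  \<comment> \<open>The spans, one for each jump, on which r agrees with \<open>P\<close>.\<close>
  define code where "code r = ?C ` (P \<inter> pos_cone G r)" for r
  have "inj_on code (orderings G)"
  proof (rule inj_onI)
    fix r s
    assume rs: "r \<in> orderings G" "s \<in> orderings G" and eq: "code r = code s"
    have P_agree: "x \<in> pos_cone G s"
      if "x \<in> pos_cone G r" "x \<in> P" "s \<in> orderings G" "code r = code s" for x r s
    proof -
      have "?C x \<in> code r"
        using that(1,2) unfolding code_def by (intro imageI) simp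
      then have "?C x \<in> ?C ` (P \<inter> pos_cone G s)"
        using that(4) unfolding code_def by simp
      then obtain y where y: "?C x = ?C y" "y \<in> P" "y \<in> pos_cone G s"
        by (elim imageE) simp
      show ?thesis
        by (rule transfer[OF cone_pos_cone[OF that(3)] y(2,3) that(2) y(1)[symmetric]])
    qed
    have sub: "pos_cone G r \<subseteq> pos_cone G s"
      if "r \<in> orderings G" "s \<in> orderings G" "code r = code s" for r s
    proof
      fix x
      assume x: "x \<in> pos_cone G r"
      note rD = rel_coneD[OF cone_pos_cone[OF that(1)]]
      note sD = rel_coneD[OF cone_pos_cone[OF that(2)]]
      have c: "x \<in> carrier G" "x \<noteq> \<one>"
        using x rD(5) rD(7)[OF x] by auto
      show "x \<in> pos_cone G s"
      proof (cases "x \<in> P")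
        case True
        then show ?thesis
          using P_agree[OF x _ that(2,3)] by blast
      next
        case False
        then have "inv x \<in> P"
          using inv_P_iff c by blast
        then have "inv x \<notin> pos_cone G s"
          using P_agree[OF _ _ that(1) that(3)[symmetric], of "inv x"]
            cone_inv[OF cone_pos_cone[OF that(1)] x] by blast
        then show ?thesis
          using sD(11)[of x] c by blast
      qed
    qed
    have "pos_cone G r = pos_cone G s"
      using sub[OF rs eq] sub[OF rs(2,1) eq[symmetric]] by blast
    then show "r = s"
      using order_of_pos_cone rs by metis
  qed
  moreover have "code ` orderings G \<subseteq> Pow (?C ` P)"
    unfolding code_def by blast
  ultimately show ?thesis
    using fin inj_on_finite by (metis finite_Pow_iff)
qed

end

theorem proposition4p1:
  fixes G :: "('a, 'b) monoid_scheme"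
  assumes "group G"
    and "conrad_orderable G"
    and "infinite (orderings G)"
  shows "\<forall>r N. conradian G r \<longrightarrow> neighborhood_of (orderings_topology G) r N \<longrightarrow>
    (\<exists>K\<subseteq>N. subtopology (orderings_topology G) K homeomorphic_space
              top_of_set cantor_set)"
proof (intro allI impI)
  fix r N
  assume r: "conradian G r" and N: "neighborhood_of (orderings_topology G) r N"
  interpret group G
    by (rule assms(1))
  have ord: "r \<in> orderings G"
    using r unfolding conradian_def by blast
  have cone: "cone G (pos_cone G r)"
    by (rule cone_pos_cone[OF ord])
  interpret conradian_group G "pos_cone G r"
  proof unfold_locales
    fix f g
    assume f: "f \<in> pos_cone G r" and g: "g \<in> pos_cone G r"
    then have "\<exists>n::nat. strictly r g (f \<otimes>\<^bsub>G\<^esub> g [^]\<^bsub>G\<^esub> n)"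
      using r unfolding conradian_def pos_cone_def by blast
    moreover have "f \<in> carrier G" "g \<in> carrier G"
      using f g unfolding pos_cone_def by auto
    ultimately show "\<exists>n::nat. inv\<^bsub>G\<^esub> g \<otimes>\<^bsub>G\<^esub> (f \<otimes>\<^bsub>G\<^esub> g [^]\<^bsub>G\<^esub> n) \<in> pos_cone G r"
      using strictly_iff_pos_cone[OF ord] by (metis m_closed nat_pow_closed)
  qed (rule cone)
  obtain U where U: "openin (orderings_topology G) U" "r \<in> U" "U \<subseteq> N"
    using N unfolding neighborhood_of_def by blast
  obtain F where F: "finite F" "F \<subseteq> pos_cone G r"
    and FU: "\<And>P. cone G P \<Longrightarrow> F \<subseteq> P \<Longrightarrow> order_of G P \<in> U"
    using open_contains_cone_nbhd[OF U(1,2)] by blast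
  \<comment> \<open>Without a Cantor family through this \<open>F\<close> there would be only
    finitely many orders.\<close>
  have "cantor_many G {\<one>\<^bsub>G\<^esub>} (carrier G) F"
    using finite_orderings_if_not_cantor_many[OF F] assms(3) by blast
  from cantor_many_imp_cantor_set[OF this] obtain K
    where K: "\<forall>s\<in>K. \<exists>P. cone G P \<and> F \<subseteq> P \<and> s = order_of G P"
      "subtopology (orderings_topology G) K homeomorphic_space top_of_set cantor_set"
    by blast
  have "K \<subseteq> N"
  proof
    fix s
    assume "s \<in> K"
    then obtain P where "cone G P" "F \<subseteq> P" "s = order_of G P"
      using K(1) by blast
    then show "s \<in> N"
      using FU[of P] U(3) by auto
  qed
  with K(2) show "\<exists>K\<subseteq>N. subtopology (orderings_topology G) K homeomorphic_space top_of_set cantor_set"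
    by (intro exI[of _ K] conjI)
qed

end
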